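(* Assume the modular curve $X(\Gamma)$ of $\Gamma=N+S$ has genus $g$ and $i\infty$ is not a Weierstrass point of $X(\Gamma)$. For $\tau_1,\tau_2\in\mathbb H$ and $q_2=e^{2\pi i\tau_2}$, $$\sum_{n=0}^\infty J_{\Gamma,n}(\tau_1)q_2^n-\sum_{l=1}^g h_{\Gamma,-l}(\tau_2)J_{\Gamma,l}(\tau_1)=\sum_{n=0}^\infty f_{\Gamma,n}(\tau_1)q_2^n,$$ as an identity of $q_2$-expansions (i.e. of power series in $q_2$ with coefficients functions of $\tau_1$).
   Context: For a positive integer $N$ and a set $S$ of exact divisors $Q$ of $N$ ($Q\mid N$, $\gcd(Q,N/Q)=1$), $\Gamma=N+S$ is the subgroup of $\mathrm{PSL}_2(\mathbb R)$ generated by $\Gamma_0(N)$ and the Atkin-Lehner involutions $W_{Q,N}=\begin{pmatrix}Qx&y\\ Nz&Qw\end{pmatrix}$ ($x,y,z,w\in\mathbb Z$, determinant $Q$), $Q\in S$. $X(\Gamma)$ is the compactified modular curve $\Gamma\backslash(\mathbb H\cup\mathbb Q\cup\{i\infty\})$; $q=e^{2\pi i\tau}$. The functions $J_{\Gamma,n}$. Let $\Gamma_\infty=\{\pm\begin{pmatrix}1&t\\0&1\end{pmatrix}:t\in\mathbb Z\}$, $e(x)=e^{2\pi i x}$, and for $n\in\mathbb N$, $\mathrm{Re}(s)>1$ put $$G_{\Gamma,-n}(\tau,s)=2\pi\sum_{\gamma\in\Gamma_\infty\backslash\Gamma}f_n(\gamma\tau),\qquad f_n(\tau)=e(-n\,\mathrm{Re}\,\tau)\,(n\,\mathrm{Im}\,\tau)^{1/2}I_{s-\frac12}(2\pi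 n\,\mathrm{Im}\,\tau),$$ with $I$ the $I$-Bessel function. It continues analytically to $\mathrm{Re}(s)>1/2$; set $j_{\Gamma,n}(\tau)=G_{\Gamma,-n}(\tau,1)$, a $\Gamma$-invariant harmonic function with expansion $j_{\Gamma,n}=q^{-n}-\bar q^n+c_\Gamma(n,0)+\sum_{\ell\ge1}(c_\Gamma(n,\ell)q^\ell+c_\Gamma(n,-\ell)\bar q^\ell)$. Define $J_{\Gamma,n}=j_{\Gamma,n}-c_\Gamma(n,0)$ for $n\ge1$ and $J_{\Gamma,0}=1$. $M_0^{!,\infty}(\Gamma)$ is the space of weakly holomorphic modular functions on $\Gamma$ whose poles are supported only at $i\infty$ and which are holomorphic at the other cusps. Since $i\infty$ is not a Weierstrass point, for each $m\ge g+1$ there is a unique $f_{\Gamma,m}=q^{-m}+\sum_{l=1}^g a_\Gamma(m,-l)q^{-l}+O(q)\in M_0^{!,\infty}(\Gamma)$ (zero constant term); put $f_{\Gamma,0}=1$ and $f_{\Gamma,m}=0$ for $1\le m\le g$. For $1\le l\le g$, $h_{\Gamma,-l}=q^l+O(q^{g+1})$ are the unique elements of the basis of this form of the space $S_2(\Gamma)$ of weight $2$ cusp forms on $\Gamma$. *)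

theory Defs
  imports "HOL-Complex_Analysis.Complex_Analysis" "HOL-Homology.Homology"
    "HOL-Computational_Algebra.Formal_Power_Series"
begin

subsection \<open>The groups $N+S$\<close>

definition mat2 :: "real \<Rightarrow> real \<Rightarrow> real \<Rightarrow> real \<Rightarrow> real^2^2" where
  "mat2 a b c d = vector [vector [a, b], vector [c, d]]"

lemma mat2_nth [simp]:
  "mat2 a b c d $ 1 $ 1 = a" "mat2 a b c d $ 1 $ 2 = b"
  "mat2 a b c d $ 2 $ 1 = c" "mat2 a b c d $ 2 $ 2 = d"
  by (simp_all add: mat2_def)

definition SL2R :: "(real^2^2) monoid" where
  "SL2R = \<lparr>carrier = {A. det A = 1}, mult = (**), one = mat 1\<rparr>"

lemma group_SL2R: "group SL2R"
proof (rule groupI)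
  fix A assume "A \<in> carrier SL2R"
  then have d: "det A = 1" by (simp add: SL2R_def)
  then have "invertible A" by (simp add: invertible_det_nz)
  then obtain B where B: "B ** A = mat 1" by (auto simp: invertible_def)
  then have "det B = 1" using d det_mul[of B A] by simp
  then show "\<exists>y\<in>carrier SL2R. y \<otimes>\<^bsub>SL2R\<^esub> A = \<one>\<^bsub>SL2R\<^esub>"
    using B by (auto simp: SL2R_def)
qed (auto simp: SL2R_def det_mul matrix_mul_assoc)

definition SL2Z :: "(real^2^2) set" where
  "SL2Z = {mat2 (of_int a) (of_int b) (of_int c) (of_int d) | a b c d :: int. a * d - b * c = 1}"

definition Gamma0 :: "nat \<Rightarrow> (real^2^2) set" where
  "Gamma0 N = {mat2 (of_int a) (of_int b) (of_int c) (of_int d) | a b c d :: int.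
     a * d - b * c = 1 \<and> int N dvd c}"

definition exact_divisors :: "nat \<Rightarrow> nat set" where
  "exact_divisors N = {Q. Q dvd N \<and> coprime Q (N div Q)}"

text \<open>The integral matrices of determinant $Q$ are scaled by $Q^{-1/2}$ to lie in
  $\mathrm{SL}_2(\mathbb{R})$.\<close>

definition atkin_lehner :: "nat \<Rightarrow> nat \<Rightarrow> (real^2^2) set" where
  "atkin_lehner N Q =
     {mat2 (of_int (int Q * x) / sqrt Q) (of_int y / sqrt Q)
           (of_int (int N * z) / sqrt Q) (of_int (int Q * w) / sqrt Q) | x y z w :: int.
        (int Q * x) * (int Q * w) - y * (int N * z) = int Q}"

text \<open>A subgroup of $\mathrm{PSL}_2(\mathbb{R})$ is represented by its full preimage in
  $\mathrm{SL}_2(\mathbb{R})$; here $-1$ lies in \<open>Gamma0 N\<close>.\<close>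

definition Gamma_plus :: "nat \<Rightarrow> nat set \<Rightarrow> (real^2^2) set" where
  "Gamma_plus N S = generate SL2R (Gamma0 N \<union> (\<Union>Q\<in>S. atkin_lehner N Q))"

definition Gamma_inf :: "(real^2^2) set" where
  "Gamma_inf = {mat2 e (e * of_int t) 0 e | e (t::int). e = 1 \<or> e = -1}"


subsection \<open>The modular curve and its genus\<close>

abbreviation uhp :: "complex set" where
  "uhp \<equiv> {\<tau>. Im \<tau> > 0}"

definition autom :: "real^2^2 \<Rightarrow> complex \<Rightarrow> complex" where
  "autom A z = of_real (A$2$1) * z + of_real (A$2$2)"

definition moeb :: "real^2^2 \<Rightarrow> complex \<Rightarrow> complex" where
  "moeb A z = (of_real (A$1$1) * z + of_real (A$1$2)) / autom A z"

text \<open>On the Riemann sphere, \<open>None\<close> is the point at infinity $i\infty$.\<close>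

fun ext_moeb :: "real^2^2 \<Rightarrow> complex option \<Rightarrow> complex option" where
  "ext_moeb A None =
     (if A$2$1 = 0 then None else Some (of_real (A$1$1) / of_real (A$2$1)))"
| "ext_moeb A (Some z) = (if autom A z = 0 then None else Some (moeb A z))"

definition ext_uhp :: "complex option set" where
  "ext_uhp = insert None (Some ` (uhp \<union> \<rat>))"

text \<open>Neighbourhoods of $i\infty$ contain a half plane $\mathrm{Im}\,\tau > c$; neighbourhoods
  of a rational $r$ contain an open disc in the upper half plane tangent to the real line at $r$.\<close>

definition ext_open :: "complex option set \<Rightarrow> bool" where
  "ext_open U \<longleftrightarrow> U \<subseteq> ext_uhp \<and> open {z \<in> uhp. Some z \<in> U} \<and>
     (None \<in> U \<longrightarrow> (\<exists>c>0. \<forall>z. Im z > c \<longrightarrow> Some z \<in> U)) \<and>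
     (\<forall>r\<in>\<rat>. Some (complex_of_real r) \<in> U \<longrightarrow>
        (\<exists>e>0. \<forall>z\<in>ball (Complex r e) e. Some z \<in> U))"

lemma ext_open_None:
  "ext_open U \<Longrightarrow> None \<in> U \<Longrightarrow> \<exists>c>0. \<forall>z. Im z > c \<longrightarrow> Some z \<in> U"
  by (simp add: ext_open_def)

lemma ext_open_Some:
  "ext_open U \<Longrightarrow> r \<in> \<rat> \<Longrightarrow> Some (complex_of_real r) \<in> U \<Longrightarrow>
     \<exists>e>0. \<forall>z\<in>ball (Complex r e) e. Some z \<in> U"
  by (simp only: ext_open_def)

lemma istopology_ext_open: "istopology ext_open"
  unfolding istopology_def
proof (intro conjI allI impI)
  fix U V assume U: "ext_open U" and V: "ext_open V"
  have "{z \<in> uhp. Some z \<in> U \<inter> V} = {z \<in> uhp. Some z \<in> U} \<inter> {z \<in> uhp. Some z \<in> V}"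
    by auto
  moreover have "open {z \<in> uhp. Some z \<in> U}" "open {z \<in> uhp. Some z \<in> V}"
    using U V unfolding ext_open_def by simp_all
  ultimately have 1: "open {z \<in> uhp. Some z \<in> U \<inter> V}"
    by (simp only: open_Int)
  have 2: "\<exists>c>0. \<forall>z. Im z > c \<longrightarrow> Some z \<in> U \<inter> V" if n: "None \<in> U \<inter> V"
  proof -
    obtain c where "c > 0" "\<forall>z. Im z > c \<longrightarrow> Some z \<in> U"
      using ext_open_None[OF U] n by auto
    moreover obtain d where "d > 0" "\<forall>z. Im z > d \<longrightarrow> Some z \<in> V"
      using ext_open_None[OF V] n by auto
    ultimately show ?thesis by (intro exI[of _ "max c d"]) auto
  qed
  have 3: "\<exists>e>0. \<forall>z\<in>ball (Complex r e) e. Some z \<in> U \<inter> V"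
    if r: "r \<in> \<rat>" "Some (complex_of_real r) \<in> U \<inter> V" for r
  proof -
    obtain c where c: "c > 0" "\<forall>z\<in>ball (Complex r c) c. Some z \<in> U"
      using ext_open_Some[OF U r(1)] r(2) by (auto simp del: mem_ball)
    obtain d where d: "d > 0" "\<forall>z\<in>ball (Complex r d) d. Some z \<in> V"
      using ext_open_Some[OF V r(1)] r(2) by (auto simp del: mem_ball)
    have sub: "ball (Complex r e) e \<subseteq> ball (Complex r e') e'" if "0 < e" "e \<le> e'" for e e'
    proof -
      have "Complex r e - Complex r e' = Complex 0 (e - e')"
        by (simp add: complex_eq_iff)
      then have "dist (Complex r e) (Complex r e') = e' - e"
        using that by (simp add: dist_norm norm_complex_def)
      then show ?thesis using that by (simp add: ball_subset_ball_iff)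
    qed
    have "min c d > 0" using c d by simp
    moreover have "Some z \<in> U \<inter> V" if "z \<in> ball (Complex r (min c d)) (min c d)" for z
      using that sub[of "min c d" c] sub[of "min c d" d] c d \<open>min c d > 0\<close>
      by (metis IntI min.cobounded1 min.cobounded2 subsetD)
    ultimately show ?thesis by blast
  qed
  have 4: "U \<inter> V \<subseteq> ext_uhp"
    using U by (auto simp: ext_open_def)
  show "ext_open (U \<inter> V)"
    unfolding ext_open_def using 4 1 2 3 by (intro conjI impI ballI)
next
  fix K assume K: "\<forall>U\<in>K. ext_open U"
  have "{z \<in> uhp. Some z \<in> \<Union>K} = (\<Union>U\<in>K. {z \<in> uhp. Some z \<in> U})"
    by auto
  moreover have "open (\<Union>U\<in>K. {z \<in> uhp. Some z \<in> U})"
    using K by (intro open_UN) (simp add: ext_open_def)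
  ultimately have 1: "open {z \<in> uhp. Some z \<in> \<Union>K}" by simp
  have 2: "\<exists>c>0. \<forall>z. Im z > c \<longrightarrow> Some z \<in> \<Union>K" if n: "None \<in> \<Union>K"
  proof -
    obtain U where U: "U \<in> K" "None \<in> U" using n by auto
    then obtain c where "c > 0" "\<forall>z. Im z > c \<longrightarrow> Some z \<in> U"
      using ext_open_None[of U] K by auto
    then show ?thesis using U by (intro exI[of _ c]) auto
  qed
  have 3: "\<exists>e>0. \<forall>z\<in>ball (Complex r e) e. Some z \<in> \<Union>K"
    if r: "r \<in> \<rat>" "Some (complex_of_real r) \<in> \<Union>K" for r
  proof -
    obtain U where U: "U \<in> K" "Some (complex_of_real r) \<in> U" using r by auto
    then obtain e where "e > 0" "\<forall>z\<in>ball (Complex r e) e. Some z \<in> U"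
      using ext_open_Some[of U r] K r(1) by (auto simp del: mem_ball)
    then show ?thesis using U by (intro exI[of _ e]) (auto simp del: mem_ball)
  qed
  have 4: "\<Union>K \<subseteq> ext_uhp"
    using K by (auto simp: ext_open_def)
  show "ext_open (\<Union>K)"
    unfolding ext_open_def using 4 1 2 3 by (intro conjI impI ballI)
qed

definition orbit_of :: "(real^2^2) set \<Rightarrow> complex option \<Rightarrow> complex option set" where
  "orbit_of \<Gamma> x = (\<lambda>\<gamma>. ext_moeb \<gamma> x) ` \<Gamma>"

text \<open>The points of $X(\Gamma)$ are the orbits, with the quotient topology.\<close>

definition modular_curve :: "(real^2^2) set \<Rightarrow> (complex option set) topology" where
  "modular_curve \<Gamma> = topology (\<lambda>V. V \<subseteq> orbit_of \<Gamma> ` ext_uhp \<and>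
     openin (topology ext_open) {x \<in> ext_uhp. orbit_of \<Gamma> x \<in> V})"

lemma openin_modular_curve:
  "openin (modular_curve \<Gamma>) V \<longleftrightarrow> V \<subseteq> orbit_of \<Gamma> ` ext_uhp \<and>
     openin (topology ext_open) {x \<in> ext_uhp. orbit_of \<Gamma> x \<in> V}"
proof -
  have "istopology (\<lambda>V. V \<subseteq> orbit_of \<Gamma> ` ext_uhp \<and>
     openin (topology ext_open) {x \<in> ext_uhp. orbit_of \<Gamma> x \<in> V})" (is "istopology ?P")
    unfolding istopology_def
  proof (intro conjI allI impI)
    fix U V assume "?P U" "?P V"
    moreover have "{x \<in> ext_uhp. orbit_of \<Gamma> x \<in> U \<inter> V} =
      {x \<in> ext_uhp. orbit_of \<Gamma> x \<in> U} \<inter> {x \<in> ext_uhp. orbit_of \<Gamma> x \<in> V}" by auto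
    ultimately show "U \<inter> V \<subseteq> orbit_of \<Gamma> ` ext_uhp"
      "openin (topology ext_open) {x \<in> ext_uhp. orbit_of \<Gamma> x \<in> U \<inter> V}"
      by auto
  next
    fix K assume K: "\<forall>U\<in>K. ?P U"
    have "{x \<in> ext_uhp. orbit_of \<Gamma> x \<in> \<Union>K} = (\<Union>U\<in>K. {x \<in> ext_uhp. orbit_of \<Gamma> x \<in> U})"
      by auto
    moreover have "openin (topology ext_open) (\<Union>U\<in>K. {x \<in> ext_uhp. orbit_of \<Gamma> x \<in> U})"
      using K by (intro openin_Union) auto
    ultimately show "openin (topology ext_open) {x \<in> ext_uhp. orbit_of \<Gamma> x \<in> \<Union>K}"
      by simp
    show "\<Union>K \<subseteq> orbit_of \<Gamma> ` ext_uhp" using K by blast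
  qed
  then show ?thesis by (simp add: modular_curve_def)
qed

text \<open>The genus of a closed oriented surface: half the rank of its first homology group.\<close>

definition has_genus :: "'a topology \<Rightarrow> nat \<Rightarrow> bool" where
  "has_genus X g \<longleftrightarrow> homology_group 1 X \<cong> free_Abelian_group {..<2 * g}"


subsection \<open>Modular forms\<close>

definition ee :: "complex \<Rightarrow> complex" where
  "ee x = exp (2 * of_real pi * \<i> * x)"

text \<open>$f(\tau) = \sum_{k \ge m} a_k q^{k/w}$ on the upper half plane.\<close>

definition has_q_expansion :: "nat \<Rightarrow> int \<Rightarrow> (int \<Rightarrow> complex) \<Rightarrow> (complex \<Rightarrow> complex) \<Rightarrow> bool" where
  "has_q_expansion w m a f \<longleftrightarrow>
     (\<forall>\<tau>\<in>uhp. ((\<lambda>k. a k * ee (of_int k * \<tau> / of_nat w)) has_sum f \<tau>) {m..})"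

definition slash :: "int \<Rightarrow> real^2^2 \<Rightarrow> (complex \<Rightarrow> complex) \<Rightarrow> complex \<Rightarrow> complex" where
  "slash k A f \<tau> = autom A \<tau> powi (- k) * f (moeb A \<tau>)"

definition weakly_modular :: "int \<Rightarrow> (real^2^2) set \<Rightarrow> (complex \<Rightarrow> complex) \<Rightarrow> bool" where
  "weakly_modular k \<Gamma> f \<longleftrightarrow> f holomorphic_on uhp \<and>
     (\<forall>\<gamma>\<in>\<Gamma>. \<forall>\<tau>\<in>uhp. slash k \<gamma> f \<tau> = f \<tau>)"

text \<open>The order of \<open>f\<close> at the cusp $\sigma(i\infty)$, measured in a local parameter
  $q^{1/w}$ with $w$ a multiple of the width, is at least \<open>m\<close>.\<close>

definition cusp_ord_ge :: "int \<Rightarrow> int \<Rightarrow> real^2^2 \<Rightarrow> (complex \<Rightarrow> complex) \<Rightarrow> bool" where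
  "cusp_ord_ge k m \<sigma> f \<longleftrightarrow> (\<exists>w>0. \<exists>a. has_q_expansion w m a (slash k \<sigma> f))"

text \<open>$M_0^{!,\infty}(\Gamma)$\<close>

definition M0_inf :: "(real^2^2) set \<Rightarrow> (complex \<Rightarrow> complex) set" where
  "M0_inf \<Gamma> = {f. weakly_modular 0 \<Gamma> f \<and> (\<exists>m. cusp_ord_ge 0 m (mat 1) f) \<and>
     (\<forall>\<sigma>\<in>SL2Z. ext_moeb \<sigma> None \<notin> orbit_of \<Gamma> None \<longrightarrow> cusp_ord_ge 0 0 \<sigma> f)}"

definition S2 :: "(real^2^2) set \<Rightarrow> (complex \<Rightarrow> complex) set" where
  "S2 \<Gamma> = {h. weakly_modular 2 \<Gamma> h \<and> (\<forall>\<sigma>\<in>SL2Z. cusp_ord_ge 2 1 \<sigma> h)}"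

text \<open>$i\infty$ is a Weierstrass point of the curve of genus \<open>g\<close> iff some nonconstant
  meromorphic function on $X(\Gamma)$ has its only pole at $i\infty$, of order at most \<open>g\<close>.
  The width of $\Gamma$ at $i\infty$ is 1.\<close>

definition inf_weierstrass :: "(real^2^2) set \<Rightarrow> nat \<Rightarrow> bool" where
  "inf_weierstrass \<Gamma> g \<longleftrightarrow> (\<exists>f\<in>M0_inf \<Gamma>. \<not> f constant_on uhp \<and>
     (\<exists>a. has_q_expansion 1 (- int g) a f))"

text \<open>$f = q^{-m} + \sum_{l=1}^g a_{-l} q^{-l} + O(q)$, for $m > g$\<close>

definition is_f :: "(real^2^2) set \<Rightarrow> nat \<Rightarrow> nat \<Rightarrow> (complex \<Rightarrow> complex) \<Rightarrow> bool" where
  "is_f \<Gamma> g m f \<longleftrightarrow> f \<in> M0_inf \<Gamma> \<and>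
     (\<exists>a. has_q_expansion 1 (- int m) a f \<and> a (- int m) = 1 \<and>
        (\<forall>k. - int m < k \<and> k < - int g \<longrightarrow> a k = 0) \<and> a 0 = 0)"

text \<open>$h = q^l + O(q^{g+1})$\<close>

definition is_h :: "(real^2^2) set \<Rightarrow> nat \<Rightarrow> nat \<Rightarrow> (complex \<Rightarrow> complex) \<Rightarrow> bool" where
  "is_h \<Gamma> g l h \<longleftrightarrow> h \<in> S2 \<Gamma> \<and>
     (\<exists>a. has_q_expansion 1 1 a h \<and>
        (\<forall>k. 1 \<le> k \<and> k \<le> int g \<longrightarrow> a k = (if k = int l then 1 else 0)))"

text \<open>The $q$-expansion at $i\infty$ of a function holomorphic there, as a formal power series.\<close>

definition q_fps :: "(complex \<Rightarrow> complex) \<Rightarrow> complex fps" where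
  "q_fps h = (THE F. \<forall>\<tau>\<in>uhp. ((\<lambda>n. fps_nth F n * ee \<tau> ^ n) has_sum h \<tau>) UNIV)"


subsection \<open>Niebur-Poincare series\<close>

definition Bessel_I :: "complex \<Rightarrow> real \<Rightarrow> complex" where
  "Bessel_I \<nu> x =
     suminf (\<lambda>k. of_real (x / 2) powr (\<nu> + 2 * of_nat k) * rGamma (\<nu> + of_nat k + 1) / fact k)"

definition niebur_term :: "nat \<Rightarrow> complex \<Rightarrow> complex \<Rightarrow> complex" where
  "niebur_term n s \<tau> = ee (- of_nat n * of_real (Re \<tau>)) * of_real (sqrt (real n * Im \<tau>)) *
     Bessel_I (s - 1 / 2) (2 * pi * real n * Im \<tau>)"

text \<open>\<open>niebur_term n s\<close> is invariant under \<open>Gamma_inf\<close>, so the choice of a representative of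
  each coset in $\Gamma_\infty\backslash\Gamma$ is immaterial.\<close>

definition niebur_series :: "(real^2^2) set \<Rightarrow> nat \<Rightarrow> complex \<Rightarrow> complex \<Rightarrow> complex" where
  "niebur_series \<Gamma> n \<tau> s = 2 * of_real pi *
     (\<Sum>\<^sub>\<infinity>C\<in>rcosets\<^bsub>SL2R\<lparr>carrier := \<Gamma>\<rparr>\<^esub> Gamma_inf. niebur_term n s (moeb (SOME \<gamma>. \<gamma> \<in> C) \<tau>))"

text \<open>The analytic continuation in \<open>s\<close>, as a family of functions of \<open>\<tau>\<close> that is jointly
  continuous in $(\tau, s)$.  It is determined on the half plane $\mathrm{Re}\,s > 1/2$ by the
  identity theorem.\<close>

definition niebur_continuation ::
    "(real^2^2) set \<Rightarrow> nat \<Rightarrow> (complex \<Rightarrow> complex \<Rightarrow> complex) \<Rightarrow> bool" where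
  "niebur_continuation \<Gamma> n G \<longleftrightarrow>
     (\<forall>\<tau>\<in>uhp. G \<tau> holomorphic_on {s. Re s > 1 / 2}) \<and>
     continuous_on (uhp \<times> {s. Re s > 1 / 2}) (\<lambda>(\<tau>, s). G \<tau> s) \<and>
     (\<forall>\<tau>\<in>uhp. \<forall>s. Re s > 1 \<longrightarrow> G \<tau> s = niebur_series \<Gamma> n \<tau> s)"

text \<open>$j = q^{-n} - \bar q^n + c_0 + \sum_{\ell \ge 1} (c_\ell q^\ell + c_{-\ell} \bar q^\ell)$\<close>

definition niebur_expansion :: "nat \<Rightarrow> (int \<Rightarrow> complex) \<Rightarrow> (complex \<Rightarrow> complex) \<Rightarrow> bool" where
  "niebur_expansion n c j \<longleftrightarrow> (\<forall>\<tau>\<in>uhp.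
     (\<lambda>l::nat. c (int l) * ee \<tau> ^ l) summable_on {1..} \<and>
     (\<lambda>l::nat. c (- int l) * cnj (ee \<tau>) ^ l) summable_on {1..} \<and>
     j \<tau> = inverse (ee \<tau> ^ n) - cnj (ee \<tau>) ^ n + c 0
       + (\<Sum>\<^sub>\<infinity>l\<in>{1::nat..}. c (int l) * ee \<tau> ^ l)
       + (\<Sum>\<^sub>\<infinity>l\<in>{1::nat..}. c (- int l) * cnj (ee \<tau>) ^ l))"

text \<open>\<open>G n \<tau> 1\<close> is $j_{\Gamma,n}(\tau)$ and \<open>c n\<close> are its Fourier coefficients.\<close>

definition niebur_J ::
    "(nat \<Rightarrow> complex \<Rightarrow> complex \<Rightarrow> complex) \<Rightarrow> (nat \<Rightarrow> int \<Rightarrow> complex) \<Rightarrow> nat \<Rightarrow> complex \<Rightarrow> complex" where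
  "niebur_J G c n \<tau> = (if n = 0 then 1 else G n \<tau> 1 - c n 0)"

end

theory Submission
  imports Defs
begin

text \<open>Let $m > g$ and let $a_{-l}$ be the coefficients of the principal part of $f_m$.  The function
  $F = J_m + \sum_l a_{-l} J_l - f_m$ is harmonic and $\Gamma$-invariant, tends to $0$ at $i\infty$ and is
  bounded at the cusps inequivalent to $i\infty$.  By the maximum principle $F = 0$.  The residue theorem
  applied to $f_m h_{-l}\,d\tau$ gives $a_{-l} = -b$ with $b$ the $m$-th coefficient of $h_{-l}$, so that
  $F = 0$ is the comparison of the coefficients of $q_2^m$.

  The boundedness of $j_n$ at the other cusps is not visible from its expansion at $i\infty$.  It is
  obtained from the Niebur-Poincare series for real $s > 1$, which satisfies there a maximum principle with
  a bound that is uniform as $s \to 1$.\<close>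

text \<open>The compact surface is never built: its global theorems are replaced by arguments on the
  upper half plane with the finitely many cosets of Gamma0(N) in SL2(Z). The half planes Im \<tau>
  \<ge> 1/5, moved by coset representatives, cover everything up to \<Gamma>, so a maximum over
  finitely many cusp neighbourhoods is a global maximum. Periods of a weight 2 form are summed over
  the cosets, which brings in the full modular group, whose homomorphisms to the complex numbers
  vanish. The obstacle is the point s = 1, where j_n is known as a continuation and not as a sum.
  For s > 1 the terms satisfy y^2 (f_xx + f_yy) = s (s - 1) f with s (s - 1) > 0, which forbids
  positive interior maxima. That this strictness is lost as s tends to 1 does no harm: only a bound
  by the values on a horocycle is carried to the limit, and these are controlled by the joint
  continuity of the continuation on a compact set of pairs (\<tau>, s). In both maximum principles a
  small multiple of Im \<tau> is subtracted, so that a merely bounded function cannot approach its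
  supremum far up in the cusp.\<close>

no_notation fps_nth (infixl "$" 75)

subsection \<open>Moebius transformations and the groups $N+S$\<close>

lemma mat_eqI:
  fixes A B :: "'a^2^2"
  assumes "A$1$1 = B$1$1" "A$1$2 = B$1$2" "A$2$1 = B$2$1" "A$2$2 = B$2$2"
  shows "A = B"
proof -
  have "A $ i $ j = B $ i $ j" for i j
    using assms exhaust_2[of i] exhaust_2[of j] by auto
  then show ?thesis unfolding vec_eq_iff by blast
qed

lemma mult_nth:
  fixes A B :: "'a::semiring_1^2^2"
  shows "(A ** B) $ i $ j = A$i$1 * B$1$j + A$i$2 * B$2$j"
  by (simp add: matrix_matrix_mult_def sum_2)

lemma mat1_nth [simp]:
  "(mat 1 :: real^2^2) $ 1 $ 1 = 1" "(mat 1 :: real^2^2) $ 1 $ 2 = 0"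
  "(mat 1 :: real^2^2) $ 2 $ 1 = 0" "(mat 1 :: real^2^2) $ 2 $ 2 = 1"
  by (simp_all add: mat_def)

text \<open>The adjugate. Being linear in the entries, it reverses products and is an involution
  without any condition on the determinant; it is the inverse as soon as
  \<open>det A = 1\<close>.\<close>

definition inv2 :: "real^2^2 \<Rightarrow> real^2^2" where
  "inv2 A = mat2 (A$2$2) (- A$1$2) (- A$2$1) (A$1$1)"

lemma inv2_nth [simp]:
  "inv2 A $ 1 $ 1 = A$2$2" "inv2 A $ 1 $ 2 = - A$1$2"
  "inv2 A $ 2 $ 1 = - A$2$1" "inv2 A $ 2 $ 2 = A$1$1"
  by (simp_all add: inv2_def)

lemma det_inv2 [simp]: "det (inv2 A) = det A"
  by (simp add: det_2 mult.commute)

lemma inv2_right: "det A = 1 \<Longrightarrow> A ** inv2 A = mat 1"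
  and inv2_left: "det A = 1 \<Longrightarrow> inv2 A ** A = mat 1"
  by (rule mat_eqI; simp add: mult_nth det_2 algebra_simps)+

lemma inv2_cancel_left: "det A = 1 \<Longrightarrow> inv2 A ** (A ** B) = B"
  and inv2_cancel_left': "det A = 1 \<Longrightarrow> A ** (inv2 A ** B) = B"
  by (simp_all add: matrix_mul_assoc inv2_right inv2_left)

lemma inv2_mult: "inv2 (A ** B) = inv2 B ** inv2 A"
  by (rule mat_eqI) (simp_all add: mult_nth algebra_simps)

lemma inv2_inv2 [simp]: "inv2 (inv2 A) = A"
  by (rule mat_eqI) simp_all

lemma autom_nonzero:
  assumes "det A = 1" "\<tau> \<in> uhp"
  shows "autom A \<tau> \<noteq> 0"
proof
  assume "autom A \<tau> = 0"
  then have "Im (autom A \<tau>) = 0" "Re (autom A \<tau>) = 0" by simp_all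
  then have "A$2$1 = 0" "A$2$2 = 0" using assms by (auto simp: autom_def)
  then show False using assms by (simp add: det_2)
qed

lemma autom_mult:
  assumes "det B = 1" "\<tau> \<in> uhp"
  shows "autom (A ** B) \<tau> = autom A (moeb B \<tau>) * autom B \<tau>"
  using autom_nonzero[OF assms]
  by (simp add: autom_def[of A] moeb_def field_simps) (simp add: autom_def mult_nth algebra_simps)

lemma moeb_mult:
  assumes "det B = 1" "\<tau> \<in> uhp"
  shows "moeb (A ** B) \<tau> = moeb A (moeb B \<tau>)"
proof -
  have nz: "autom B \<tau> \<noteq> 0" by (rule autom_nonzero[OF assms])
  have "moeb A (moeb B \<tau>) =
      ((A$1$1 * moeb B \<tau> + A$1$2) * autom B \<tau>) / (autom A (moeb B \<tau>) * autom B \<tau>)"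
    using nz by (simp add: moeb_def[of A])
  also have "(A$1$1 * moeb B \<tau> + A$1$2) * autom B \<tau> = (A ** B)$1$1 * \<tau> + (A ** B)$1$2"
    using nz by (simp add: moeb_def field_simps) (simp add: autom_def mult_nth algebra_simps)
  finally show ?thesis by (simp add: moeb_def[of "A ** B"] autom_mult[OF assms])
qed

lemma Im_moeb:
  assumes "det A = 1"
  shows "Im (moeb A \<tau>) = Im \<tau> / (cmod (autom A \<tau>))\<^sup>2"
proof -
  have "Im (moeb A \<tau>) = (Im (A$1$1 * \<tau> + A$1$2) * Re (autom A \<tau>)
      - Re (A$1$1 * \<tau> + A$1$2) * Im (autom A \<tau>)) / (cmod (autom A \<tau>))\<^sup>2"
    by (simp add: moeb_def Im_divide cmod_power2)
  also have "Im (A$1$1 * \<tau> + A$1$2) * Re (autom A \<tau>)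
      - Re (A$1$1 * \<tau> + A$1$2) * Im (autom A \<tau>) = det A * Im \<tau>"
    by (simp add: autom_def det_2 algebra_simps)
  finally show ?thesis using assms by simp
qed

lemma moeb_uhp:
  assumes "det A = 1" "\<tau> \<in> uhp"
  shows "moeb A \<tau> \<in> uhp"
  using assms autom_nonzero[OF assms] by (simp add: Im_moeb)

lemma moeb_mat1 [simp]: "moeb (mat 1) \<tau> = \<tau>"
  by (simp add: moeb_def autom_def)

lemma moeb_inv2:
  assumes "det A = 1" "\<tau> \<in> uhp"
  shows "moeb A (moeb (inv2 A) \<tau>) = \<tau>" "moeb (inv2 A) (moeb A \<tau>) = \<tau>"
  using assms moeb_mult[of "inv2 A" \<tau> A] moeb_mult[of A \<tau> "inv2 A"]
  by (simp_all add: inv2_left inv2_right)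

text \<open>Real upper triangular matrices, whose entries need not be integers, arise when a cusp
  equivalent to i\<infinity> is transported to i\<infinity>; they scale heights by the square of the
  corner entry.\<close>

lemma moeb_upper:
  fixes \<tau> :: complex
  assumes "A$2$1 = 0" "det A = 1"
  shows "moeb A \<tau> = (A$1$1)\<^sup>2 * \<tau> + A$1$1 * A$1$2"
proof -
  have "A$1$1 * A$2$2 = 1" using assms by (simp add: det_2)
  then have "complex_of_real (A$1$1) * A$2$2 = 1" "A$2$2 \<noteq> 0"
    by (auto simp flip: of_real_mult)
  then have "1 / complex_of_real (A$2$2) = A$1$1"
    by (simp add: field_simps)
  moreover have "moeb A \<tau> = (A$1$1 * \<tau> + A$1$2) * (1 / complex_of_real (A$2$2))"
    by (simp add: moeb_def autom_def assms)
  ultimately show ?thesis by (simp add: power2_eq_square algebra_simps)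
qed

lemma moeb_has_derivative:
  assumes "det A = 1" "\<tau> \<in> uhp"
  shows "(moeb A has_field_derivative 1 / (autom A \<tau>)\<^sup>2) (at \<tau>)"
proof -
  have nz: "autom A \<tau> \<noteq> 0" by (rule autom_nonzero[OF assms])
  have d: "complex_of_real (A$1$1) * A$2$2 - A$1$2 * A$2$1 = 1"
    using assms(1) by (metis det_2 of_real_1 of_real_diff of_real_mult)
  have "((\<lambda>z. (A$1$1 * z + A$1$2) / autom A z) has_field_derivative
     (A$1$1 * autom A \<tau> - (A$1$1 * \<tau> + A$1$2) * A$2$1) / (autom A \<tau> * autom A \<tau>)) (at \<tau>)"
    using nz unfolding autom_def by (auto intro!: derivative_eq_intros)
  moreover have "A$1$1 * autom A \<tau> - (A$1$1 * \<tau> + A$1$2) * A$2$1 = 1"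
    using d by (simp add: autom_def algebra_simps)
  ultimately show ?thesis by (simp add: moeb_def[abs_def] power2_eq_square)
qed

lemma open_uhp: "open uhp" and convex_uhp: "convex uhp"
  by (simp_all add: open_halfspace_Im_gt convex_halfspace_Im_gt)

lemma connected_uhp: "connected uhp"
  using convex_uhp by (rule convex_connected)

abbreviation shift :: "real \<Rightarrow> real^2^2" where
  "shift t \<equiv> mat2 1 t 0 1"

lemma det_mat2 [simp]: "det (mat2 a b c d) = a * d - b * c"
  by (simp add: det_2)

lemma moeb_shift [simp]: "moeb (shift t) \<tau> = \<tau> + t"
  by (simp add: moeb_def autom_def)

section \<open>Integral matrices, translations and Gamma0(N)\<close>

lemma det_SL2Z: "\<sigma> \<in> SL2Z \<Longrightarrow> det \<sigma> = 1"
  by (auto simp: SL2Z_def simp flip: of_int_mult of_int_diff)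

lemma SL2Z_mult:
  assumes "A \<in> SL2Z" "B \<in> SL2Z"
  shows "A ** B \<in> SL2Z"
proof -
  obtain a b c d where A: "A = mat2 (of_int a) (of_int b) (of_int c) (of_int d)" "a * d - b * c = 1"
    using assms by (auto simp: SL2Z_def)
  obtain a' b' c' d' where B: "B = mat2 (of_int a') (of_int b') (of_int c') (of_int d')"
      "a' * d' - b' * c' = 1"
    using assms by (auto simp: SL2Z_def)
  have "A ** B = mat2 (of_int (a * a' + b * c')) (of_int (a * b' + b * d'))
     (of_int (c * a' + d * c')) (of_int (c * b' + d * d'))"
    by (rule mat_eqI) (simp_all add: A B mult_nth)
  moreover have "(a * a' + b * c') * (c * b' + d * d') - (a * b' + b * d') * (c * a' + d * c')
      = (a * d - b * c) * (a' * d' - b' * c')"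
    by (simp add: algebra_simps)
  ultimately show ?thesis unfolding SL2Z_def A(2) B(2) by fastforce
qed

lemma SL2Z_inv2: "A \<in> SL2Z \<Longrightarrow> inv2 A \<in> SL2Z"
proof -
  assume "A \<in> SL2Z"
  then obtain a b c d where A: "A = mat2 (of_int a) (of_int b) (of_int c) (of_int d)" "a * d - b * c = 1"
    by (auto simp: SL2Z_def)
  have "inv2 A = mat2 (of_int d) (of_int (-b)) (of_int (-c)) (of_int a)"
    by (rule mat_eqI) (simp_all add: A)
  moreover have "d * a - (-b) * (-c) = 1" using A(2) by (simp add: algebra_simps)
  ultimately show ?thesis unfolding SL2Z_def by blast
qed

lemma SL2Z_nth: "A \<in> SL2Z \<Longrightarrow> \<exists>k::int. A $ i $ j = of_int k"
  using exhaust_2[of i] exhaust_2[of j] by (auto simp: SL2Z_def)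

lemma Gamma0_subset_SL2Z: "Gamma0 N \<subseteq> SL2Z"
  by (auto simp: Gamma0_def SL2Z_def)

lemma shift_in_Gamma0: "shift (of_int t) \<in> Gamma0 N"
  unfolding Gamma0_def
  by (rule CollectI, rule exI[of _ 1], rule exI[of _ t], rule exI[of _ 0], rule exI[of _ 1]) simp

lemma shift_in_SL2Z: "shift (of_int t) \<in> SL2Z"
  using shift_in_Gamma0 Gamma0_subset_SL2Z by blast

lemma mat1_in_SL2Z: "mat 1 \<in> SL2Z"
proof -
  have "mat 1 = shift (of_int 0)" by (rule mat_eqI) simp_all
  then show ?thesis using shift_in_SL2Z by metis
qed

lemma Gamma_inf_subset_Gamma0: "Gamma_inf \<subseteq> Gamma0 N"
proof
  fix A assume "A \<in> Gamma_inf"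
  then obtain e t where A: "A = mat2 e (e * of_int t) 0 e" "e = 1 \<or> e = -1"
    by (auto simp: Gamma_inf_def)
  then obtain e' :: int where e': "e = of_int e'" "e' * e' = 1"
    by (metis mult_1 mult_minus1 minus_minus of_int_1 of_int_minus)
  have "A = mat2 (of_int e') (of_int (e' * t)) (of_int 0) (of_int e')" "e' * e' - e' * t * 0 = 1" "int N dvd 0"
    using A e' by simp_all
  then show "A \<in> Gamma0 N" unfolding Gamma0_def by blast
qed

text \<open>The conjugate is congruent to the identity modulo N. Hence N is a common period, though
  not the smallest one in general, at all cusps.\<close>

lemma conj_shift_in_Gamma0:
  assumes "\<sigma> \<in> SL2Z"
  shows "\<sigma> ** shift (of_nat N) ** inv2 \<sigma> \<in> Gamma0 N"
proof -
  obtain a b c d where A: "\<sigma> = mat2 (of_int a) (of_int b) (of_int c) (of_int d)" "a * d - b * c = 1"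
    using assms by (auto simp: SL2Z_def)
  have bc: "of_int a * of_int d = (1::real) + of_int b * of_int c"
    using A(2) by (simp flip: of_int_mult of_int_diff) 
  have "\<sigma> ** shift (of_nat N) ** inv2 \<sigma> = mat2 (of_int (1 - N * a * c)) (of_int (N * a * a))
     (of_int (- N * c * c)) (of_int (1 + N * a * c))"
    using bc by (intro mat_eqI) (simp_all add: A mult_nth algebra_simps)
  moreover have "(1 - N * a * c) * (1 + N * a * c) - (N * a * a) * (- N * c * c) = 1"
    by (simp add: algebra_simps)
  moreover have "int N dvd (- N * c * c)" by simp
  ultimately show ?thesis unfolding Gamma0_def by blast
qed

text \<open>The image of i\<infinity> is the ratio of the first column, and the lower left entry of
  \<open>inv2 A ** B\<close> is the determinant of the two first columns.\<close>

lemma ext_moeb_None_eq_iff: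
  assumes "det A = 1" "det B = 1"
  shows "ext_moeb A None = ext_moeb B None \<longleftrightarrow> (inv2 A ** B)$2$1 = 0"
proof -
  have "A$1$1 \<noteq> 0 \<or> A$2$1 \<noteq> 0" "B$1$1 \<noteq> 0 \<or> B$2$1 \<noteq> 0"
    using assms by (auto simp: det_2)
  then show ?thesis
    by (auto simp: mult_nth frac_eq_eq algebra_simps simp flip: of_real_mult)
qed

section \<open>Atkin-Lehner matrices for the divisors of N\<close>

lemma atkin_lehner_iff:
  assumes "Q > 0"
  shows "A \<in> atkin_lehner N Q \<longleftrightarrow> det A = 1 \<and> (\<exists>x y z w :: int.
    sqrt Q * A$1$1 = of_int (int Q * x) \<and> sqrt Q * A$1$2 = of_int y \<and>
    sqrt Q * A$2$1 = of_int (int N * z) \<and> sqrt Q * A$2$2 = of_int (int Q * w))"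
    (is "_ \<longleftrightarrow> _ \<and> (\<exists>x y z w. ?P x y z w)")
proof
  have r: "sqrt Q > 0" "sqrt Q * sqrt Q = Q" using assms by simp_all
  show "det A = 1 \<and> (\<exists>x y z w. ?P x y z w)" if A: "A \<in> atkin_lehner N Q"
  proof -
    obtain x y z w where A: "A = mat2 (of_int (int Q * x) / sqrt Q) (of_int y / sqrt Q)
           (of_int (int N * z) / sqrt Q) (of_int (int Q * w) / sqrt Q)"
      and d: "(int Q * x) * (int Q * w) - y * (int N * z) = int Q"
      using A unfolding atkin_lehner_def by blast
    have "det A = of_int ((int Q * x) * (int Q * w) - y * (int N * z)) / (sqrt Q * sqrt Q)"
      by (simp add: A diff_divide_distrib del: real_sqrt_mult_self)
    also have "\<dots> = 1" unfolding d using r by simp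
    finally have "det A = 1" .
    moreover have "?P x y z w" using r by (simp add: A)
    ultimately show ?thesis by blast
  qed
  show "A \<in> atkin_lehner N Q" if "det A = 1 \<and> (\<exists>x y z w. ?P x y z w)"
  proof -
    from that obtain x y z w where P: "?P x y z w" and d: "det A = 1" by blast
    have "A = mat2 (of_int (int Q * x) / sqrt Q) (of_int y / sqrt Q)
           (of_int (int N * z) / sqrt Q) (of_int (int Q * w) / sqrt Q)"
      using P r by (intro mat_eqI) (auto simp: field_simps)
    moreover have "real_of_int ((int Q * x) * (int Q * w) - y * (int N * z)) = of_int (int Q)"
    proof -
      have "real_of_int ((int Q * x) * (int Q * w) - y * (int N * z)) =
         (sqrt Q * A$1$1) * (sqrt Q * A$2$2) - (sqrt Q * A$1$2) * (sqrt Q * A$2$1)"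
        using P by simp
      also have "\<dots> = (sqrt Q * sqrt Q) * det A" unfolding det_2 by (simp only: algebra_simps)
      finally show ?thesis using d r by simp
    qed
    then have "(int Q * x) * (int Q * w) - y * (int N * z) = int Q"
      by (simp only: of_int_eq_iff)
    ultimately show ?thesis unfolding atkin_lehner_def by blast
  qed
qed

text \<open>The case Q = 1, which lets Gamma0(N) and the involutions be treated alike.\<close>

lemma Gamma0_iff_atkin_lehner: "Gamma0 N = atkin_lehner N 1"
proof (intro equalityI subsetI)
  fix A assume "A \<in> Gamma0 N"
  then obtain a b c d z where A: "A = mat2 (of_int a) (of_int b) (of_int c) (of_int d)"
    "a * d - b * c = 1" "c = int N * z"
    unfolding Gamma0_def dvd_def by blast
  then show "A \<in> atkin_lehner N 1"
    unfolding atkin_lehner_def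
    by (intro CollectI exI[of _ a] exI[of _ b] exI[of _ z] exI[of _ d]) simp
next
  fix A assume "A \<in> atkin_lehner N 1"
  then obtain x y z w where A: "A = mat2 (of_int x) (of_int y) (of_int (int N * z)) (of_int w)"
    "x * w - y * (int N * z) = 1"
    unfolding atkin_lehner_def by auto
  moreover have "int N dvd int N * z" by simp
  ultimately show "A \<in> Gamma0 N" unfolding Gamma0_def by blast
qed

lemma inv2_atkin_lehner:
  assumes "Q > 0" "A \<in> atkin_lehner N Q"
  shows "inv2 A \<in> atkin_lehner N Q"
proof -
  obtain x y z w :: int where P: "det A = 1"
    "sqrt Q * A$1$1 = of_int (int Q * x)" "sqrt Q * A$1$2 = of_int y"
    "sqrt Q * A$2$1 = of_int (int N * z)" "sqrt Q * A$2$2 = of_int (int Q * w)"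
    using assms atkin_lehner_iff by blast
  then have "sqrt Q * inv2 A$1$1 = of_int (int Q * w)" "sqrt Q * inv2 A$1$2 = of_int (-y)"
    "sqrt Q * inv2 A$2$1 = of_int (int N * (-z))" "sqrt Q * inv2 A$2$2 = of_int (int Q * x)"
    by simp_all
  with P(1) show ?thesis using atkin_lehner_iff[OF assms(1)] by (metis det_inv2)
qed

text \<open>The product belongs to R = Q Q' / d^2 with d = gcd(Q, Q'). Indeed sqrt Q sqrt Q' = d
  sqrt R, and d can be taken out of every entry of the integral product; for the diagonal entries to
  be divisible by d R one uses that lcm(Q, Q') = d R divides N.\<close>

lemma mult_atkin_lehner:
  assumes "N > 0" "Q dvd N" "Q' dvd N" "A \<in> atkin_lehner N Q" "B \<in> atkin_lehner N Q'"
  shows "\<exists>R. R dvd N \<and> A ** B \<in> atkin_lehner N R"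
proof -
  have pos: "Q > 0" "Q' > 0" using assms by (auto intro: dvd_pos_nat)
  define d where "d = gcd Q Q'"
  have "d > 0" using pos by (simp add: d_def)
  obtain q where q: "Q = d * q" unfolding d_def by (meson dvd_def gcd_dvd1)
  obtain q' where q': "Q' = d * q'" unfolding d_def by (meson dvd_def gcd_dvd2)
  have "lcm Q Q' dvd N" using assms by simp
  moreover have "lcm Q Q' = d * q * q'"
  proof -
    have "d * lcm Q Q' = Q * Q'" using prod_gcd_lcm_nat[of Q Q'] by (simp only: d_def)
    also have "\<dots> = d * (d * q * q')" unfolding q q' by (simp only: ac_simps)
    finally show ?thesis using \<open>d > 0\<close> by simp
  qed
  ultimately obtain n where n: "N = d * q * q' * n" by (metis dvd_def)
  define R where "R = q * q'"
  have "R > 0" using pos by (simp add: R_def q q')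
  have "R dvd N" by (simp add: R_def n)
  have rt: "sqrt Q * sqrt Q' = d * sqrt R"
    by (simp add: q q' R_def real_sqrt_mult)
  obtain x y z w :: int where A: "det A = 1"
    "sqrt Q * A$1$1 = of_int (int Q * x)" "sqrt Q * A$1$2 = of_int y"
    "sqrt Q * A$2$1 = of_int (int N * z)" "sqrt Q * A$2$2 = of_int (int Q * w)"
    using assms(4) atkin_lehner_iff[OF pos(1)] by blast
  obtain x' y' z' w' :: int where B: "det B = 1"
    "sqrt Q' * B$1$1 = of_int (int Q' * x')" "sqrt Q' * B$1$2 = of_int y'"
    "sqrt Q' * B$2$1 = of_int (int N * z')" "sqrt Q' * B$2$2 = of_int (int Q' * w')"
    using assms(5) atkin_lehner_iff[OF pos(2)] by blast
  have entry: "sqrt R * (A ** B)$i$j = v"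
    if "(sqrt Q * A$i$1) * (sqrt Q' * B$1$j) + (sqrt Q * A$i$2) * (sqrt Q' * B$2$j) = d * v" for i j and v :: real
  proof -
    have "d * (sqrt R * (A ** B)$i$j) = sqrt Q * sqrt Q' * (A ** B)$i$j"
      by (simp add: rt)
    also have "\<dots> = d * v" using that by (simp add: mult_nth algebra_simps)
    finally show ?thesis using \<open>d > 0\<close> by simp
  qed
  have "sqrt R * (A ** B)$1$1 = of_int (int R * (d * x * x' + n * y * z'))"
    by (rule entry; unfold A B) (simp add: q q' n R_def algebra_simps)
  moreover have "sqrt R * (A ** B)$1$2 = of_int (q * x * y' + q' * y * w')"
    by (rule entry; unfold A B) (simp add: q q' n R_def algebra_simps)
  moreover have "sqrt R * (A ** B)$2$1 = of_int (int N * (q' * z * x' + q * w * z'))"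
    by (rule entry; unfold A B) (simp add: q q' n R_def algebra_simps)
  moreover have "sqrt R * (A ** B)$2$2 = of_int (int R * (n * z * y' + d * w * w'))"
    by (rule entry; unfold A B) (simp add: q q' n R_def algebra_simps)
  moreover have "det (A ** B) = 1" using A B by (simp add: det_mul)
  ultimately have "A ** B \<in> atkin_lehner N R" using atkin_lehner_iff[OF \<open>R > 0\<close>] by blast
  with \<open>R dvd N\<close> show ?thesis by blast
qed

lemma inv_SL2R: "det A = 1 \<Longrightarrow> inv\<^bsub>SL2R\<^esub> A = inv2 A"
  by (rule group.inv_equality[OF group_SL2R]) (simp_all add: SL2R_def inv2_left)

text \<open>What the later arguments use of N+S. The divisor in \<open>Gamma_atkin_lehner\<close>
  ranges over all divisors of N, since products of involutions from S may lead outside S.\<close>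

locale atkin_lehner_group =
  fixes N :: nat and \<Gamma> :: "(real^2^2) set"
  assumes N_pos: "N > 0"
    and Gamma_atkin_lehner: "\<gamma> \<in> \<Gamma> \<Longrightarrow> \<exists>Q. Q dvd N \<and> \<gamma> \<in> atkin_lehner N Q"
    and Gamma_mult: "\<gamma> \<in> \<Gamma> \<Longrightarrow> \<delta> \<in> \<Gamma> \<Longrightarrow> \<gamma> ** \<delta> \<in> \<Gamma>"
    and Gamma_inv: "\<gamma> \<in> \<Gamma> \<Longrightarrow> inv2 \<gamma> \<in> \<Gamma>"
    and Gamma0_subset: "Gamma0 N \<subseteq> \<Gamma>"
begin

lemma det_Gamma: "\<gamma> \<in> \<Gamma> \<Longrightarrow> det \<gamma> = 1"
  using Gamma_atkin_lehner atkin_lehner_iff N_pos by (metis dvd_pos_nat)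

lemma mat1_in_Gamma: "mat 1 \<in> \<Gamma>"
  using shift_in_Gamma0[of 0] Gamma0_subset Gamma_mult Gamma_inv inv2_right det_Gamma
  by (metis subsetD)

lemma Gamma_inf_subset: "Gamma_inf \<subseteq> \<Gamma>"
  using Gamma_inf_subset_Gamma0 Gamma0_subset by blast

text \<open>With lower left entry 0 the determinant condition reads Q^2 x w = Q, which forces Q = 1.
  So the involutions do not enlarge the stabilizer of i\<infinity>, and the width there remains
  1.\<close>

lemma Gamma_stabilizer:
  assumes "\<gamma> \<in> \<Gamma>" "\<gamma>$2$1 = 0"
  shows "\<gamma> \<in> Gamma_inf"
proof -
  obtain Q where Q: "Q dvd N" "\<gamma> \<in> atkin_lehner N Q" using Gamma_atkin_lehner assms by blast
  then have pos: "Q > 0" using N_pos by (auto intro: dvd_pos_nat)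
  obtain x y z w :: int where P: "det \<gamma> = 1"
    "sqrt Q * \<gamma>$1$1 = of_int (int Q * x)" "sqrt Q * \<gamma>$1$2 = of_int y" "sqrt Q * \<gamma>$2$2 = of_int (int Q * w)"
    using Q atkin_lehner_iff[OF pos] by blast
  have "(sqrt Q * \<gamma>$1$1) * (sqrt Q * \<gamma>$2$2) = (sqrt Q * sqrt Q) * det \<gamma>"
    by (simp add: det_2 assms(2) del: real_sqrt_mult_self)
  then have "real_of_int ((int Q * x) * (int Q * w)) = of_int (int Q)"
    unfolding P using pos by simp
  then have "(int Q * x) * (int Q * w) = int Q" by (simp only: of_int_eq_iff)
  then have 1: "int Q * (x * w) = 1" using pos by (simp add: algebra_simps)
  then have "Q = 1" by (metis zmult_eq_1_iff of_nat_0_le_iff of_nat_1 of_nat_eq_iff neg_0_le_iff_le not_one_le_zero)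
  with 1 have "x = 1 \<and> w = 1 \<or> x = -1 \<and> w = -1" by (simp add: zmult_eq_1_iff)
  then have "\<gamma> = mat2 (of_int x) (of_int x * of_int (x * y)) 0 (of_int x)"
    using P \<open>Q = 1\<close> assms(2) by (intro mat_eqI) auto
  then show ?thesis
    using \<open>x = 1 \<and> w = 1 \<or> x = -1 \<and> w = -1\<close> unfolding Gamma_inf_def
    by (intro CollectI exI[of _ "of_int x"] exI[of _ "x * y"]) auto
qed

text \<open>The denominators sqrt Q take at most N values, so the bottom rows lie in a finite union
  of scaled lattices; the convergence of the Poincare series rests on this.\<close>

lemma Gamma_bottom_row:
  assumes "\<gamma> \<in> \<Gamma>"
  shows "\<exists>Q. 0 < Q \<and> Q \<le> N \<and> (\<exists>m k :: int. \<gamma>$2$1 = of_int m / sqrt Q \<and> \<gamma>$2$2 = of_int k / sqrt Q)"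
proof -
  obtain Q where Q: "Q dvd N" "\<gamma> \<in> atkin_lehner N Q" using Gamma_atkin_lehner assms by blast
  then have Q': "Q > 0" "Q \<le> N" using N_pos by (auto intro: dvd_pos_nat dvd_imp_le)
  then obtain z w :: int where
    "sqrt Q * \<gamma>$2$1 = of_int (int N * z)" "sqrt Q * \<gamma>$2$2 = of_int (int Q * w)"
    using Q(2) atkin_lehner_iff by blast
  then have "\<gamma>$2$1 = of_int (int N * z) / sqrt Q" "\<gamma>$2$2 = of_int (int Q * w) / sqrt Q"
    using Q' by (simp_all add: field_simps)
  with Q' show ?thesis by blast
qed

text \<open>A term of the Poincare series grows at the cusp \<sigma>(i\<infinity>) only if
  \<open>\<gamma> ** \<sigma>\<close> fixes i\<infinity>. At a cusp inequivalent to i\<infinity>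
  there is no such term.\<close>

lemma cusp_inequivalent:
  assumes "ext_moeb \<sigma> None \<notin> orbit_of \<Gamma> None" "det \<sigma> = 1" "\<gamma> \<in> \<Gamma>"
  shows "(\<gamma> ** \<sigma>)$2$1 \<noteq> 0"
proof
  assume "(\<gamma> ** \<sigma>)$2$1 = 0"
  then have "ext_moeb (inv2 \<gamma>) None = ext_moeb \<sigma> None"
    using assms det_Gamma by (subst ext_moeb_None_eq_iff) auto
  then show False using assms Gamma_inv unfolding orbit_of_def by (metis imageI)
qed

lemma cusp_equivalent:
  assumes "ext_moeb \<sigma> None \<in> orbit_of \<Gamma> None" "det \<sigma> = 1"
  obtains \<gamma> t where "\<gamma> \<in> \<Gamma>" "\<sigma> = \<gamma> ** t" "t$2$1 = 0" "det t = 1"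
proof -
  obtain \<gamma> where \<gamma>: "\<gamma> \<in> \<Gamma>" "ext_moeb \<gamma> None = ext_moeb \<sigma> None"
    using assms unfolding orbit_of_def by fastforce
  have d: "det \<gamma> = 1" using \<gamma>(1) by (rule det_Gamma)
  show ?thesis
  proof (rule that[OF \<gamma>(1)])
    show "\<sigma> = \<gamma> ** (inv2 \<gamma> ** \<sigma>)" by (simp add: inv2_cancel_left'[OF d])
    show "(inv2 \<gamma> ** \<sigma>)$2$1 = 0" using ext_moeb_None_eq_iff[OF d assms(2)] \<gamma>(2) by simp
    show "det (inv2 \<gamma> ** \<sigma>) = 1" using d assms(2) by (simp add: det_mul)
  qed
qed

end

lemma atkin_lehner_group_Gamma_plus:
  assumes "N > 0" "S \<subseteq> exact_divisors N"
  shows "atkin_lehner_group N (Gamma_plus N S)"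
proof
  interpret group SL2R by (rule group_SL2R)
  define H where "H = Gamma0 N \<union> (\<Union>Q\<in>S. atkin_lehner N Q)"
  have al: "\<exists>Q. Q dvd N \<and> A \<in> atkin_lehner N Q" if "A \<in> H" for A
    using that assms unfolding H_def Gamma0_iff_atkin_lehner exact_divisors_def
    by (auto intro: exI[of _ 1])
  have pos: "Q > 0" if "Q dvd N" for Q using that assms by (auto intro: dvd_pos_nat)
  have sub: "H \<subseteq> carrier SL2R"
    using al pos atkin_lehner_iff unfolding SL2R_def by fastforce
  then have car: "generate SL2R H \<subseteq> carrier SL2R" by (rule generate_incl)
  have G: "Gamma_plus N S = generate SL2R H" by (simp add: Gamma_plus_def H_def)
  show "\<exists>Q. Q dvd N \<and> \<gamma> \<in> atkin_lehner N Q" if "\<gamma> \<in> Gamma_plus N S" for \<gamma>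
    using that unfolding G
  proof (induction rule: generate.induct)
    case one
    have "mat 1 = shift (of_int 0)" by (rule mat_eqI) simp_all
    then have "mat 1 \<in> Gamma0 N" using shift_in_Gamma0 by metis
    then show ?case unfolding Gamma0_iff_atkin_lehner by (auto simp: SL2R_def intro: exI[of _ 1])
  next
    case (incl h)
    then show ?case by (rule al)
  next
    case (inv h)
    then have "det h = 1" using sub by (auto simp: SL2R_def)
    then show ?case using al[OF inv] inv2_atkin_lehner pos by (metis inv_SL2R)
  next
    case (eng h1 h2)
    then show ?case using mult_atkin_lehner[OF assms(1)] by (fastforce simp: SL2R_def)
  qed
  show "\<gamma> ** \<delta> \<in> Gamma_plus N S" if "\<gamma> \<in> Gamma_plus N S" "\<delta> \<in> Gamma_plus N S" for \<gamma> \<delta>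
    using generate.eng that unfolding G by (fastforce simp: SL2R_def)
  show "inv2 \<gamma> \<in> Gamma_plus N S" if "\<gamma> \<in> Gamma_plus N S" for \<gamma>
  proof -
    have "det \<gamma> = 1" using that car unfolding G by (auto simp: SL2R_def)
    then show ?thesis using generate_m_inv_closed[OF sub] that inv_SL2R unfolding G by metis
  qed
  show "Gamma0 N \<subseteq> Gamma_plus N S"
    unfolding G H_def by (auto intro: generate.incl)
qed (use assms in simp)

subsection \<open>Reduction to $\mathrm{SL}_2(\mathbb{Z})$\<close>

lemma inv2_mat1 [simp]: "inv2 (mat 1) = mat 1"
  by (rule mat_eqI) simp_all

text \<open>With Q about 1 / sqrt y, Dirichlet approximation yields coprime h, k with |k \<tau> -
  h|^2 \<le> 1 / Q^2 + (k y)^2 \<le> y + 4 y, and a matrix with bottom row (k, -h) lifts \<tau> to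
  height at least 1/5. The 4 comes from Q \<le> 2 / sqrt y, the cost of rounding up a number that is
  at least 1.\<close>

lemma SL2Z_reduction:
  assumes "\<tau> \<in> uhp"
  obtains \<sigma> \<tau>' where "\<sigma> \<in> SL2Z" "Im \<tau>' \<ge> 1 / 5" "\<tau> = moeb \<sigma> \<tau>'"
proof (cases "Im \<tau> \<ge> 1 / 5")
  case True
  then show ?thesis using that[of "mat 1" \<tau>] mat1_in_SL2Z by simp
next
  case False
  define y where "y = Im \<tau>"
  have y: "0 < y" "y < 1" using assms False by (auto simp: y_def)
  define Q where "Q = nat \<lceil>1 / sqrt y\<rceil>"
  have "1 / sqrt y \<ge> 1" using y by simp
  then have Q: "Q > 0" "1 / sqrt y \<le> Q" "Q \<le> 2 / sqrt y" unfolding Q_def by linarith+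
  obtain h k where hk: "coprime h k" "0 < k" "k \<le> int Q" "\<bar>of_int k * Re \<tau> - of_int h\<bar> < 1 / Q"
    using Dirichlet_approx_coprime[OF Q(1)] by blast
  obtain u v where uv: "u * h + v * k = 1"
    using hk(1) by (metis bezout_int coprime_imp_gcd_eq_1)
  define \<gamma> where "\<gamma> = mat2 (of_int (-u)) (of_int (-v)) (of_int k) (of_int (-h))"
  have "(-u) * (-h) - (-v) * k = 1" using uv by simp
  then have \<gamma>: "\<gamma> \<in> SL2Z" unfolding SL2Z_def \<gamma>_def by blast
  have "(cmod (autom \<gamma> \<tau>))\<^sup>2 = (of_int k * Re \<tau> - of_int h)\<^sup>2 + (k * y)\<^sup>2"
    by (simp add: cmod_power2 autom_def \<gamma>_def y_def)
  also have "(of_int k * Re \<tau> - of_int h)\<^sup>2 \<le> (1 / Q)\<^sup>2"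
    using hk(4) by (metis abs_ge_zero less_imp_le power2_abs power_mono)
  also have "\<dots> \<le> (sqrt y)\<^sup>2"
    using Q y by (intro power_mono) (simp_all add: field_simps)
  also have "(k * y)\<^sup>2 \<le> (2 / sqrt y * y)\<^sup>2"
    using hk Q y by (intro power_mono mult_right_mono) auto
  also have "(2 / sqrt y * y)\<^sup>2 = 4 * y"
    using y by (simp add: power_mult_distrib power_divide power2_eq_square)
  finally have "(cmod (autom \<gamma> \<tau>))\<^sup>2 \<le> 5 * y" using y by simp
  then have "Im (moeb \<gamma> \<tau>) \<ge> 1 / 5"
    using autom_nonzero[OF det_SL2Z[OF \<gamma>] assms]
    by (simp add: Im_moeb[OF det_SL2Z[OF \<gamma>]] field_simps flip: y_def)
  moreover have "\<tau> = moeb (inv2 \<gamma>) (moeb \<gamma> \<tau>)"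
    using moeb_inv2(2)[OF det_SL2Z[OF \<gamma>] assms] by simp
  ultimately show ?thesis using that[of "inv2 \<gamma>" "moeb \<gamma> \<tau>"] SL2Z_inv2[OF \<gamma>] by blast
qed

lemma Gamma0_iff: "A \<in> Gamma0 N \<longleftrightarrow> A \<in> SL2Z \<and> (\<exists>k::int. A$2$1 = of_int (int N * k))"
proof
  assume "A \<in> Gamma0 N"
  then obtain a b c d k where "A = mat2 (of_int a) (of_int b) (of_int c) (of_int d)" "c = int N * k"
    unfolding Gamma0_def dvd_def by blast
  then have "A$2$1 = of_int (int N * k)" by simp
  then show "A \<in> SL2Z \<and> (\<exists>k::int. A$2$1 = of_int (int N * k))"
    using \<open>A \<in> Gamma0 N\<close> Gamma0_subset_SL2Z by blast
next
  assume "A \<in> SL2Z \<and> (\<exists>k::int. A$2$1 = of_int (int N * k))"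
  then obtain a b c d k where A: "A = mat2 (of_int a) (of_int b) (of_int c) (of_int d)"
    "a * d - b * c = 1" and k: "A$2$1 = of_int (int N * k)"
    unfolding SL2Z_def by blast
  from k have "real_of_int c = of_int (int N * k)" by (simp only: A(1) mat2_nth)
  then have "int N dvd c" by (simp only: of_int_eq_iff dvd_triv_left)
  with A show "A \<in> Gamma0 N" unfolding Gamma0_def by blast
qed

lemma Gamma0_mult:
  assumes "A \<in> Gamma0 N" "B \<in> Gamma0 N"
  shows "A ** B \<in> Gamma0 N"
proof -
  obtain k l where kl: "A$2$1 = of_int (int N * k)" "B$2$1 = of_int (int N * l)"
    and AB: "A \<in> SL2Z" "B \<in> SL2Z"
    using assms unfolding Gamma0_iff by blast
  obtain a d :: int where "B$1$1 = of_int a" "A$2$2 = of_int d"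
    using SL2Z_nth AB by metis
  then have "(A ** B)$2$1 = of_int (int N * (k * a + d * l))"
    by (simp add: mult_nth kl algebra_simps)
  then show ?thesis unfolding Gamma0_iff using SL2Z_mult[OF AB] by blast
qed

lemma Gamma0_inv2: "A \<in> Gamma0 N \<Longrightarrow> inv2 A \<in> Gamma0 N"
  unfolding Gamma0_iff using SL2Z_inv2 inv2_nth(3) by (metis mult_minus_right of_int_minus)

text \<open>Finite index of Gamma0(N): the coset of a matrix is determined by its bottom row modulo
  N, because c d' - d c' = (c - c') d' - (d - d') c'. The choice made by \<open>rep\<close> depends
  only on the coset, since equivalent matrices satisfy the same predicate; right multiplication
  permutes \<open>R\<close> because it is injective on a finite set.\<close>

lemma finite_coset_reps:
  assumes "N > 0"
  obtains R and rep :: "real^2^2 \<Rightarrow> real^2^2"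
  where "finite R" "R \<subseteq> SL2Z" "\<And>\<sigma>. \<sigma> \<in> SL2Z \<Longrightarrow> rep \<sigma> \<in> R"
    "\<And>\<sigma>. \<sigma> \<in> SL2Z \<Longrightarrow> \<sigma> ** inv2 (rep \<sigma>) \<in> Gamma0 N"
    "\<And>\<gamma>. \<gamma> \<in> SL2Z \<Longrightarrow> bij_betw (\<lambda>r. rep (r ** \<gamma>)) R R"
    "rep (mat 1) \<in> Gamma0 N"
proof -
  define rel where "rel \<sigma> \<rho> \<longleftrightarrow> \<rho> \<in> SL2Z \<and> \<sigma> ** inv2 \<rho> \<in> Gamma0 N" for \<sigma> \<rho>
  define rep where "rep \<sigma> = (SOME \<rho>. rel \<sigma> \<rho>)" for \<sigma>
  have refl: "rel \<sigma> \<sigma>" if "\<sigma> \<in> SL2Z" for \<sigma>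
  proof -
    have "mat 1 = shift (of_int 0)" by (rule mat_eqI) simp_all
    then show ?thesis using that shift_in_Gamma0 inv2_right det_SL2Z unfolding rel_def by metis
  qed
  have sym: "rel \<rho> \<sigma>" if "rel \<sigma> \<rho>" "\<sigma> \<in> SL2Z" for \<sigma> \<rho>
    using that Gamma0_inv2[of "\<sigma> ** inv2 \<rho>"] unfolding rel_def by (simp add: inv2_mult)
  have trans: "rel \<sigma> \<rho>'" if "rel \<sigma> \<rho>" "rel \<rho> \<rho>'" "\<sigma> \<in> SL2Z" for \<sigma> \<rho> \<rho>'
  proof -
    have "(\<sigma> ** inv2 \<rho>) ** (\<rho> ** inv2 \<rho>') = \<sigma> ** inv2 \<rho>'"
      using that det_SL2Z by (simp add: rel_def inv2_cancel_left flip: matrix_mul_assoc)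
    then show ?thesis using that Gamma0_mult unfolding rel_def by metis
  qed
  have rep: "rel \<sigma> (rep \<sigma>)" if "\<sigma> \<in> SL2Z" for \<sigma>
    unfolding rep_def using refl[OF that] by (rule someI)
  have repSL: "rep \<sigma> \<in> SL2Z" if "\<sigma> \<in> SL2Z" for \<sigma> using rep[OF that] by (simp add: rel_def)
  have rep_eq: "rep \<sigma> = rep \<rho>" if "rel \<sigma> \<rho>" "\<sigma> \<in> SL2Z" for \<sigma> \<rho>
  proof -
    have \<rho>: "\<rho> \<in> SL2Z" using that(1) by (simp add: rel_def)
    have "rel \<sigma> x \<longleftrightarrow> rel \<rho> x" for x
      using trans[OF that(1) _ that(2), of x] trans[OF sym[OF that] _ \<rho>, of x] by blast
    then show ?thesis by (simp add: rep_def)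
  qed
  define R where "R = rep ` SL2Z"
  have R: "R \<subseteq> SL2Z" using repSL by (auto simp: R_def)
  have rep_R: "rep r = r" if "r \<in> R" for r
    using that rep_eq[OF rep] by (auto simp: R_def)
  have eq: "r = r'" if "r \<in> R" "r' \<in> R" "rel r r'" for r r'
    using that rep_eq rep_R R by (metis subsetD)
  have "finite R"
  proof (rule inj_on_finite)
    show "finite ({0..<int N} \<times> {0..<int N})" by simp
    let ?f = "\<lambda>r::real^2^2. (\<lfloor>r$2$1\<rfloor> mod int N, \<lfloor>r$2$2\<rfloor> mod int N)"
    show "?f ` R \<subseteq> {0..<int N} \<times> {0..<int N}" using assms by auto
    show "inj_on ?f R"
    proof (rule inj_onI, rule eq)
      fix r r' assume r: "r \<in> R" "r' \<in> R" "?f r = ?f r'"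
      obtain c d where cd: "r$2$1 = of_int c" "r$2$2 = of_int d" using R r SL2Z_nth by (metis subsetD)
      obtain c' d' where cd': "r'$2$1 = of_int c'" "r'$2$2 = of_int d'" using R r SL2Z_nth by (metis subsetD)
      have "c mod int N = c' mod int N" "d mod int N = d' mod int N" using r(3) by (auto simp: cd cd')
      then have "int N dvd c - c'" "int N dvd d - d'" by (simp_all add: mod_eq_dvd_iff)
      then have "int N dvd (c - c') * d' - (d - d') * c'" by simp
      then obtain k where "(c - c') * d' - (d - d') * c' = int N * k" by (auto simp: dvd_def)
      then have "c * d' - d * c' = int N * k" by (simp add: algebra_simps)
      then have "real_of_int (c * d' - d * c') = of_int (int N * k)" by (rule arg_cong)
      then have "(r ** inv2 r')$2$1 = of_int (int N * k)"
        by (simp add: mult_nth cd cd' algebra_simps)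
      then show "rel r r'"
        using R r SL2Z_inv2 SL2Z_mult unfolding rel_def Gamma0_iff by blast
    qed auto
  qed
  moreover have "bij_betw (\<lambda>r. rep (r ** \<gamma>)) R R" if \<gamma>: "\<gamma> \<in> SL2Z" for \<gamma>
  proof -
    have "inj_on (\<lambda>r. rep (r ** \<gamma>)) R"
    proof (rule inj_onI)
      fix r r' assume r: "r \<in> R" "r' \<in> R" "rep (r ** \<gamma>) = rep (r' ** \<gamma>)"
      have SL: "r ** \<gamma> \<in> SL2Z" "r' ** \<gamma> \<in> SL2Z" using R r \<gamma> SL2Z_mult by blast+
      have "rel (r ** \<gamma>) (r' ** \<gamma>)" using trans sym rep SL r(3) by metis
      then have "rel r r'"
        using R r \<gamma> unfolding rel_def inv2_mult
        by (auto simp: det_SL2Z inv2_cancel_left' simp flip: matrix_mul_assoc)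
      then show "r = r'" using eq r by blast
    qed
    moreover have "(\<lambda>r. rep (r ** \<gamma>)) ` R \<subseteq> R" using R \<gamma> SL2Z_mult by (auto simp: R_def)
    ultimately show ?thesis using \<open>finite R\<close> by (simp add: bij_betw_def endo_inj_surj)
  qed
  moreover have "rep (mat 1) \<in> Gamma0 N"
    using sym[OF rep[OF mat1_in_SL2Z] mat1_in_SL2Z] by (simp add: rel_def)
  ultimately show ?thesis
    using that[of R rep] R rep by (auto simp: R_def rel_def)
qed

subsection \<open>A maximum principle for series of eigenfunctions\<close>

text \<open>The equation y^2 (f_xx + f_yy) = s (s - 1) f of the hyperbolic Laplacian. Derivatives
  are taken along horizontal and vertical lines only, which is all that a second derivative test at
  a maximum uses.\<close>

definition laplace_data where
  "laplace_data s f fx fy fxx fyy \<longleftrightarrow> (\<forall>\<tau>\<in>uhp.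
     ((\<lambda>t. f (\<tau> + of_real t)) has_real_derivative fx \<tau>) (at 0) \<and>
     ((\<lambda>t. fx (\<tau> + of_real t)) has_real_derivative fxx \<tau>) (at 0) \<and>
     ((\<lambda>t. f (\<tau> + \<i> * of_real t)) has_real_derivative fy \<tau>) (at 0) \<and>
     ((\<lambda>t. fy (\<tau> + \<i> * of_real t)) has_real_derivative fyy \<tau>) (at 0) \<and>
     fxx \<tau> + fyy \<tau> = s * (s - 1) / (Im \<tau>)\<^sup>2 * f \<tau>)"

definition laplace_eigen :: "real \<Rightarrow> (complex \<Rightarrow> real) \<Rightarrow> bool" where
  "laplace_eigen s f \<longleftrightarrow> (\<exists>fx fy fxx fyy. laplace_data s f fx fy fxx fyy)"

lemma laplace_eigen_cong:
  assumes "laplace_eigen s f" "\<And>\<tau>. \<tau> \<in> uhp \<Longrightarrow> f \<tau> = g \<tau>"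
  shows "laplace_eigen s g"
proof -
  obtain fx fy fxx fyy where f: "laplace_data s f fx fy fxx fyy"
    using assms(1) unfolding laplace_eigen_def by blast
  note f = f[unfolded laplace_data_def]
  have near: "((\<lambda>t. g (\<tau> + v * of_real t)) has_real_derivative d) (at 0)"
    if \<tau>: "\<tau> \<in> uhp" and d: "((\<lambda>t. f (\<tau> + v * of_real t)) has_real_derivative d) (at 0)" for \<tau> v d
  proof -
    have "open ((\<lambda>t. \<tau> + v * of_real t) -` uhp)"
      by (intro open_vimage open_uhp continuous_intros)
    then show ?thesis
      by (rule has_field_derivative_transform_within_open[OF d]) (use \<tau> assms(2) in auto)
  qed
  show ?thesis unfolding laplace_eigen_def laplace_data_def
    using f assms(2) near[of _ 1] near[of _ \<i>]
    by (intro exI[of _ fx] exI[of _ fy] exI[of _ fxx] exI[of _ fyy]) simp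
qed

lemma laplace_eigen_zero: "laplace_eigen s (\<lambda>_. 0)"
  unfolding laplace_eigen_def laplace_data_def by (rule exI[of _ "\<lambda>_. 0"])+ simp

lemma laplace_eigen_add:
  assumes "laplace_eigen s f" "laplace_eigen s g"
  shows "laplace_eigen s (\<lambda>\<tau>. f \<tau> + g \<tau>)"
proof -
  obtain fx fy fxx fyy where f: "laplace_data s f fx fy fxx fyy"
    using assms(1) unfolding laplace_eigen_def by blast
  note f = f[unfolded laplace_data_def]
  obtain gx gy gxx gyy where g: "laplace_data s g gx gy gxx gyy"
    using assms(2) unfolding laplace_eigen_def by blast
  note g = g[unfolded laplace_data_def]
  show ?thesis unfolding laplace_eigen_def laplace_data_def
  proof (intro exI ballI conjI)
    fix \<tau> assume \<tau>: "\<tau> \<in> uhp"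
    show "((\<lambda>t. f (\<tau> + of_real t) + g (\<tau> + of_real t)) has_real_derivative fx \<tau> + gx \<tau>) (at 0)"
      using f g \<tau> by (intro DERIV_add) blast+
    show "((\<lambda>t. fx (\<tau> + of_real t) + gx (\<tau> + of_real t)) has_real_derivative fxx \<tau> + gxx \<tau>) (at 0)"
      using f g \<tau> by (intro DERIV_add) blast+
    show "((\<lambda>t. f (\<tau> + \<i> * of_real t) + g (\<tau> + \<i> * of_real t)) has_real_derivative fy \<tau> + gy \<tau>) (at 0)"
      using f g \<tau> by (intro DERIV_add) blast+
    show "((\<lambda>t. fy (\<tau> + \<i> * of_real t) + gy (\<tau> + \<i> * of_real t)) has_real_derivative fyy \<tau> + gyy \<tau>) (at 0)"
      using f g \<tau> by (intro DERIV_add) blast+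
    have "fxx \<tau> + fyy \<tau> = s * (s - 1) / (Im \<tau>)\<^sup>2 * f \<tau>" "gxx \<tau> + gyy \<tau> = s * (s - 1) / (Im \<tau>)\<^sup>2 * g \<tau>"
      using f g \<tau> by blast+
    then show "fxx \<tau> + gxx \<tau> + (fyy \<tau> + gyy \<tau>) = s * (s - 1) / (Im \<tau>)\<^sup>2 * (f \<tau> + g \<tau>)"
      unfolding distrib_left by linarith
  qed
qed

lemma laplace_eigen_sum:
  assumes "\<And>i. i \<in> I \<Longrightarrow> laplace_eigen s (f i)"
  shows "laplace_eigen s (\<lambda>\<tau>. \<Sum>i\<in>I. f i \<tau>)"
  using assms by (induction I rule: infinite_finite_induct) (auto simp: laplace_eigen_zero laplace_eigen_add)

text \<open>If d were positive, \<phi>' would be positive just to the right of its zero at 0, and by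
  the mean value theorem \<phi> would exceed its maximum there.\<close>

lemma second_derivative_nonpos_at_max:
  fixes \<phi> \<phi>' :: "real \<Rightarrow> real"
  assumes "\<delta> > 0" and d1: "\<And>t. \<bar>t\<bar> < \<delta> \<Longrightarrow> (\<phi> has_real_derivative \<phi>' t) (at t)"
    and d2: "(\<phi>' has_real_derivative d) (at 0)"
    and mx: "\<And>t. \<bar>t\<bar> < \<delta> \<Longrightarrow> \<phi> t \<le> \<phi> 0"
  shows "d \<le> 0"
proof (rule ccontr)
  assume "\<not> d \<le> 0"
  have 0: "\<phi>' 0 = 0"
    using DERIV_local_max[OF d1[of 0], of \<delta>] mx \<open>\<delta> > 0\<close> by simp
  obtain e where e: "e > 0" "\<And>h. 0 < h \<Longrightarrow> h < e \<Longrightarrow> \<phi>' 0 < \<phi>' (0 + h)"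
    using DERIV_pos_inc_right[OF d2] \<open>\<not> d \<le> 0\<close> by auto
  define h where "h = min e \<delta> / 2"
  have h: "0 < h" "h < e" "h < \<delta>" using e \<open>\<delta> > 0\<close> by (auto simp: h_def)
  obtain z where z: "0 < z" "z < h" "\<phi> h - \<phi> 0 = (h - 0) * \<phi>' z"
    using MVT2[of 0 h \<phi> \<phi>'] d1 h by auto
  have "\<phi>' z > 0" using e(2)[of z] z h 0 by simp
  then have "\<phi> h > \<phi> 0" using z h by (simp add: algebra_simps)
  then show False using mx[of h] h by simp
qed

text \<open>The linear term is harmonic and the paraboloid has Laplacian 4 \<delta>. The second
  derivative test at q in the two coordinate directions therefore bounds the Laplacian of f at q by
  4 \<delta>.\<close>

lemma laplace_eigen_perturbed_max:
  assumes "laplace_eigen s f" "q \<in> uhp" "\<rho> > 0"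
    and mx: "\<And>\<tau>. dist \<tau> q < \<rho> \<Longrightarrow> f \<tau> - \<epsilon> * Im \<tau> - \<delta> * (cmod (\<tau> - p))\<^sup>2
                \<le> f q - \<epsilon> * Im q - \<delta> * (cmod (q - p))\<^sup>2"
  shows "s * (s - 1) / (Im q)\<^sup>2 * f q \<le> 4 * \<delta>"
proof -
  obtain fx fy fxx fyy where f: "laplace_data s f fx fy fxx fyy"
    using assms(1) unfolding laplace_eigen_def by blast
  note f = f[unfolded laplace_data_def]
  define r where "r = min \<rho> (Im q)"
  have "r > 0" using assms by (auto simp: r_def)
  have "fxx q - 2 * \<delta> \<le> 0"
  proof (rule second_derivative_nonpos_at_max[OF \<open>r > 0\<close>])
    fix t :: real assume t: "\<bar>t\<bar> < r"
    have "((\<lambda>t'. f (q + of_real t + of_real t')) has_real_derivative fx (q + of_real t)) (at 0)"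
      using f assms(2) by simp
    then have "((\<lambda>t. f (q + of_real t)) has_real_derivative fx (q + of_real t)) (at t)"
      using DERIV_shift[of "\<lambda>t. f (q + of_real t)" _ 0 t] by (simp add: add_ac)
    then show "((\<lambda>t. f (q + of_real t) - \<epsilon> * Im q - \<delta> * ((Re q + t - Re p)\<^sup>2 + (Im q - Im p)\<^sup>2))
      has_real_derivative (fx (q + of_real t) - 2 * \<delta> * (Re q + t - Re p))) (at t)"
      by (auto intro!: derivative_eq_intros)
    show "f (q + of_real t) - \<epsilon> * Im q - \<delta> * ((Re q + t - Re p)\<^sup>2 + (Im q - Im p)\<^sup>2)
      \<le> f (q + of_real 0) - \<epsilon> * Im q - \<delta> * ((Re q + 0 - Re p)\<^sup>2 + (Im q - Im p)\<^sup>2)"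
      using mx[of "q + of_real t"] t by (simp add: r_def dist_norm cmod_power2)
  next
    show "((\<lambda>t. fx (q + of_real t) - 2 * \<delta> * (Re q + t - Re p)) has_real_derivative (fxx q - 2 * \<delta>)) (at 0)"
      using f assms(2) by (auto intro!: derivative_eq_intros)
  qed
  moreover have "fyy q - 2 * \<delta> \<le> 0"
  proof (rule second_derivative_nonpos_at_max[OF \<open>r > 0\<close>])
    fix t :: real assume t: "\<bar>t\<bar> < r"
    have "((\<lambda>t'. f (q + \<i> * of_real t + \<i> * of_real t')) has_real_derivative fy (q + \<i> * of_real t)) (at 0)"
    proof -
      have "q + \<i> * of_real t \<in> uhp" using t by (simp add: r_def abs_less_iff)
      then show ?thesis using f by blast
    qed
    then have "((\<lambda>t. f (q + \<i> * of_real t)) has_real_derivative fy (q + \<i> * of_real t)) (at t)"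
      using DERIV_shift[of "\<lambda>t. f (q + \<i> * of_real t)" _ 0 t] by (simp add: ring_distribs add_ac)
    then show "((\<lambda>t. f (q + \<i> * of_real t) - \<epsilon> * (Im q + t) - \<delta> * ((Re q - Re p)\<^sup>2 + (Im q + t - Im p)\<^sup>2))
      has_real_derivative (fy (q + \<i> * of_real t) - \<epsilon> - 2 * \<delta> * (Im q + t - Im p))) (at t)"
      by (auto intro!: derivative_eq_intros)
    show "f (q + \<i> * of_real t) - \<epsilon> * (Im q + t) - \<delta> * ((Re q - Re p)\<^sup>2 + (Im q + t - Im p)\<^sup>2)
      \<le> f (q + \<i> * of_real 0) - \<epsilon> * (Im q + 0) - \<delta> * ((Re q - Re p)\<^sup>2 + (Im q + 0 - Im p)\<^sup>2)"
      using mx[of "q + \<i> * of_real t"] t by (simp add: r_def dist_norm cmod_power2 norm_mult)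
  next
    show "((\<lambda>t. fy (q + \<i> * of_real t) - \<epsilon> - 2 * \<delta> * (Im q + t - Im p)) has_real_derivative (fyy q - 2 * \<delta>)) (at 0)"
      using f assms(2) by (auto intro!: derivative_eq_intros)
  qed
  ultimately show ?thesis using f assms(2) by (smt (verit))
qed

section \<open>Periodic functions on a half plane\<close>

lemma translate_to_strip:
  fixes P :: real
  assumes "P > 0" and per: "\<And>\<tau>. Im \<tau> \<ge> y \<Longrightarrow> u (\<tau> + of_real P) = u \<tau>" and "Im \<tau> \<ge> y"
  obtains \<tau>' where "Im \<tau>' = Im \<tau>" "0 \<le> Re \<tau>'" "Re \<tau>' \<le> P" "u \<tau>' = u \<tau>"
proof -
  have nat: "u (\<tau> + of_real (of_nat k * P)) = u \<tau>" if "Im \<tau> \<ge> y" for k \<tau>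
    using per[of "\<tau> + of_real (of_nat j * P)" for j] that
    by (induction k) (simp_all add: ring_distribs add_ac)
  have int: "u (\<tau> + of_real (of_int k * P)) = u \<tau>" for k
  proof (cases "k \<ge> 0")
    case True
    then show ?thesis using nat[OF assms(3), of "nat k"] by simp
  next
    case False
    then show ?thesis using nat[of "\<tau> + of_real (of_int k * P)" "nat (- k)"] assms(3) by simp
  qed
  define k where "k = - \<lfloor>Re \<tau> / P\<rfloor>"
  have "of_int (- k) \<le> Re \<tau> / P" "Re \<tau> / P \<le> of_int (- k) + 1"
    unfolding k_def by linarith+
  then have "0 \<le> Re \<tau> + k * P" "Re \<tau> + k * P \<le> P"
    using \<open>P > 0\<close> by (simp_all add: field_simps)
  then show ?thesis using that[of "\<tau> + of_real (of_int k * P)"] int by simp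
qed

text \<open>By periodicity w lives on a half-infinite cylinder. The hypothesis \<open>large\<close>
  keeps the supremum from escaping upwards, which leaves a compact rectangle; its height is at least
  Im \<tau>, so that it contains a translate of \<tau> and its maximum is at least
  w(\<tau>).\<close>

lemma periodic_attains_sup:
  fixes w :: "complex \<Rightarrow> real"
  assumes "P > 0" and cont: "continuous_on {z. Im z \<ge> y} w"
    and per: "\<And>z. Im z \<ge> y \<Longrightarrow> w (z + of_real P) = w z"
    and \<tau>: "Im \<tau> \<ge> y" and large: "\<And>z. Im z \<ge> y \<Longrightarrow> Im z > Y \<Longrightarrow> w z \<le> w \<tau>"
  obtains q where "Im q \<ge> y" "\<And>z. Im z \<ge> y \<Longrightarrow> w z \<le> w q"
proof -
  define K where "K = cbox (Complex 0 y) (Complex P (max Y (Im \<tau>)))"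
  have K: "z \<in> K \<longleftrightarrow> 0 \<le> Re z \<and> Re z \<le> P \<and> y \<le> Im z \<and> Im z \<le> max Y (Im \<tau>)" for z
    by (auto simp: K_def in_cbox_complex_iff)
  have strip: "\<exists>z'\<in>K. w z' = w z" if z: "Im z \<ge> y" "Im z \<le> max Y (Im \<tau>)" for z
    by (rule translate_to_strip[of P y w z]) (use \<open>P > 0\<close> per z in \<open>auto simp: K\<close>)
  then have "K \<noteq> {}" using \<tau> by fastforce
  moreover have "continuous_on K w" by (rule continuous_on_subset[OF cont]) (auto simp: K)
  moreover have "compact K" by (simp add: K_def)
  ultimately obtain q where q: "q \<in> K" "\<And>z. z \<in> K \<Longrightarrow> w z \<le> w q"
    using continuous_attains_sup[of K w] by blast
  have "w z \<le> w q" if z: "Im z \<ge> y" "Im z \<le> max Y (Im \<tau>)" for z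
    using strip[OF z] q(2) by metis
  then have "w z \<le> w q" if "Im z \<ge> y" for z
    using that \<tau> large[of z] by (cases "Im z \<le> max Y (Im \<tau>)") force+
  moreover have "Im q \<ge> y" using q(1) by (simp add: K)
  ultimately show ?thesis using that by blast
qed

text \<open>A strict local maximum of the limit, sharpened by a paraboloid, yields interior maxima of the
  partial sums, where their Laplacian would have the wrong sign.  This avoids differentiating
  the series.\<close>

lemma laplace_eigen_series_max_principle:
  fixes u :: "complex \<Rightarrow> complex" and t :: "'i \<Rightarrow> complex \<Rightarrow> complex"
  assumes "s > 1" "y\<^sub>0 > 0" "P > 0"
    and eig: "\<And>i \<zeta>. i \<in> I \<Longrightarrow> laplace_eigen s (\<lambda>\<tau>. Re (\<zeta> * t i \<tau>))"
    and cont_t: "\<And>i. i \<in> I \<Longrightarrow> continuous_on uhp (t i)"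
    and unif: "\<And>p. Im p > y\<^sub>0 \<Longrightarrow> \<exists>r>0.
      uniform_limit (cball p r) (\<lambda>F \<tau>. \<Sum>i\<in>F. t i \<tau>) u (finite_subsets_at_top I)"
    and cont: "continuous_on {\<tau>. Im \<tau> \<ge> y\<^sub>0} u"
    and bound: "\<And>\<tau>. Im \<tau> \<ge> y\<^sub>0 \<Longrightarrow> cmod (u \<tau>) \<le> C"
    and per: "\<And>\<tau>. Im \<tau> \<ge> y\<^sub>0 \<Longrightarrow> u (\<tau> + of_real P) = u \<tau>"
    and line: "\<And>\<tau>. Im \<tau> = y\<^sub>0 \<Longrightarrow> cmod (u \<tau>) \<le> B"
    and \<tau>: "Im \<tau> \<ge> y\<^sub>0"
  shows "cmod (u \<tau>) \<le> B"
proof (rule ccontr)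
  note times_complex.sel(1) [simp del]
  assume "\<not> cmod (u \<tau>) \<le> B"
  then have gt: "cmod (u \<tau>) > B" by simp
  have "cmod (u (\<i> * y\<^sub>0)) \<le> B" by (rule line) simp
  then have B: "B \<ge> 0" using norm_ge_zero[of "u (\<i> * y\<^sub>0)"] by linarith
  \<comment> \<open>The phase of u(\<tau>) is rotated away: the modulus at \<tau> becomes the real
    part of \<zeta> u, and elsewhere that real part is at most the modulus.\<close>
  define \<zeta> where "\<zeta> = cnj (u \<tau>) / cmod (u \<tau>)"
  have nz: "cmod (u \<tau>) > 0" using gt B by linarith
  have \<zeta>: "cmod \<zeta> = 1" using nz by (simp add: \<zeta>_def norm_divide)
  have "\<zeta> * u \<tau> = cmod (u \<tau>)"
    using nz complex_norm_square[of "u \<tau>"] by (simp add: \<zeta>_def field_simps power2_eq_square)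
  then have Re\<tau>: "Re (\<zeta> * u \<tau>) = cmod (u \<tau>)" by simp
  have Re_le: "Re (\<zeta> * z) \<le> cmod z" for z
    using complex_Re_le_cmod[of "\<zeta> * z"] by (simp add: norm_mult \<zeta>)
  \<comment> \<open>Half of the excess of |u(\<tau>)| over B is spent on the linear term, so
    v(\<tau>) > B still holds, while v is negative far up in the cusp and hence attains its
    maximum.\<close>
  define \<epsilon> where "\<epsilon> = (cmod (u \<tau>) - B) / (2 * Im \<tau>)"
  have \<epsilon>: "\<epsilon> > 0" using gt \<tau> \<open>y\<^sub>0 > 0\<close> by (simp add: \<epsilon>_def)
  define v where "v z = Re (\<zeta> * u z) - \<epsilon> * Im z" for z
  have "\<epsilon> * Im \<tau> = (cmod (u \<tau>) - B) / 2" using \<tau> \<open>y\<^sub>0 > 0\<close> by (simp add: \<epsilon>_def)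
  then have v\<tau>: "v \<tau> > B" using gt Re\<tau> unfolding v_def by argo
  have "continuous_on {z. Im z \<ge> y\<^sub>0} v"
    unfolding v_def by (intro continuous_intros cont)
  moreover have "v z \<le> v \<tau>" if z: "Im z \<ge> y\<^sub>0" "Im z > C / \<epsilon>" for z
  proof -
    have "\<epsilon> * Im z > C" using \<epsilon> z by (simp add: field_simps)
    moreover have "Re (\<zeta> * u z) \<le> C" using Re_le[of "u z"] bound[OF z(1)] by simp
    ultimately show ?thesis using v\<tau> B by (simp add: v_def)
  qed
  ultimately obtain p where p: "Im p \<ge> y\<^sub>0" and glob: "\<And>z. Im z \<ge> y\<^sub>0 \<Longrightarrow> v z \<le> v p"
    using periodic_attains_sup[OF \<open>P > 0\<close>, of y\<^sub>0 v \<tau> "C / \<epsilon>"] per \<tau> by (auto simp: v_def)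
  have vp: "v p > B" using glob[OF \<tau>] v\<tau> by simp
  have Imp: "Im p > y\<^sub>0"
  proof (rule ccontr)
    assume "\<not> Im p > y\<^sub>0"
    then have "Im p = y\<^sub>0" using p by simp
    then have "Re (\<zeta> * u p) \<le> B" using line[of p] Re_le[of "u p"] by linarith
    moreover have "\<epsilon> * Im p > 0" using \<epsilon> \<open>Im p = y\<^sub>0\<close> \<open>y\<^sub>0 > 0\<close> by simp
    ultimately show False using vp by (simp add: v_def)
  qed
  define m where "m = Re (\<zeta> * u p)"
  have "\<epsilon> * Im p > 0" using \<epsilon> Imp \<open>y\<^sub>0 > 0\<close> by simp
  then have m: "m > 0" using vp B by (simp add: v_def m_def)
  obtain r0 where r0: "r0 > 0"
    "uniform_limit (cball p r0) (\<lambda>F \<tau>. \<Sum>i\<in>F. t i \<tau>) u (finite_subsets_at_top I)"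
    using unif[OF Imp] by blast
  \<comment> \<open>The disc stays above the horocycle and inside the region of uniform convergence,
    and on it the linear term differs by at most m / 4 from its value at p.\<close>
  define r where "r = min r0 (min (Im p - y\<^sub>0) (m / (4 * \<epsilon>)))"
  have r': "r > 0" "r \<le> r0" "r \<le> Im p - y\<^sub>0" "r \<le> m / (4 * \<epsilon>)"
    using r0 Imp m \<epsilon> by (simp_all add: r_def)
  then have r: "r > 0" "r \<le> r0" "r \<le> Im p - y\<^sub>0" "\<epsilon> * r \<le> m / 4"
    using \<epsilon> by (simp_all add: field_simps)
  define Z where "Z = Im p + r"
  have Z: "Z > 0" using Imp r \<open>y\<^sub>0 > 0\<close> by (simp add: Z_def)
  \<comment> \<open>Chosen so that 4 \<delta> is half of s (s - 1) / Z^2 * (m / 2), the lower bound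
    found below for the Laplacian of the partial sum at its perturbed maximum.\<close>
  define \<delta> where "\<delta> = s * (s - 1) * m / (16 * Z\<^sup>2)"
  have \<delta>: "\<delta> > 0" using \<open>s > 1\<close> m Z by (simp add: \<delta>_def)
  \<comment> \<open>The paraboloid lowers the boundary of the disc by \<delta> r^2, more than twice
    the error \<eta> of the partial sum, so the maximum is interior; the bound m / 4 keeps the
    partial sum at least m / 2 there.\<close>
  define \<eta> where "\<eta> = min (m / 4) (\<delta> * r\<^sup>2 / 4)"
  have \<eta>: "\<eta> > 0" "\<eta> \<le> m / 4" "2 * \<eta> < \<delta> * r\<^sup>2" using m \<delta> r by (auto simp: \<eta>_def min_def)
  have ImB: "y\<^sub>0 \<le> Im z" "Im z \<le> Z" if "z \<in> cball p r" for z
    using abs_Im_le_cmod[of "p - z"] that r by (auto simp: dist_norm Z_def)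
  have "\<forall>\<^sub>F F in finite_subsets_at_top I. \<forall>z\<in>cball p r0. dist (\<Sum>i\<in>F. t i z) (u z) < \<eta>"
    using r0(2) \<eta>(1) by (simp add: uniform_limit_iff)
  then obtain F where F0: "finite F" "F \<subseteq> I"
    "\<forall>F'. finite F' \<and> F \<subseteq> F' \<and> F' \<subseteq> I \<longrightarrow>
      (\<forall>z\<in>cball p r0. dist (\<Sum>i\<in>F'. t i z) (u z) < \<eta>)"
    unfolding eventually_finite_subsets_at_top by (elim exE conjE)
  then have F: "finite F" "F \<subseteq> I" "\<And>z. z \<in> cball p r0 \<Longrightarrow> dist (\<Sum>i\<in>F. t i z) (u z) < \<eta>"
    by (simp_all del: mem_cball)
  define f where "f z = (\<Sum>i\<in>F. Re (\<zeta> * t i z))" for z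
  have f_close: "\<bar>f z - Re (\<zeta> * u z)\<bar> < \<eta>" if "z \<in> cball p r" for z
  proof -
    have "f z - Re (\<zeta> * u z) = Re (\<zeta> * ((\<Sum>i\<in>F. t i z) - u z))"
      by (simp only: f_def right_diff_distrib sum_distrib_left minus_complex.sel Re_sum)
    then have "\<bar>f z - Re (\<zeta> * u z)\<bar> \<le> cmod (\<zeta> * ((\<Sum>i\<in>F. t i z) - u z))"
      using abs_Re_le_cmod by presburger
    also have "\<dots> < \<eta>" using F(3)[of z] that r by (simp add: norm_mult \<zeta> dist_norm)
    finally show ?thesis .
  qed
  have eigf: "laplace_eigen s f"
    unfolding f_def[abs_def] using F eig by (intro laplace_eigen_sum) auto
  define w where "w z = f z - \<epsilon> * Im z - \<delta> * (cmod (z - p))\<^sup>2" for z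
  have sub: "cball p r \<subseteq> uhp" using ImB \<open>y\<^sub>0 > 0\<close> by fastforce
  have "continuous_on (cball p r) w"
    unfolding w_def f_def using F sub cont_t
    by (intro continuous_intros continuous_on_subset[of uhp _ "cball p r"]) auto
  then obtain q where q: "q \<in> cball p r" "\<And>z. z \<in> cball p r \<Longrightarrow> w z \<le> w q"
    using continuous_attains_sup[of "cball p r" w] r by fastforce
  have "p \<in> cball p r" using r by simp
  have wp: "w p > v p - \<eta>" using f_close[OF \<open>p \<in> cball p r\<close>] by (simp add: w_def v_def)
  have "dist p q < r"
  proof (rule ccontr)
    assume "\<not> dist p q < r"
    then have "cmod (q - p) = r" using q(1) by (simp add: dist_norm norm_minus_commute)
    then have "w q < v q + \<eta> - \<delta> * r\<^sup>2" using f_close[OF q(1)] by (simp add: w_def v_def)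
    moreover have "v q \<le> v p" using glob ImB[OF q(1)] by simp
    ultimately show False using wp q(2)[OF \<open>p \<in> cball p r\<close>] \<eta>(3) by linarith
  qed
  have "s * (s - 1) / (Im q)\<^sup>2 * f q \<le> 4 * \<delta>"
  proof (rule laplace_eigen_perturbed_max[OF eigf])
    show "q \<in> uhp" using q sub by blast
    show "r - dist p q > 0" using \<open>dist p q < r\<close> by simp
    show "f z - \<epsilon> * Im z - \<delta> * (cmod (z - p))\<^sup>2 \<le> f q - \<epsilon> * Im q - \<delta> * (cmod (q - p))\<^sup>2"
      if "dist z q < r - dist p q" for z
      using q(2)[of z] that dist_triangle[of p z q] by (simp add: w_def dist_commute)
  qed
  moreover have "f q \<ge> m / 2"
  proof -
    have "w p \<le> w q" using q \<open>p \<in> cball p r\<close> by blast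
    moreover have "\<delta> * (cmod (q - p))\<^sup>2 \<ge> 0" using \<delta> by simp
    ultimately have "f q \<ge> f p - \<epsilon> * Im p + \<epsilon> * Im q" by (simp add: w_def)
    moreover have "\<epsilon> * Im p - \<epsilon> * Im q \<le> \<epsilon> * r"
      using abs_Im_le_cmod[of "p - q"] q(1) \<epsilon>
      by (simp add: dist_norm flip: right_diff_distrib)
    moreover have "f p > m - \<eta>" using f_close[OF \<open>p \<in> cball p r\<close>] by (simp add: m_def)
    ultimately show ?thesis using r \<eta> by linarith
  qed
  moreover have "s * (s - 1) / (Im q)\<^sup>2 \<ge> s * (s - 1) / Z\<^sup>2"
    using ImB[OF q(1)] \<open>y\<^sub>0 > 0\<close> \<open>s > 1\<close> Z by (intro divide_left_mono power_mono) auto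
  ultimately have "s * (s - 1) / Z\<^sup>2 * (m / 2) \<le> 4 * \<delta>"
    using m \<open>s > 1\<close> Z mult_mono[of "s * (s - 1) / Z\<^sup>2" "s * (s - 1) / (Im q)\<^sup>2" "m / 2" "f q"] by simp
  moreover have "4 * \<delta> = s * (s - 1) / Z\<^sup>2 * (m / 4)"
    using Z by (simp add: \<delta>_def field_simps)
  moreover have "s * (s - 1) / Z\<^sup>2 * (m / 4) > 0" using m \<open>s > 1\<close> Z by simp
  ultimately show False by simp
qed

subsection \<open>The Niebur-Poincare series\<close>

text \<open>$I_{s-1/2}(2\pi n y) = (\pi n y)^{s-1/2} \sum_k c_k y^{2k}$ with $c_k$ the following coefficients.\<close>

definition bessel_coeff :: "nat \<Rightarrow> real \<Rightarrow> nat \<Rightarrow> real" where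
  "bessel_coeff n s k = (pi * n) ^ (2 * k) * rGamma (s + 1 / 2 + k) / fact k"

definition bessel_fun :: "nat \<Rightarrow> real \<Rightarrow> real \<Rightarrow> real" where
  "bessel_fun n s z = (suminf (\<lambda>k. bessel_coeff n s k * z ^ k))"

text \<open>The factor sqrt(n y) I_{s-1/2}(2 pi n y) of a Niebur term, with the branch point at y =
  0 isolated as y^s times a power series in y^2. The exponent s decides the convergence of the
  Poincare series.\<close>

definition radial :: "nat \<Rightarrow> real \<Rightarrow> real \<Rightarrow> real" where
  "radial n s y = sqrt n * (pi * n) powr (s - 1 / 2) * (y powr s * bessel_fun n s (y\<^sup>2))"

text \<open>The functional equation z rGamma(z + 1) = rGamma(z) at z = s + 1/2 + k.\<close>

lemma bessel_coeff_Suc: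
  "(real k + s + 1 / 2) * (real k + 1) * bessel_coeff n s (Suc k) = (pi * n)\<^sup>2 * bessel_coeff n s k"
proof -
  define x where "x = real k + 1"
  define G where "G = rGamma (s + 1 / 2 + k + 1)"
  have x: "x > 0" by (simp add: x_def)
  have "s + 1 / 2 + real (Suc k) = s + 1 / 2 + k + 1" by simp
  then have 1: "bessel_coeff n s (Suc k) = (pi * n)\<^sup>2 * (pi * n) ^ (2 * k) * G / (x * fact k)"
    unfolding bessel_coeff_def G_def x_def by (simp add: power2_eq_square mult_ac)
  have 2: "bessel_coeff n s k = (pi * n) ^ (2 * k) * ((real k + s + 1 / 2) * G) / fact k"
    unfolding bessel_coeff_def G_def using rGamma_plus1[of "s + 1 / 2 + k"] by (simp add: add_ac)
  show ?thesis unfolding 1 2 x_def[symmetric] using x by (simp add: divide_simps)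
qed

text \<open>By the recurrence each step divides by (k + 1) (k + s + 1/2). The second factor is at
  least 1, and without it the coefficients are those of an exponential series.\<close>

lemma bessel_coeff_bound:
  assumes "s > 1"
  shows "\<bar>bessel_coeff n s k\<bar> \<le> \<bar>bessel_coeff n s 0\<bar> * ((pi * n)\<^sup>2) ^ k / fact k"
proof (induction k)
  case (Suc k)
  have "(real k + 1) * \<bar>bessel_coeff n s (Suc k)\<bar>
      \<le> (real k + s + 1 / 2) * ((real k + 1) * \<bar>bessel_coeff n s (Suc k)\<bar>)"
    using assms mult_right_mono[of 1 "real k + s + 1 / 2" "(real k + 1) * \<bar>bessel_coeff n s (Suc k)\<bar>"] by simp
  also have "\<dots> = \<bar>(real k + s + 1 / 2) * (real k + 1) * bessel_coeff n s (Suc k)\<bar>"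
    using assms by (simp add: abs_mult)
  also have "\<dots> = (pi * n)\<^sup>2 * \<bar>bessel_coeff n s k\<bar>"
    unfolding bessel_coeff_Suc by (simp add: abs_mult)
  also have "\<dots> \<le> (pi * n)\<^sup>2 * (\<bar>bessel_coeff n s 0\<bar> * ((pi * n)\<^sup>2) ^ k / fact k)"
    using Suc by (intro mult_left_mono) auto
  finally have "\<bar>bessel_coeff n s (Suc k)\<bar>
      \<le> (pi * n)\<^sup>2 * (\<bar>bessel_coeff n s 0\<bar> * ((pi * n)\<^sup>2) ^ k / fact k) / (real k + 1)"
    by (simp add: pos_le_divide_eq mult_ac)
  also have "\<dots> = \<bar>bessel_coeff n s 0\<bar> * ((pi * n)\<^sup>2) ^ Suc k / fact (Suc k)"
    unfolding fact_Suc power_Suc of_nat_Suc of_nat_mult by (simp only: divide_divide_eq_left mult_ac add_ac times_divide_eq_right)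
  finally show ?case .
qed simp

lemma summable_bessel:
  assumes "s > 1"
  shows "summable (\<lambda>k. bessel_coeff n s k * z ^ k)"
proof (rule summable_comparison_test')
  show "summable (\<lambda>k. \<bar>bessel_coeff n s 0\<bar> * (((pi * n)\<^sup>2 * \<bar>z\<bar>) ^ k /\<^sub>R fact k))"
    by (intro summable_mult summable_exp_generic)
  show "norm (bessel_coeff n s k * z ^ k) \<le> \<bar>bessel_coeff n s 0\<bar> * (((pi * n)\<^sup>2 * \<bar>z\<bar>) ^ k /\<^sub>R fact k)"
    for k
  proof -
    have "norm (bessel_coeff n s k * z ^ k) = \<bar>bessel_coeff n s k\<bar> * \<bar>z\<bar> ^ k"
      by (simp add: abs_mult power_abs)
    also have "\<dots> \<le> \<bar>bessel_coeff n s 0\<bar> * ((pi * n)\<^sup>2) ^ k / fact k * \<bar>z\<bar> ^ k"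
      by (intro mult_right_mono bessel_coeff_bound assms) auto
    finally show ?thesis by (simp add: power_mult_distrib field_simps)
  qed
qed

text \<open>The equation of the function 0F1 with parameter s + 1/2, that is,
  \<open>bessel_coeff_Suc\<close> read as an identity of power series. In the variable z = y^2
  termwise differentiation applies on the whole line.\<close>

lemma bessel_ode:
  assumes "s > 1"
  obtains B1 B2 :: "real \<Rightarrow> real" where
    "\<And>z. (bessel_fun n s has_real_derivative B1 z) (at z)"
    "\<And>z. (B1 has_real_derivative B2 z) (at z)"
    "\<And>z. z * B2 z + (s + 1 / 2) * B1 z = (pi * n)\<^sup>2 * bessel_fun n s z"
proof -
  define c where "c = bessel_coeff n s"
  have c: "summable (\<lambda>k. c k * z ^ k)" for z unfolding c_def by (rule summable_bessel[OF assms])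
  have c1: "summable (\<lambda>k. diffs c k * z ^ k)" for z by (rule termdiff_converges_all[OF c])
  have c2: "summable (\<lambda>k. diffs (diffs c) k * z ^ k)" for z by (rule termdiff_converges_all[OF c1])
  define B1 where "B1 z = (suminf (\<lambda>k. diffs c k * z ^ k))" for z
  define B2 where "B2 z = (suminf (\<lambda>k. diffs (diffs c) k * z ^ k))" for z
  have ode: "z * B2 z + (s + 1 / 2) * B1 z = (pi * n)\<^sup>2 * bessel_fun n s z" for z
  proof -
    have "(\<lambda>k. z * (diffs (diffs c) k * z ^ k)) sums (z * B2 z)"
      unfolding B2_def by (intro sums_mult summable_sums c2)
    then have "(\<lambda>k. real (Suc k) * diffs c (Suc k) * z ^ Suc k) sums (z * B2 z)"
      by (simp add: diffs_def[of "diffs c"] mult_ac)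
    then have "(\<lambda>k. real k * diffs c k * z ^ k) sums (z * B2 z)"
      using sums_Suc_imp[of "\<lambda>k. real k * diffs c k * z ^ k"] by simp
    moreover have "(\<lambda>k. (s + 1 / 2) * (diffs c k * z ^ k)) sums ((s + 1 / 2) * B1 z)"
      unfolding B1_def by (intro sums_mult summable_sums c1)
    ultimately have "(\<lambda>k. real k * diffs c k * z ^ k + (s + 1 / 2) * (diffs c k * z ^ k))
        sums (z * B2 z + (s + 1 / 2) * B1 z)"
      by (rule sums_add)
    moreover have "real k * diffs c k * z ^ k + (s + 1 / 2) * (diffs c k * z ^ k) = (pi * n)\<^sup>2 * (c k * z ^ k)" for k
    proof -
      have "real k * diffs c k * z ^ k + (s + 1 / 2) * (diffs c k * z ^ k)
          = ((real k + s + 1 / 2) * (real k + 1) * c (Suc k)) * z ^ k"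
      proof -
        have "x * ((1 + x) * d) * w + (s + h) * ((1 + x) * d * w) = (x + s + h) * (x + 1) * d * w"
          for x d w h :: real by (simp add: algebra_simps)
        then show ?thesis unfolding diffs_def of_nat_Suc .
      qed
      then show ?thesis unfolding c_def bessel_coeff_Suc by simp
    qed
    ultimately have "(\<lambda>k. (pi * n)\<^sup>2 * (c k * z ^ k)) sums (z * B2 z + (s + 1 / 2) * B1 z)" by simp
    moreover have "(\<lambda>k. (pi * n)\<^sup>2 * (c k * z ^ k)) sums ((pi * n)\<^sup>2 * bessel_fun n s z)"
      unfolding bessel_fun_def c_def[symmetric] by (intro sums_mult summable_sums c)
    ultimately show ?thesis by (rule sums_unique2)
  qed
  have d1: "(bessel_fun n s has_real_derivative B1 z) (at z)" for z
    unfolding bessel_fun_def[abs_def] B1_def c_def[symmetric]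
    by (rule termdiffs_strong_converges_everywhere[OF c])
  have d2: "(B1 has_real_derivative B2 z) (at z)" for z
    unfolding B1_def[abs_def] B2_def by (rule termdiffs_strong_converges_everywhere[OF c1])
  show ?thesis by (rule that[OF d1 d2 ode])
qed

text \<open>The modified Bessel equation for sqrt(y) I_{s-1/2}. It is what separation of variables
  leaves of the hyperbolic eigenvalue equation for e(-n x) R(y).\<close>

lemma radial_ode:
  assumes "s > 1"
  obtains R1 R2 :: "real \<Rightarrow> real" where
    "\<And>y. y > 0 \<Longrightarrow> (radial n s has_real_derivative R1 y) (at y)"
    "\<And>y. y > 0 \<Longrightarrow> (R1 has_real_derivative R2 y) (at y)"
    "\<And>y. y > 0 \<Longrightarrow> R2 y = ((2 * pi * n)\<^sup>2 + s * (s - 1) / y\<^sup>2) * radial n s y"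
proof -
  define B where "B = bessel_fun n s"
  obtain B1 B2 where B: "\<And>z. (B has_real_derivative B1 z) (at z)"
    "\<And>z. (B1 has_real_derivative B2 z) (at z)"
    "\<And>z. z * B2 z + (s + 1 / 2) * B1 z = (pi * n)\<^sup>2 * B z"
    unfolding B_def using bessel_ode[OF assms] by blast
  define C where "C = sqrt n * (pi * n) powr (s - 1 / 2)"
  define R1 where "R1 y = C * (s * y powr (s - 1) * B (y\<^sup>2) + 2 * y powr (s + 1) * B1 (y\<^sup>2))" for y
  define R2 where "R2 y = C * y powr (s - 2) * (s * (s - 1) * B (y\<^sup>2) + (4 * s + 2) * y\<^sup>2 * B1 (y\<^sup>2)
     + 4 * (y\<^sup>2)\<^sup>2 * B2 (y\<^sup>2))" for y
  have pw: "y powr (s - 1) = y powr (s - 2) * y" "y powr s = y powr (s - 2) * y\<^sup>2"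
    "y powr (s + 1) = y powr (s - 2) * y ^ 3" if "y > 0" for y
    using that powr_add[of y "s - 2" 1] powr_add[of y "s - 2" 2] powr_add[of y "s - 2" 3]
    by (simp_all add: powr_numeral add.commute)
  have dB: "((\<lambda>y. B (y\<^sup>2)) has_real_derivative B1 (y\<^sup>2) * (2 * y)) (at y)"
    "((\<lambda>y. B1 (y\<^sup>2)) has_real_derivative B2 (y\<^sup>2) * (2 * y)) (at y)" for y
  proof -
    have sq: "((\<lambda>y. y\<^sup>2) has_real_derivative 2 * y) (at y)" by (auto intro!: derivative_eq_intros)
    show "((\<lambda>y. B (y\<^sup>2)) has_real_derivative B1 (y\<^sup>2) * (2 * y)) (at y)"
      "((\<lambda>y. B1 (y\<^sup>2)) has_real_derivative B2 (y\<^sup>2) * (2 * y)) (at y)"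
      by (rule DERIV_chain2[OF B(1) sq], rule DERIV_chain2[OF B(2) sq])
  qed
  have rad: "radial n s = (\<lambda>y. C * (y powr s * B (y\<^sup>2)))"
    by (simp add: radial_def C_def B_def fun_eq_iff)
  have "(radial n s has_real_derivative R1 y) (at y)" if y: "y > 0" for y
  proof -
    have "(radial n s has_real_derivative
        C * (s * y powr (s - 1) * B (y\<^sup>2) + B1 (y\<^sup>2) * (2 * y) * y powr s)) (at y)"
      unfolding rad by (intro DERIV_cmult DERIV_mult has_real_derivative_powr dB y)
    then show ?thesis by (simp add: R1_def pw[OF y] power2_eq_square power3_eq_cube mult_ac)
  qed
  moreover have "(R1 has_real_derivative R2 y) (at y)" if y: "y > 0" for y
  proof -
    have "s + 1 - 1 = s" "s - 1 - 1 = s - 2" by simp_all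
    note d = has_real_derivative_powr[OF y, of "s - 1", unfolded this]
       has_real_derivative_powr[OF y, of "s + 1", unfolded this]
    have "(R1 has_real_derivative
        C * ((s * ((s - 1) * y powr (s - 2)) * B (y\<^sup>2) + B1 (y\<^sup>2) * (2 * y) * (s * y powr (s - 1)))
           + (2 * ((s + 1) * y powr s) * B1 (y\<^sup>2) + B2 (y\<^sup>2) * (2 * y) * (2 * y powr (s + 1))))) (at y)"
      unfolding R1_def[abs_def] by (intro DERIV_cmult DERIV_mult DERIV_add d dB)
    moreover have "C * ((s * ((s - 1) * y powr (s - 2)) * B (y\<^sup>2) + B1 (y\<^sup>2) * (2 * y) * (s * y powr (s - 1)))
           + (2 * ((s + 1) * y powr s) * B1 (y\<^sup>2) + B2 (y\<^sup>2) * (2 * y) * (2 * y powr (s + 1)))) = R2 y"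
      unfolding R2_def pw[OF y] by (simp add: algebra_simps power2_eq_square power3_eq_cube)
    ultimately show ?thesis by simp
  qed
  moreover have "R2 y = ((2 * pi * n)\<^sup>2 + s * (s - 1) / y\<^sup>2) * radial n s y" if y: "y > 0" for y
  proof -
    have "R2 y = C * y powr (s - 2) * (s * (s - 1) * B (y\<^sup>2) + 4 * y\<^sup>2 * (y\<^sup>2 * B2 (y\<^sup>2) + (s + 1 / 2) * B1 (y\<^sup>2)))"
      unfolding R2_def by (simp add: field_simps power2_eq_square)
    also have "\<dots> = C * y powr (s - 2) * (s * (s - 1) * B (y\<^sup>2) + 4 * y\<^sup>2 * ((pi * n)\<^sup>2 * B (y\<^sup>2)))"
      unfolding B(3) ..
    also have "\<dots> = ((2 * pi * n)\<^sup>2 + s * (s - 1) / y\<^sup>2) * (C * (y powr (s - 2) * y\<^sup>2 * B (y\<^sup>2)))"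
      using y by (simp add: field_simps)
    finally show ?thesis using pw[OF y] by (simp add: rad)
  qed
  ultimately show ?thesis by (rule that)
qed

text \<open>For real s every quantity in the Bessel series is real, and y^(1/2) y^(s-1/2) = y^s
  collects the powers of y.\<close>

lemma niebur_term_radial:
  assumes "n \<ge> 1" "s > 1" "\<tau> \<in> uhp"
  shows "niebur_term n (of_real s) \<tau> = ee (- of_nat n * of_real (Re \<tau>)) * of_real (radial n s (Im \<tau>))"
proof -
  define y where "y = Im \<tau>"
  have y: "y > 0" using assms by (simp add: y_def)
  have "of_real (2 * pi * real n * y / 2) powr (of_real s - 1 / 2 + 2 * of_nat k)
          * rGamma (complex_of_real s - 1 / 2 + of_nat k + 1) / fact k
      = complex_of_real ((pi * n * y) powr (s - 1 / 2) * (bessel_coeff n s k * (y\<^sup>2) ^ k))" for k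
  proof -
    have "complex_of_real s - 1 / 2 + 2 * of_nat k = of_real (s - 1 / 2 + 2 * k)"
      by simp
    then have "complex_of_real (2 * pi * real n * y / 2) powr (of_real s - 1 / 2 + 2 * of_nat k)
      = of_real ((pi * n * y) powr (s - 1 / 2 + 2 * k))"
      using y by (simp only:) (subst powr_of_real, auto simp: mult_ac)
    also have "(pi * n * y) powr (s - 1 / 2 + 2 * k) = (pi * n * y) powr (s - 1 / 2) * (pi * n * y) powr (real (2 * k))"
      by (simp add: powr_add)
    also have "(pi * n * y) powr (real (2 * k)) = (pi * n) ^ (2 * k) * (y\<^sup>2) ^ k"
      using y assms by (subst powr_realpow) (simp_all add: power_mult_distrib power_mult)
    finally have 1: "complex_of_real (2 * pi * real n * y / 2) powr (of_real s - 1 / 2 + 2 * of_nat k)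
      = of_real ((pi * n * y) powr (s - 1 / 2) * ((pi * n) ^ (2 * k) * (y\<^sup>2) ^ k))" .
    have "complex_of_real s - 1 / 2 + of_nat k + 1 = of_real (s + 1 / 2 + k)"
      by simp
    then have 2: "rGamma (complex_of_real s - 1 / 2 + of_nat k + 1) = of_real (rGamma (s + 1 / 2 + k))"
      by (simp only: rGamma_complex_of_real)
    show ?thesis unfolding 1 2 bessel_coeff_def by simp
  qed
  then have "Bessel_I (of_real s - 1 / 2) (2 * pi * real n * y)
      = (suminf (\<lambda>k. complex_of_real ((pi * n * y) powr (s - 1 / 2) * (bessel_coeff n s k * (y\<^sup>2) ^ k))))"
    unfolding Bessel_I_def by presburger
  also have "\<dots> = of_real (suminf (\<lambda>k. (pi * n * y) powr (s - 1 / 2) * (bessel_coeff n s k * (y\<^sup>2) ^ k)))"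
    by (intro suminf_of_real[symmetric] summable_mult summable_bessel assms)
  also have "(suminf (\<lambda>k. (pi * n * y) powr (s - 1 / 2) * (bessel_coeff n s k * (y\<^sup>2) ^ k)))
      = (pi * n * y) powr (s - 1 / 2) * bessel_fun n s (y\<^sup>2)"
    unfolding bessel_fun_def by (intro suminf_mult summable_bessel assms)
  finally have "of_real (sqrt (n * y)) * Bessel_I (of_real s - 1 / 2) (2 * pi * real n * y)
     = of_real (sqrt (n * y) * (pi * n * y) powr (s - 1 / 2) * bessel_fun n s (y\<^sup>2))" by simp
  also have "sqrt (n * y) * (pi * n * y) powr (s - 1 / 2) = sqrt n * (pi * n) powr (s - 1 / 2) * y powr s"
  proof -
    have "sqrt y * y powr (s - 1 / 2) = y powr (1 / 2 + (s - 1 / 2))"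
      using y by (simp only: powr_add powr_half_sqrt less_imp_le)
    also have "1 / 2 + (s - 1 / 2) = s" by simp
    finally show ?thesis using y
      by (simp add: powr_mult real_sqrt_mult)
  qed
  finally show ?thesis
    unfolding niebur_term_def radial_def y_def[symmetric] by (simp add: mult_ac)
qed

text \<open>The factor \<open>bessel_fun\<close> is continuous up to 0 and hence bounded on
  [0, Y^2]; what remains is the power y^s.\<close>

lemma radial_bound:
  assumes "s > 1"
  obtains K where "K > 0" "\<And>y. 0 < y \<Longrightarrow> y \<le> Y \<Longrightarrow> \<bar>radial n s y\<bar> \<le> K * y powr s"
proof -
  obtain B1 where "\<And>z. (bessel_fun n s has_real_derivative B1 z) (at z)"
    using bessel_ode[OF assms] by metis
  then have "continuous_on {0..Y\<^sup>2} (bessel_fun n s)"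
    by (meson DERIV_isCont continuous_at_imp_continuous_on)
  then have "bounded (bessel_fun n s ` {0..Y\<^sup>2})"
    using compact_continuous_image compact_imp_bounded compact_Icc by blast
  then obtain M where M: "M > 0" "\<And>z. z \<in> {0..Y\<^sup>2} \<Longrightarrow> \<bar>bessel_fun n s z\<bar> \<le> M"
    unfolding bounded_pos by auto
  define C where "C = sqrt n * (pi * n) powr (s - 1 / 2)"
  show ?thesis
  proof (rule that)
    show "C * M + 1 > 0" using M by (simp add: C_def add_nonneg_pos)
    show "\<bar>radial n s y\<bar> \<le> (C * M + 1) * y powr s" if "0 < y" "y \<le> Y" for y
    proof -
      have "\<bar>radial n s y\<bar> = C * y powr s * \<bar>bessel_fun n s (y\<^sup>2)\<bar>"
        by (simp add: radial_def C_def abs_mult)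
      also have "\<dots> \<le> C * y powr s * M"
        using that M(2)[of "y\<^sup>2"] by (intro mult_left_mono) (auto simp: C_def power_mono)
      also have "\<dots> \<le> (C * M + 1) * y powr s" by (simp add: algebra_simps)
      finally show ?thesis .
    qed
  qed
qed

lemma norm_ee_real [simp]: "cmod (ee (of_real x)) = 1"
  by (simp add: ee_def)

lemma norm_niebur_term:
  assumes "n \<ge> 1" "s > 1" "\<tau> \<in> uhp"
  shows "cmod (niebur_term n (of_real s) \<tau>) = \<bar>radial n s (Im \<tau>)\<bar>"
  using norm_ee_real[of "- real n * Re \<tau>"]
  by (simp add: niebur_term_radial[OF assms] norm_mult)

section \<open>Niebur terms as eigenfunctions of the hyperbolic Laplacian\<close>

lemma DERIV_line:
  assumes "(h has_field_derivative h') (at \<tau>)"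
  shows "((\<lambda>t. Re (h (\<tau> + v * of_real t))) has_real_derivative Re (h' * v)) (at 0)"
    and "((\<lambda>t. Im (h (\<tau> + v * of_real t))) has_real_derivative Im (h' * v)) (at 0)"
proof -
  have "((\<lambda>t. \<tau> + v * of_real t) has_vector_derivative v) (at 0)"
    by (auto intro!: derivative_eq_intros)
  then have "((h \<circ> (\<lambda>t. \<tau> + v * of_real t)) has_vector_derivative v * h') (at 0)"
    using assms by (intro field_vector_diff_chain_at) auto
  then have d: "((\<lambda>t. h (\<tau> + v * of_real t)) has_vector_derivative h' * v) (at 0)"
    by (simp add: o_def mult.commute)
  show "((\<lambda>t. Re (h (\<tau> + v * of_real t))) has_real_derivative Re (h' * v)) (at 0)"
    "((\<lambda>t. Im (h (\<tau> + v * of_real t))) has_real_derivative Im (h' * v)) (at 0)"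
    by (rule has_field_derivative_Re[OF d], rule has_field_derivative_Im[OF d])
qed

text \<open>Invariance of the hyperbolic Laplacian. For holomorphic M the Laplacian of F o M is
  |M'|^2 times that of F at M, the mixed terms and the terms with M'' cancelling by the
  Cauchy-Riemann equations, and |M'| / Im M = 1 / Im \<tau> for a Moebius map of determinant
  1.\<close>

lemma laplace_eigen_niebur_term:
  assumes "n \<ge> 1" "s > 1" "det A = 1"
  shows "laplace_eigen s (\<lambda>\<tau>. Re (\<zeta> * niebur_term n (of_real s) (moeb A \<tau>)))"
proof -
  define \<kappa> where "\<kappa> = 2 * pi * n"
  \<comment> \<open>This is Re(\<zeta> e(-n x)), so that f below is a product of real functions of
    the two coordinates of \<open>moeb A \<tau>\<close>.\<close>
  define E where "E x = Re \<zeta> * cos (\<kappa> * x) + Im \<zeta> * sin (\<kappa> * x)" for x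
  define E1 where "E1 x = \<kappa> * (Im \<zeta> * cos (\<kappa> * x) - Re \<zeta> * sin (\<kappa> * x))" for x
  have E: "(E has_real_derivative E1 x) (at x)" "(E1 has_real_derivative - \<kappa>\<^sup>2 * E x) (at x)" for x
    unfolding E_def[abs_def] E1_def[abs_def]
    by (auto intro!: derivative_eq_intros simp: algebra_simps power2_eq_square)
  define R where "R = radial n s"
  obtain R1 R2 where R: "\<And>y. y > 0 \<Longrightarrow> (R has_real_derivative R1 y) (at y)"
    "\<And>y. y > 0 \<Longrightarrow> (R1 has_real_derivative R2 y) (at y)"
    "\<And>y. y > 0 \<Longrightarrow> R2 y = (\<kappa>\<^sup>2 + s * (s - 1) / y\<^sup>2) * R y"
    unfolding R_def \<kappa>_def using radial_ode[OF assms(2)] by blast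
  define X where "X \<tau> = Re (moeb A \<tau>)" for \<tau>
  define Y where "Y \<tau> = Im (moeb A \<tau>)" for \<tau>
  define D where "D \<tau> = 1 / (autom A \<tau>)\<^sup>2" for \<tau>
  define D2 where "D2 \<tau> = - 2 * of_real (A$2$1) / (autom A \<tau>) ^ 3" for \<tau>
  have Y: "Y \<tau> > 0" if "\<tau> \<in> uhp" for \<tau> using moeb_uhp[OF assms(3) that] by (simp add: Y_def)
  have M': "(moeb A has_field_derivative D \<tau>) (at \<tau>)" if "\<tau> \<in> uhp" for \<tau>
    using moeb_has_derivative[OF assms(3) that] by (simp add: D_def)
  have D': "(D has_field_derivative D2 \<tau>) (at \<tau>)" if "\<tau> \<in> uhp" for \<tau>
  proof -
    have nz: "autom A \<tau> \<noteq> 0" by (rule autom_nonzero[OF assms(3) that])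
    have a: "(autom A has_field_derivative of_real (A$2$1)) (at \<tau>)"
      unfolding autom_def[abs_def] by (auto intro!: derivative_eq_intros)
    show ?thesis unfolding D_def[abs_def] D2_def using nz
      by (auto intro!: derivative_eq_intros a simp: field_simps power2_eq_square power3_eq_cube)
  qed
  define f where "f \<tau> = E (X \<tau>) * R (Y \<tau>)" for \<tau>
  have f: "Re (\<zeta> * niebur_term n (of_real s) (moeb A \<tau>)) = f \<tau>" if "\<tau> \<in> uhp" for \<tau>
  proof -
    have "ee (- of_nat n * of_real (X \<tau>)) = cis (- (\<kappa> * X \<tau>))"
      by (simp add: ee_def cis_conv_exp \<kappa>_def mult_ac)
    then have "niebur_term n (of_real s) (moeb A \<tau>) = cis (- (\<kappa> * X \<tau>)) * of_real (R (Y \<tau>))"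
      using niebur_term_radial[OF assms(1,2) moeb_uhp[OF assms(3) that]] by (simp add: X_def Y_def R_def)
    then show ?thesis by (simp add: f_def E_def algebra_simps)
  qed
  have XY: "((\<lambda>t. X (\<tau> + v * of_real t)) has_real_derivative Re (D \<tau> * v)) (at 0)"
    "((\<lambda>t. Y (\<tau> + v * of_real t)) has_real_derivative Im (D \<tau> * v)) (at 0)"
    "((\<lambda>t. Re (D (\<tau> + v * of_real t))) has_real_derivative Re (D2 \<tau> * v)) (at 0)"
    "((\<lambda>t. Im (D (\<tau> + v * of_real t))) has_real_derivative Im (D2 \<tau> * v)) (at 0)"
    if "\<tau> \<in> uhp" for \<tau> v
    unfolding X_def Y_def by (intro DERIV_line M' D' that)+
  have comp: "((\<lambda>t. E (X (\<tau> + v * of_real t))) has_real_derivative E1 (X \<tau>) * Re (D \<tau> * v)) (at 0)"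
    "((\<lambda>t. E1 (X (\<tau> + v * of_real t))) has_real_derivative - \<kappa>\<^sup>2 * E (X \<tau>) * Re (D \<tau> * v)) (at 0)"
    "((\<lambda>t. R (Y (\<tau> + v * of_real t))) has_real_derivative R1 (Y \<tau>) * Im (D \<tau> * v)) (at 0)"
    "((\<lambda>t. R1 (Y (\<tau> + v * of_real t))) has_real_derivative R2 (Y \<tau>) * Im (D \<tau> * v)) (at 0)"
    if "\<tau> \<in> uhp" for \<tau> v
  proof -
    have Y0: "Y (\<tau> + v * of_real 0) > 0" using Y[OF that] by simp
    show "((\<lambda>t. E (X (\<tau> + v * of_real t))) has_real_derivative E1 (X \<tau>) * Re (D \<tau> * v)) (at 0)"
      using DERIV_chain2[OF E(1) XY(1)[OF that]] by simp
    show "((\<lambda>t. E1 (X (\<tau> + v * of_real t))) has_real_derivative - \<kappa>\<^sup>2 * E (X \<tau>) * Re (D \<tau> * v)) (at 0)"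
      using DERIV_chain2[OF E(2) XY(1)[OF that]] by simp
    show "((\<lambda>t. R (Y (\<tau> + v * of_real t))) has_real_derivative R1 (Y \<tau>) * Im (D \<tau> * v)) (at 0)"
      using DERIV_chain2[OF R(1)[OF Y0] XY(2)[OF that]] by simp
    show "((\<lambda>t. R1 (Y (\<tau> + v * of_real t))) has_real_derivative R2 (Y \<tau>) * Im (D \<tau> * v)) (at 0)"
      using DERIV_chain2[OF R(2)[OF Y0] XY(2)[OF that]] by simp
  qed
  \<comment> \<open>The chain rule in the directions 1 and \<i>. The direction \<i> replaces (Re D,
    Im D) by (- Im D, Re D), and in the second derivatives its square -1 reverses the terms with
    \<open>D2\<close>.\<close>
  define fx where "fx \<tau> = E1 (X \<tau>) * Re (D \<tau>) * R (Y \<tau>) + E (X \<tau>) * (R1 (Y \<tau>) * Im (D \<tau>))" for \<tau>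
  define fy where "fy \<tau> = E (X \<tau>) * (R1 (Y \<tau>) * Re (D \<tau>)) - E1 (X \<tau>) * Im (D \<tau>) * R (Y \<tau>)" for \<tau>
  define fxx where "fxx \<tau> = (- \<kappa>\<^sup>2 * E (X \<tau>) * (Re (D \<tau>))\<^sup>2 + E1 (X \<tau>) * Re (D2 \<tau>)) * R (Y \<tau>)
     + 2 * E1 (X \<tau>) * R1 (Y \<tau>) * Re (D \<tau>) * Im (D \<tau>)
     + E (X \<tau>) * (R2 (Y \<tau>) * (Im (D \<tau>))\<^sup>2 + R1 (Y \<tau>) * Im (D2 \<tau>))" for \<tau>
  define fyy where "fyy \<tau> = (- \<kappa>\<^sup>2 * E (X \<tau>) * (Im (D \<tau>))\<^sup>2 - E1 (X \<tau>) * Re (D2 \<tau>)) * R (Y \<tau>)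
     - 2 * E1 (X \<tau>) * R1 (Y \<tau>) * Re (D \<tau>) * Im (D \<tau>)
     + E (X \<tau>) * (R2 (Y \<tau>) * (Re (D \<tau>))\<^sup>2 - R1 (Y \<tau>) * Im (D2 \<tau>))" for \<tau>
  have "((\<lambda>t. f (\<tau> + of_real t)) has_real_derivative fx \<tau>) (at 0) \<and>
     ((\<lambda>t. fx (\<tau> + of_real t)) has_real_derivative fxx \<tau>) (at 0) \<and>
     ((\<lambda>t. f (\<tau> + \<i> * of_real t)) has_real_derivative fy \<tau>) (at 0) \<and>
     ((\<lambda>t. fy (\<tau> + \<i> * of_real t)) has_real_derivative fyy \<tau>) (at 0) \<and>
     fxx \<tau> + fyy \<tau> = s * (s - 1) / (Im \<tau>)\<^sup>2 * f \<tau>" if \<tau>: "\<tau> \<in> uhp" for \<tau>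
  proof (intro conjI)
    note [derivative_intros] = comp[OF \<tau>, of 1, simplified] XY(3,4)[OF \<tau>, of 1, simplified]
      comp[OF \<tau>, of \<i>, simplified] XY(3,4)[OF \<tau>, of \<i>, simplified]
    show "((\<lambda>t. f (\<tau> + of_real t)) has_real_derivative fx \<tau>) (at 0)"
      unfolding f_def fx_def by (auto intro!: derivative_eq_intros)
    show "((\<lambda>t. fx (\<tau> + of_real t)) has_real_derivative fxx \<tau>) (at 0)"
      unfolding fx_def fxx_def by (auto intro!: derivative_eq_intros simp: algebra_simps power2_eq_square)
    show "((\<lambda>t. f (\<tau> + \<i> * of_real t)) has_real_derivative fy \<tau>) (at 0)"
      unfolding f_def fy_def by (auto intro!: derivative_eq_intros)
    show "((\<lambda>t. fy (\<tau> + \<i> * of_real t)) has_real_derivative fyy \<tau>) (at 0)"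
      unfolding fy_def fyy_def by (auto intro!: derivative_eq_intros simp: algebra_simps power2_eq_square)
    have "fxx \<tau> + fyy \<tau> = ((Re (D \<tau>))\<^sup>2 + (Im (D \<tau>))\<^sup>2) * E (X \<tau>) * (R2 (Y \<tau>) - \<kappa>\<^sup>2 * R (Y \<tau>))"
      unfolding fxx_def fyy_def by (simp only: algebra_simps)
    also have "R2 (Y \<tau>) - \<kappa>\<^sup>2 * R (Y \<tau>) = s * (s - 1) / (Y \<tau>)\<^sup>2 * R (Y \<tau>)"
      using R(3)[OF Y[OF \<tau>]] by (simp add: algebra_simps)
    also have "(Re (D \<tau>))\<^sup>2 + (Im (D \<tau>))\<^sup>2 = (cmod (D \<tau>))\<^sup>2" by (simp add: cmod_power2)
    finally have "fxx \<tau> + fyy \<tau> = (cmod (D \<tau>) / Y \<tau>)\<^sup>2 * (s * (s - 1) * f \<tau>)"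
      by (simp add: f_def power_divide)
    moreover have "cmod (D \<tau>) / Y \<tau> = 1 / Im \<tau>"
      using autom_nonzero[OF assms(3) \<tau>] \<tau>
      by (simp add: Y_def Im_moeb[OF assms(3)] D_def norm_divide norm_power)
    ultimately show "fxx \<tau> + fyy \<tau> = s * (s - 1) / (Im \<tau>)\<^sup>2 * f \<tau>"
      by (simp add: power_divide)
  qed
  then have "laplace_eigen s f" unfolding laplace_eigen_def laplace_data_def by blast
  then show ?thesis by (rule laplace_eigen_cong) (rule f[symmetric])
qed

lemma continuous_on_niebur_term:
  assumes "n \<ge> 1" "s > 1" "det A = 1"
  shows "continuous_on uhp (\<lambda>\<tau>. niebur_term n (of_real s) (moeb A \<tau>))"
proof -
  obtain R1 where R1: "\<And>y. y > 0 \<Longrightarrow> (radial n s has_real_derivative R1 y) (at y)"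
    using radial_ode[OF assms(2)] by metis
  have rad: "continuous_on {0<..} (radial n s)"
    by (meson R1 DERIV_isCont continuous_at_imp_continuous_on greaterThan_iff)
  have moeb: "continuous_on uhp (moeb A)"
    by (intro continuous_at_imp_continuous_on ballI) (use moeb_has_derivative[OF assms(3)] DERIV_isCont in blast)
  have "continuous_on uhp (\<lambda>\<tau>. radial n s (Im (moeb A \<tau>)))"
    by (rule continuous_on_compose2[OF rad]) (use moeb moeb_uhp[OF assms(3)] in \<open>auto intro!: continuous_intros\<close>)
  then have "continuous_on uhp (\<lambda>\<tau>. ee (- of_nat n * of_real (Re (moeb A \<tau>))) * of_real (radial n s (Im (moeb A \<tau>))))"
    unfolding ee_def by (intro continuous_intros moeb)
  then show ?thesis
    by (rule continuous_on_eq) (use niebur_term_radial[OF assms(1,2)] moeb_uhp[OF assms(3)] in auto)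
qed

lemma niebur_term_plus_int:
  "niebur_term n s (z + of_real (of_int t)) = niebur_term n s z"
proof -
  have "ee (- of_nat n * of_real (Re z + of_int t)) = ee (- of_nat n * of_real (Re z)) * exp (2 * of_real pi * \<i> * of_int (- int n * t))"
    by (simp add: ee_def ring_distribs flip: exp_add)
  also have "exp (2 * of_real pi * \<i> * of_int (- int n * t)) = 1"
    using exp_integer_2pi[of "of_int (- int n * t)"] by (simp add: mult_ac)
  finally show ?thesis by (simp add: niebur_term_def)
qed

lemma moeb_Gamma_inf:
  assumes "h \<in> Gamma_inf"
  obtains t :: int where "\<And>z. moeb h z = z + of_real (of_int t)"
proof -
  obtain e t where h: "h = mat2 e (e * of_int t) 0 e" "e = 1 \<or> e = -1"
    using assms by (auto simp: Gamma_inf_def)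
  then have "moeb h z = z + of_real (of_int t)" for z by (auto simp: moeb_def autom_def)
  then show ?thesis by (rule that)
qed

section \<open>Lattice sums that dominate the Poincare series\<close>

lemma summable_on_max_abs_powr:
  assumes "s > (1::real)"
  shows "(\<lambda>k::int. real_of_int (max 1 \<bar>k\<bar>) powr (- s)) summable_on UNIV"
proof -
  define w where "w k = real_of_int (max 1 \<bar>k\<bar>) powr (- s)" for k :: int
  have "summable (\<lambda>i::nat. norm (real i powr (- s)))"
    using assms by (simp add: summable_real_powr_iff)
  then have nat: "(\<lambda>i::nat. real i powr (- s)) summable_on {1..}"
    by (rule summable_on_subset[OF norm_summable_imp_summable_on]) simp
  have pos: "w summable_on {1..}"
  proof -
    have "bij_betw int {1..} {1..}"
      by (rule bij_betwI[of _ _ _ nat]) auto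
    then have "w summable_on {1..} \<longleftrightarrow> (\<lambda>i. w (int i)) summable_on {1..}"
      by (rule summable_on_reindex_bij_betw[symmetric])
    also have "\<dots> \<longleftrightarrow> (\<lambda>i::nat. real i powr (- s)) summable_on {1..}"
      by (intro summable_on_cong) (auto simp: w_def max_def)
    finally show ?thesis using nat by simp
  qed
  have neg: "w summable_on {..-1}"
  proof -
    have "bij_betw uminus {1..} {..-1::int}"
      by (rule bij_betwI[of _ _ _ uminus]) auto
    then have "w summable_on {..-1} \<longleftrightarrow> (\<lambda>i. w (- i)) summable_on {1..}"
      by (rule summable_on_reindex_bij_betw[symmetric])
    moreover have "w (- i) = w i" for i by (simp add: w_def)
    ultimately show ?thesis using pos by simp
  qed
  have "w summable_on ({1..} \<union> {..-1} \<union> {0})"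
    by (intro summable_on_Un_disjoint pos neg) auto
  also have "{1..} \<union> {..-1} \<union> {0} = (UNIV :: int set)" by auto
  finally show ?thesis by (simp add: w_def)
qed

text \<open>The weight is a product, so the double sum factors. \<open>max 1\<close> gives the index
  0 the weight 1 and leaves the others unchanged; \<open>A\<close> records the finitely many values
  of Q.\<close>

lemma summable_on_lattice:
  assumes "s > (1::real)" "finite A"
  shows "(\<lambda>(Q, m, k). real_of_int (max 1 \<bar>m\<bar>) powr (- s) * real_of_int (max 1 \<bar>k\<bar>) powr (- s))
           summable_on (A :: nat set) \<times> UNIV \<times> (UNIV :: int set)"
proof -
  define w where "w k = real_of_int (max 1 \<bar>k\<bar>) powr (- s)" for k :: int
  have w: "w summable_on UNIV" using summable_on_max_abs_powr[OF assms(1)] by (simp add: w_def[abs_def])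
  have 1: "(\<lambda>(m, k). w m * w k) summable_on UNIV \<times> UNIV"
  proof (rule summable_on_SigmaI)
    show "((\<lambda>k. case (m, k) of (m, k) \<Rightarrow> w m * w k) has_sum (w m * infsum w UNIV)) UNIV" for m
      using has_sum_cmult_right[OF has_sum_infsum[OF w]] by simp
    show "(\<lambda>m. w m * infsum w UNIV) summable_on UNIV"
      by (intro summable_on_cmult_left w)
  qed (simp add: w_def)
  have "(\<lambda>(Q, mk). (case mk of (m, k) \<Rightarrow> w m * w k)) summable_on A \<times> (UNIV \<times> UNIV)"
  proof (rule summable_on_SigmaI)
    show "((\<lambda>mk. case (Q, mk) of (Q, mk) \<Rightarrow> (case mk of (m, k) \<Rightarrow> w m * w k)) has_sum
        infsum (\<lambda>(m, k). w m * w k) (UNIV \<times> UNIV)) (UNIV \<times> UNIV)" for Q :: nat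
      using has_sum_infsum[OF 1] by simp
    show "(\<lambda>Q. infsum (\<lambda>(m, k). w m * w k) (UNIV \<times> UNIV)) summable_on A"
      using assms(2) by (rule summable_on_finite)
  qed (auto simp: w_def)
  then show ?thesis by (simp add: w_def split_def)
qed

text \<open>With v = |m \<tau> + k|, one factor v absorbs |m| Im \<tau> and the other absorbs k: |k|
  \<le> v + |m| X \<le> v (1 + X / \<open>y\<^sub>0\<close>), while 1 \<le> v /
  \<open>y\<^sub>0\<close> covers k = 0. The bound has product form to match the factored double
  sum, which converges for every s > 1.\<close>

lemma lattice_point_bound:
  fixes m k :: int
  assumes "m \<noteq> 0" "y\<^sub>0 > 0" "Im \<tau> \<ge> y\<^sub>0" "\<bar>Re \<tau>\<bar> \<le> X"
  shows "Im \<tau> / (cmod (of_int m * \<tau> + of_int k))\<^sup>2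
    \<le> (1 + (X + 1) / y\<^sub>0) / (real_of_int (max 1 \<bar>m\<bar>) * real_of_int (max 1 \<bar>k\<bar>))"
proof -
  define K where "K = 1 + (X + 1) / y\<^sub>0"
  define v where "v = cmod (of_int m * \<tau> + of_int k)"
  have X: "X \<ge> 0" using assms(4) by linarith
  have y: "Im \<tau> > 0" using assms by linarith
  have m: "max 1 \<bar>m\<bar> = \<bar>m\<bar>" "\<bar>real_of_int m\<bar> \<ge> 1" using assms(1) by linarith+
  have Im: "\<bar>real_of_int m\<bar> * Im \<tau> \<le> v"
    using abs_Im_le_cmod[of "of_int m * \<tau> + of_int k"] y by (simp add: v_def abs_mult)
  have "\<bar>real_of_int m\<bar> * y\<^sub>0 \<le> \<bar>real_of_int m\<bar> * Im \<tau>" using assms by (intro mult_left_mono) auto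
  then have mv: "\<bar>real_of_int m\<bar> \<le> v / y\<^sub>0" using Im assms(2) by (simp add: pos_le_divide_eq)
  have "1 * y\<^sub>0 \<le> \<bar>real_of_int m\<bar> * y\<^sub>0" using m assms(2) by (intro mult_right_mono) auto
  moreover have "\<bar>real_of_int m\<bar> * y\<^sub>0 \<le> v" using mv assms(2) by (simp add: pos_le_divide_eq)
  ultimately have v: "v > 0" using assms(2) by linarith
  have "\<bar>real_of_int k\<bar> \<le> \<bar>of_int m * Re \<tau> + of_int k\<bar> + \<bar>of_int m * Re \<tau>\<bar>" by linarith
  also have "\<bar>of_int m * Re \<tau> + of_int k\<bar> \<le> v"
    using abs_Re_le_cmod[of "of_int m * \<tau> + of_int k"] by (simp add: v_def)
  also have "\<bar>of_int m * Re \<tau>\<bar> \<le> v / y\<^sub>0 * X"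
    unfolding abs_mult using mv assms X by (intro mult_mono) auto
  finally have "\<bar>real_of_int k\<bar> \<le> v * (1 + X / y\<^sub>0)" by (simp add: field_simps)
  also have "\<dots> \<le> v * K" using v assms(2) by (intro mult_left_mono) (auto simp: K_def divide_simps)
  finally have 1: "\<bar>real_of_int k\<bar> \<le> v * K" .
  have "1 \<le> v / y\<^sub>0" using mv m by linarith
  also have "\<dots> = v * (1 / y\<^sub>0)" by simp
  also have "\<dots> \<le> v * K" using v assms(2) X by (intro mult_left_mono) (auto simp: K_def divide_simps)
  finally have "real_of_int (max 1 \<bar>k\<bar>) \<le> v * K" using 1 by simp
  then have "(\<bar>real_of_int m\<bar> * Im \<tau>) * real_of_int (max 1 \<bar>k\<bar>) \<le> v * (v * K)"
    using Im v y by (intro mult_mono) auto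
  then have "Im \<tau> * (real_of_int (max 1 \<bar>m\<bar>) * real_of_int (max 1 \<bar>k\<bar>)) \<le> K * v\<^sup>2"
    by (simp add: m(1) power2_eq_square mult_ac)
  moreover have "real_of_int (max 1 \<bar>m\<bar>) * real_of_int (max 1 \<bar>k\<bar>) > 0" by simp
  ultimately show ?thesis using v unfolding v_def[symmetric] K_def[symmetric]
    by (simp add: divide_simps)
qed

section \<open>Cosets of the stabilizer of i\<infinity> and invariance of the series\<close>

context atkin_lehner_group
begin

definition cosets :: "(real^2^2) set set" where
  "cosets = rcosets\<^bsub>SL2R\<lparr>carrier := \<Gamma>\<rparr>\<^esub> Gamma_inf"

definition coset_rep :: "(real^2^2) set \<Rightarrow> real^2^2" where
  "coset_rep C = (SOME \<gamma>. \<gamma> \<in> C)"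

lemma Gamma_inf_iff: "h \<in> Gamma_inf \<longleftrightarrow> h \<in> \<Gamma> \<and> h$2$1 = 0"
  using Gamma_stabilizer Gamma_inf_subset by (auto simp: Gamma_inf_def)

lemma coset_iff: "C \<in> cosets \<longleftrightarrow> (\<exists>\<gamma>\<in>\<Gamma>. C = (\<lambda>h. h ** \<gamma>) ` Gamma_inf)"
  by (auto simp: cosets_def RCOSETS_def r_coset_def SL2R_def)

lemma Gamma_inf_mult:
  assumes "h \<in> Gamma_inf" "h' \<in> Gamma_inf"
  shows "h ** h' \<in> Gamma_inf"
  using assms Gamma_mult by (auto simp: Gamma_inf_iff mult_nth)

lemma Gamma_inf_inv: "h \<in> Gamma_inf \<Longrightarrow> inv2 h \<in> Gamma_inf"
  using Gamma_inv by (auto simp: Gamma_inf_iff)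

lemma coset_subset:
  assumes "C \<in> cosets"
  shows "C \<subseteq> \<Gamma>"
  using assms Gamma_mult Gamma_inf_subset unfolding coset_iff by auto

lemma coset_rep_in:
  assumes "C \<in> cosets"
  shows "coset_rep C \<in> C"
proof -
  obtain \<gamma> where "C = (\<lambda>h. h ** \<gamma>) ` Gamma_inf"
    using assms[unfolded coset_iff] by (rule bexE)
  moreover have "mat 1 \<in> Gamma_inf" using mat1_in_Gamma by (simp add: Gamma_inf_iff)
  ultimately have "C \<noteq> {}" by blast
  then show ?thesis unfolding coset_rep_def by (simp add: some_in_eq)
qed

lemma coset_rep_Gamma: "C \<in> cosets \<Longrightarrow> coset_rep C \<in> \<Gamma>"
  using coset_rep_in coset_subset by blast

lemma coset_eq:
  assumes "C \<in> cosets" "\<gamma> \<in> C"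
  shows "C = (\<lambda>h. h ** \<gamma>) ` Gamma_inf"
proof -
  obtain \<gamma>' where C: "C = (\<lambda>h. h ** \<gamma>') ` Gamma_inf"
    using assms(1)[unfolded coset_iff] by (rule bexE)
  then obtain h where h: "h \<in> Gamma_inf" "\<gamma> = h ** \<gamma>'" using assms by blast
  have dh: "det h = 1" using h Gamma_inf_subset det_Gamma by blast
  have "k ** \<gamma>' \<in> (\<lambda>h. h ** \<gamma>) ` Gamma_inf" if "k \<in> Gamma_inf" for k
  proof -
    have "k ** \<gamma>' = (k ** inv2 h) ** \<gamma>"
      by (simp add: h inv2_cancel_left[OF dh] flip: matrix_mul_assoc)
    then show ?thesis using that h Gamma_inf_mult Gamma_inf_inv by blast
  qed
  moreover have "k ** \<gamma> \<in> C" if "k \<in> Gamma_inf" for k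
  proof -
    have "k ** \<gamma> = (k ** h) ** \<gamma>'" by (simp add: h matrix_mul_assoc)
    then show ?thesis using that h Gamma_inf_mult C by blast
  qed
  ultimately show ?thesis using C by blast
qed

lemma coset_eqI:
  assumes "C \<in> cosets" "C' \<in> cosets" "\<gamma> \<in> C" "\<gamma>' \<in> C'" "(\<gamma> ** inv2 \<gamma>')$2$1 = 0"
  shows "C = C'"
proof -
  have G: "\<gamma> \<in> \<Gamma>" "\<gamma>' \<in> \<Gamma>" using assms coset_subset by blast+
  then have "\<gamma> ** inv2 \<gamma>' \<in> Gamma_inf"
    using assms(5) Gamma_mult Gamma_inv by (simp add: Gamma_inf_iff)
  then have "(\<gamma> ** inv2 \<gamma>') ** \<gamma>' \<in> C'"
    using coset_eq[OF assms(2,4)] by blast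
  then have "\<gamma> \<in> C'"
    using inv2_left[OF det_Gamma[OF G(2)]] by (simp flip: matrix_mul_assoc)
  then show ?thesis using coset_eq[OF assms(1,3)] coset_eq[OF assms(2)] by simp
qed

lemma niebur_term_coset:
  assumes "C \<in> cosets" "\<gamma> \<in> C" "\<gamma>' \<in> C" "\<tau> \<in> uhp"
  shows "niebur_term n s (moeb \<gamma> \<tau>) = niebur_term n s (moeb \<gamma>' \<tau>)"
proof -
  obtain h where h: "h \<in> Gamma_inf" "\<gamma> = h ** \<gamma>'" using assms coset_eq by blast
  obtain t where t: "\<And>z. moeb h z = z + of_real (of_int t)" using moeb_Gamma_inf[OF h(1)] by blast
  have "det \<gamma>' = 1" using assms coset_subset det_Gamma by blast
  then show ?thesis by (simp only: h(2) moeb_mult[OF _ assms(4)] t niebur_term_plus_int)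
qed

lemma niebur_series_alt:
  "niebur_series \<Gamma> n \<tau> s = 2 * of_real pi * (\<Sum>\<^sub>\<infinity>C\<in>cosets. niebur_term n s (moeb (coset_rep C) \<tau>))"
  by (simp add: niebur_series_def cosets_def coset_rep_def)

text \<open>Right translation by \<delta> permutes the cosets, and a term does not depend on the
  representative. Reindexing an \<open>infsum\<close> along a bijection is valid with or without
  convergence, so s is arbitrary here.\<close>

lemma niebur_series_invariant:
  assumes \<delta>: "\<delta> \<in> \<Gamma>" and \<tau>: "\<tau> \<in> uhp"
  shows "niebur_series \<Gamma> n (moeb \<delta> \<tau>) s = niebur_series \<Gamma> n \<tau> s"
proof -
  define g where "g C = (\<lambda>\<gamma>. \<gamma> ** \<delta>) ` C" for C :: "(real^2^2) set"
  have d: "det \<delta> = 1" using \<delta> by (rule det_Gamma)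
  have img: "(\<lambda>\<gamma>. \<gamma> ** \<epsilon>) ` C \<in> cosets" if \<epsilon>: "\<epsilon> \<in> \<Gamma>" and C: "C \<in> cosets" for C \<epsilon>
  proof -
    obtain \<gamma> where "\<gamma> \<in> \<Gamma>" "C = (\<lambda>h. h ** \<gamma>) ` Gamma_inf"
      using C[unfolded coset_iff] by (rule bexE)
    then have "(\<lambda>\<gamma>. \<gamma> ** \<epsilon>) ` C = (\<lambda>h. h ** (\<gamma> ** \<epsilon>)) ` Gamma_inf" "\<gamma> ** \<epsilon> \<in> \<Gamma>"
      using \<epsilon> Gamma_mult by (auto simp: image_image matrix_mul_assoc)
    then show ?thesis unfolding coset_iff by (intro bexI)
  qed
  have "bij_betw g cosets cosets"
  proof (rule bij_betwI[of _ _ _ "\<lambda>C. (\<lambda>\<gamma>. \<gamma> ** inv2 \<delta>) ` C"])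
    show "(\<lambda>\<gamma>. \<gamma> ** inv2 \<delta>) ` g C = C" for C
      by (simp add: g_def image_image inv2_right[OF d] flip: matrix_mul_assoc)
    show "g ((\<lambda>\<gamma>. \<gamma> ** inv2 \<delta>) ` C) = C" for C
      by (simp add: g_def image_image inv2_left[OF d] flip: matrix_mul_assoc)
  qed (use img \<delta> Gamma_inv in \<open>auto simp: g_def\<close>)
  then have "(\<Sum>\<^sub>\<infinity>C\<in>cosets. niebur_term n s (moeb (coset_rep C) \<tau>))
      = (\<Sum>\<^sub>\<infinity>C\<in>cosets. niebur_term n s (moeb (coset_rep (g C)) \<tau>))"
    by (rule infsum_reindex_bij_betw[symmetric])
  also have "\<dots> = (\<Sum>\<^sub>\<infinity>C\<in>cosets. niebur_term n s (moeb (coset_rep C) (moeb \<delta> \<tau>)))"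
  proof (rule infsum_cong)
    fix C assume C: "C \<in> cosets"
    have "g C \<in> cosets" using img[OF \<delta> C] by (simp add: g_def)
    moreover have "coset_rep C ** \<delta> \<in> g C" using coset_rep_in[OF C] by (simp add: g_def)
    ultimately have "niebur_term n s (moeb (coset_rep (g C)) \<tau>) = niebur_term n s (moeb (coset_rep C ** \<delta>) \<tau>)"
      using niebur_term_coset coset_rep_in \<tau> by blast
    then show "niebur_term n s (moeb (coset_rep (g C)) \<tau>) = niebur_term n s (moeb (coset_rep C) (moeb \<delta> \<tau>))"
      by (simp only: moeb_mult[OF d \<tau>])
  qed
  finally show ?thesis by (simp add: niebur_series_alt)
qed

text \<open>The majorant for the Weierstrass test. A coset is recovered from the bottom row (m, k) /
  sqrt Q of \<open>coset_rep C ** \<sigma>\<close>, where m is nonzero because the cusp is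
  inequivalent to i\<infinity>. The image of \<tau> has height Q Im \<tau> / |m \<tau> + k|^2, at
  most a constant over |m| max(1, |k|), and a term is bounded by a multiple of the s-th power of
  that height.\<close>

lemma niebur_term_dominated:
  assumes n: "n \<ge> 1" and s: "s > (1::real)" and \<sigma>: "\<sigma> \<in> SL2Z"
    and cusp: "ext_moeb \<sigma> None \<notin> orbit_of \<Gamma> None" and y\<^sub>0: "y\<^sub>0 > 0"
  obtains M where "M summable_on cosets"
    "\<And>C \<tau>. C \<in> cosets \<Longrightarrow> Im \<tau> \<ge> y\<^sub>0 \<Longrightarrow> \<bar>Re \<tau>\<bar> \<le> X \<Longrightarrow>
        cmod (niebur_term n (of_real s) (moeb (coset_rep C ** \<sigma>) \<tau>)) \<le> M C"
proof -
  define A where "A C = coset_rep C ** \<sigma>" for C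
  have det\<sigma>: "det \<sigma> = 1" using \<sigma> by (rule det_SL2Z)
  have detA: "det (A C) = 1" if "C \<in> cosets" for C
    using that coset_rep_Gamma det_Gamma det\<sigma> by (simp add: A_def det_mul)
  define P where "P C q \<longleftrightarrow> (case q of (Q, m, k) \<Rightarrow> 0 < Q \<and> Q \<le> N \<and> m \<noteq> 0 \<and>
     (A C)$2$1 = of_int m / sqrt (real Q) \<and> (A C)$2$2 = of_int k / sqrt (real Q))"
    for C :: "(real^2^2) set" and q :: "nat \<times> int \<times> int"
  have "\<exists>q. P C q" if C: "C \<in> cosets" for C
  proof -
    obtain Q m k where Q: "0 < Q" "Q \<le> N"
      "coset_rep C$2$1 = of_int m / sqrt (real Q)" "coset_rep C$2$2 = of_int k / sqrt (real Q)"
      using Gamma_bottom_row[OF coset_rep_Gamma[OF C]] by blast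
    obtain a b c d where \<sigma>': "\<sigma>$1$1 = of_int a" "\<sigma>$1$2 = of_int b" "\<sigma>$2$1 = of_int c" "\<sigma>$2$2 = of_int d"
      using SL2Z_nth[OF \<sigma>] by metis
    have row: "(A C)$2$1 = of_int (m * a + k * c) / sqrt (real Q)" "(A C)$2$2 = of_int (m * b + k * d) / sqrt (real Q)"
      by (simp_all add: A_def mult_nth Q \<sigma>' add_divide_distrib)
    have "(A C)$2$1 \<noteq> 0"
      unfolding A_def by (rule cusp_inequivalent[OF cusp det\<sigma> coset_rep_Gamma[OF C]])
    moreover have "(A C)$2$1 = 0" if "m * a + k * c = 0" unfolding row(1) that by simp
    ultimately have "m * a + k * c \<noteq> 0" by blast
    then have "P C (Q, m * a + k * c, m * b + k * d)" using Q row by (simp add: P_def)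
    then show ?thesis by blast
  qed
  then obtain q where q: "\<And>C. C \<in> cosets \<Longrightarrow> P C (q C)" by metis
  \<comment> \<open>\<sigma> cancels in the quotient of the two matrices, and equal bottom rows make
    the lower left entry of the quotient 0; so it stabilizes i\<infinity>.\<close>
  have inj: "inj_on q cosets"
  proof (rule inj_onI)
    fix C C' assume C: "C \<in> cosets" "C' \<in> cosets" "q C = q C'"
    obtain Q m k where "q C = (Q, m, k)" by (cases "q C")
    then have eq: "(A C)$2$1 = (A C')$2$1" "(A C)$2$2 = (A C')$2$2"
      using q[OF C(1)] q[OF C(2)] C(3) by (simp_all add: P_def)
    have "A C ** inv2 (A C') = coset_rep C ** inv2 (coset_rep C')"
      by (simp add: A_def inv2_mult inv2_cancel_left'[OF det\<sigma>] flip: matrix_mul_assoc)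
    moreover have "(A C ** inv2 (A C'))$2$1 = 0" using eq by (simp add: mult_nth)
    ultimately show "C = C'" using coset_eqI C coset_rep_in by metis
  qed
  define w where "w = (\<lambda>(Q::nat, m, k). real_of_int (max 1 \<bar>m\<bar>) powr (- s) * real_of_int (max 1 \<bar>k\<bar>) powr (- s))"
  have "w summable_on {1..N} \<times> UNIV \<times> UNIV"
    unfolding w_def by (rule summable_on_lattice[OF s]) simp
  moreover have "q ` cosets \<subseteq> {1..N} \<times> UNIV \<times> UNIV"
    using q by (fastforce simp: P_def split: prod.splits)
  ultimately have "w summable_on q ` cosets" by (rule summable_on_subset)
  then have wq: "(\<lambda>C. w (q C)) summable_on cosets"
    using summable_on_reindex[OF inj, of w] by (simp add: o_def)
  \<comment> \<open>The maximum with 0 keeps K positive for a negative X, where the strip is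
    empty.\<close>
  define X' where "X' = max X 0"
  define K where "K = 1 + (X' + 1) / y\<^sub>0"
  have K: "K > 0" using y\<^sub>0 by (auto simp: K_def X'_def intro!: add_pos_nonneg)
  obtain Kr where Kr: "Kr > 0" "\<And>y. 0 < y \<Longrightarrow> y \<le> N * K \<Longrightarrow> \<bar>radial n s y\<bar> \<le> Kr * y powr s"
    using radial_bound[OF s] by blast
  show ?thesis
  proof (rule that)
    show "(\<lambda>C. Kr * (N * K) powr s * w (q C)) summable_on cosets"
      by (intro summable_on_cmult_right wq)
    fix C \<tau> assume C: "C \<in> cosets" and \<tau>: "Im \<tau> \<ge> y\<^sub>0" "\<bar>Re \<tau>\<bar> \<le> X"
    have "\<tau> \<in> uhp" using \<tau> y\<^sub>0 by simp
    obtain Q m k where qC: "q C = (Q, m, k)" by (cases "q C")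
    then have row: "0 < Q" "Q \<le> N" "m \<noteq> 0" "(A C)$2$1 = of_int m / sqrt (real Q)" "(A C)$2$2 = of_int k / sqrt (real Q)"
      using q[OF C] by (simp_all add: P_def)
    define D where "D = real_of_int (max 1 \<bar>m\<bar>) * real_of_int (max 1 \<bar>k\<bar>)"
    have "1 \<le> real_of_int (max 1 \<bar>m\<bar>)" "1 \<le> real_of_int (max 1 \<bar>k\<bar>)" by auto
    then have D: "D \<ge> 1" unfolding D_def using mult_mono[of 1 _ 1] by fastforce
    define y where "y = Im (moeb (A C) \<tau>)"
    have "y > 0" using moeb_uhp[OF detA[OF C] \<open>\<tau> \<in> uhp\<close>] by (simp add: y_def)
    have "autom (A C) \<tau> = (of_int m * \<tau> + of_int k) / of_real (sqrt (real Q))"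
      by (simp add: autom_def row add_divide_distrib)
    then have "(cmod (autom (A C) \<tau>))\<^sup>2 = (cmod (of_int m * \<tau> + of_int k))\<^sup>2 / Q"
      by (simp add: norm_divide power_divide)
    then have "y = Q * (Im \<tau> / (cmod (of_int m * \<tau> + of_int k))\<^sup>2)"
      by (simp add: y_def Im_moeb[OF detA[OF C]])
    also have "\<dots> \<le> Q * (K / D)"
      unfolding K_def D_def using \<tau> by (intro mult_left_mono lattice_point_bound row y\<^sub>0) (auto simp: X'_def)
    also have "\<dots> \<le> N * (K / D)" using row(2) K D by (intro mult_right_mono) auto
    finally have y: "y \<le> N * K / D" by simp
    also have "\<dots> \<le> N * K" using D K divide_left_mono[of 1 D "N * K"] by simp
    finally have yN: "y \<le> N * K" .
    have "cmod (niebur_term n (of_real s) (moeb (A C) \<tau>)) = \<bar>radial n s y\<bar>"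
      unfolding y_def by (rule norm_niebur_term[OF n s moeb_uhp[OF detA[OF C] \<open>\<tau> \<in> uhp\<close>]])
    also have "\<dots> \<le> Kr * y powr s" by (rule Kr(2)[OF \<open>y > 0\<close> yN])
    also have "\<dots> \<le> Kr * (N * K / D) powr s"
      using Kr(1) y \<open>y > 0\<close> s by (intro mult_left_mono powr_mono2) auto
    also have "(N * K / D) powr s = (N * K) powr s * w (q C)"
      using K D by (simp add: powr_divide w_def qC D_def powr_mult powr_minus_divide)
    finally show "cmod (niebur_term n (of_real s) (moeb (coset_rep C ** \<sigma>) \<tau>)) \<le> Kr * (N * K) powr s * w (q C)"
      by (simp add: A_def mult_ac)
  qed
qed

end

section \<open>Passage from real s > 1 to s = 1\<close>

lemma niebur_continuation_at_1:
  assumes "niebur_continuation \<Gamma> n G" "\<tau> \<in> uhp"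
  shows "(\<lambda>k. G \<tau> (of_real (1 + inverse (real (Suc k))))) \<longlonglongrightarrow> G \<tau> 1"
proof -
  have "G \<tau> holomorphic_on {s. Re s > 1 / 2}"
    using assms by (simp add: niebur_continuation_def)
  then have "G \<tau> field_differentiable (at 1)"
    by (rule holomorphic_on_imp_differentiable_at) (use open_halfspace_Re_gt[of "1 / 2"] in simp_all)
  then have "isCont (G \<tau>) 1" by (rule field_differentiable_imp_continuous_at)
  moreover have "(\<lambda>k. complex_of_real (1 + inverse (real (Suc k)))) \<longlonglongrightarrow> of_real 1"
    by (intro tendsto_of_real LIMSEQ_inverse_real_of_nat_add)
  ultimately show ?thesis using isCont_tendsto_compose[of 1 "G \<tau>"] by simp
qed

lemma moeb_plus_nat:
  assumes "\<sigma> \<in> SL2Z" "\<tau> \<in> uhp"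
  obtains \<delta> where "\<delta> \<in> Gamma0 N" "moeb \<sigma> (\<tau> + of_real (real N)) = moeb \<delta> (moeb \<sigma> \<tau>)"
proof -
  have d: "det \<sigma> = 1" using assms det_SL2Z by blast
  have "moeb \<sigma> (\<tau> + of_real (real N)) = moeb (\<sigma> ** shift (of_nat N)) \<tau>"
    using moeb_mult[of "shift (of_nat N)" \<tau> \<sigma>] assms by simp
  also have "\<sigma> ** shift (of_nat N) = (\<sigma> ** shift (of_nat N) ** inv2 \<sigma>) ** \<sigma>"
    by (simp add: inv2_left[OF d] flip: matrix_mul_assoc)
  also have "moeb \<dots> \<tau> = moeb (\<sigma> ** shift (of_nat N) ** inv2 \<sigma>) (moeb \<sigma> \<tau>)"
    by (rule moeb_mult[OF d assms(2)])
  finally show ?thesis by (rule that[OF conj_shift_in_Gamma0[OF assms(1)]])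
qed

context atkin_lehner_group
begin

text \<open>For s > 1 this is the invariance of the series, and the value at 1 is a limit of values
  at real s > 1.\<close>

lemma niebur_continuation_invariant:
  assumes "niebur_continuation \<Gamma> n G" "\<delta> \<in> \<Gamma>" "\<tau> \<in> uhp"
  shows "G (moeb \<delta> \<tau>) 1 = G \<tau> 1"
proof -
  have \<delta>\<tau>: "moeb \<delta> \<tau> \<in> uhp" using assms det_Gamma moeb_uhp by blast
  have "G (moeb \<delta> \<tau>) (of_real (1 + inverse (real (Suc k)))) = G \<tau> (of_real (1 + inverse (real (Suc k))))" for k
  proof -
    have "Re (of_real (1 + inverse (real (Suc k)))) > 1" by simp
    then show ?thesis
      using assms \<delta>\<tau> niebur_series_invariant[OF assms(2,3)]
      unfolding niebur_continuation_def by metis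
  qed
  then have "(\<lambda>k. G \<tau> (of_real (1 + inverse (real (Suc k))))) \<longlonglongrightarrow> G (moeb \<delta> \<tau>) 1"
    using niebur_continuation_at_1[OF assms(1) \<delta>\<tau>] by simp
  then show ?thesis using niebur_continuation_at_1[OF assms(1,3)] LIMSEQ_unique by blast
qed

text \<open>For real $s > 1$ the maximum principle bounds the series in the cusp neighbourhood by its
  values on the horocycle, and on the horocycle the continuation is bounded uniformly in $s$;
  so the bound survives the limit $s \to 1$ although the series need not converge there.\<close>

lemma niebur_bounded_at_cusp:
  assumes n: "n \<ge> 1" and G: "niebur_continuation \<Gamma> n G" and \<sigma>: "\<sigma> \<in> SL2Z"
    and cusp: "ext_moeb \<sigma> None \<notin> orbit_of \<Gamma> None" and y\<^sub>0: "y\<^sub>0 > 0"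
  obtains B where "\<And>\<tau>. Im \<tau> \<ge> y\<^sub>0 \<Longrightarrow> cmod (G (moeb \<sigma> \<tau>) 1) \<le> B"
proof -
  have d\<sigma>: "det \<sigma> = 1" using \<sigma> by (rule det_SL2Z)
  have up: "\<tau> \<in> uhp" "moeb \<sigma> \<tau> \<in> uhp" if "Im \<tau> \<ge> y\<^sub>0" for \<tau>
    using that y\<^sub>0 moeb_uhp[OF d\<sigma>] by auto
  have joint: "continuous_on (uhp \<times> {s. Re s > 1 / 2}) (\<lambda>(\<tau>, s). G \<tau> s)"
    using G by (simp add: niebur_continuation_def)
  have moeb: "continuous_on uhp (moeb \<sigma>)"
    by (intro continuous_at_imp_continuous_on ballI) (use moeb_has_derivative[OF d\<sigma>] DERIV_isCont in blast)
  \<comment> \<open>One period of the horocycle and all s in the closed interval [1, 2] form a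
    compact set, on which joint continuity in (\<tau>, s) gives a single bound.\<close>
  define L where "L = (\<lambda>(x, s). G (moeb \<sigma> (of_real x + \<i> * of_real y\<^sub>0)) (of_real s))"
  have "continuous_on ({0..real N} \<times> {1..2}) L"
  proof -
    have "continuous_on ({0..real N} \<times> {1..2::real}) (\<lambda>p. moeb \<sigma> (of_real (fst p) + \<i> * of_real y\<^sub>0))"
      by (rule continuous_on_compose2[OF moeb]) (use y\<^sub>0 in \<open>auto intro!: continuous_intros\<close>)
    then have "continuous_on ({0..real N} \<times> {1..2::real})
        (\<lambda>p. (\<lambda>(\<tau>, s). G \<tau> s) (moeb \<sigma> (of_real (fst p) + \<i> * of_real y\<^sub>0), of_real (snd p)))"
      using up(2) by (intro continuous_on_compose2[OF joint] continuous_intros) auto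
    then show ?thesis by (simp add: L_def case_prod_unfold)
  qed
  then have "bounded (L ` ({0..real N} \<times> {1..2}))"
    by (intro compact_imp_bounded compact_continuous_image compact_Times compact_Icc)
  then obtain B where B: "\<And>p. p \<in> {0..real N} \<times> {1..2} \<Longrightarrow> cmod (L p) \<le> B"
    unfolding bounded_iff by blast
  have bound: "cmod (G (moeb \<sigma> \<tau>) (of_real s)) \<le> B" if s: "1 < s" "s \<le> 2" and \<tau>: "Im \<tau> \<ge> y\<^sub>0" for s \<tau>
  proof -
    define u where "u \<tau> = G (moeb \<sigma> \<tau>) (of_real s)" for \<tau>
    define t where "t C \<tau> = 2 * of_real pi * niebur_term n (of_real s) (moeb (coset_rep C ** \<sigma>) \<tau>)" for C \<tau>
    have detA: "det (coset_rep C ** \<sigma>) = 1" if "C \<in> cosets" for C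
      using that coset_rep_Gamma det_Gamma d\<sigma> by (simp add: det_mul)
    have u_series: "u \<tau> = niebur_series \<Gamma> n (moeb \<sigma> \<tau>) (of_real s)" if "Im \<tau> \<ge> y\<^sub>0" for \<tau>
      using G up[OF that] s by (simp add: niebur_continuation_def u_def)
    have u_sum: "u \<tau> = (\<Sum>\<^sub>\<infinity>C\<in>cosets. t C \<tau>)" if "Im \<tau> \<ge> y\<^sub>0" for \<tau>
      unfolding u_series[OF that] niebur_series_alt t_def infsum_cmult_right'
      using moeb_mult[OF d\<sigma> up(1)[OF that]] by simp
    have dom: "\<exists>M. M summable_on cosets \<and>
        (\<forall>C\<in>cosets. \<forall>\<tau>. Im \<tau> \<ge> y\<^sub>0 \<longrightarrow> \<bar>Re \<tau>\<bar> \<le> X \<longrightarrow> cmod (t C \<tau>) \<le> M C)" for X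
    proof -
      obtain M where M: "M summable_on cosets"
        "\<And>C \<tau>. C \<in> cosets \<Longrightarrow> Im \<tau> \<ge> y\<^sub>0 \<Longrightarrow> \<bar>Re \<tau>\<bar> \<le> X \<Longrightarrow>
          cmod (niebur_term n (of_real s) (moeb (coset_rep C ** \<sigma>) \<tau>)) \<le> M C"
        by (rule niebur_term_dominated[OF n s(1) \<sigma> cusp y\<^sub>0, of X]) blast
      have "(\<lambda>C. 2 * pi * M C) summable_on cosets" by (intro summable_on_cmult_right M)
      moreover have "cmod (t C \<tau>) \<le> 2 * pi * M C" if "C \<in> cosets" "Im \<tau> \<ge> y\<^sub>0" "\<bar>Re \<tau>\<bar> \<le> X" for C \<tau>
        using M(2)[OF that] by (simp add: t_def norm_mult)
      ultimately show ?thesis by blast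
    qed
    have per: "u (\<tau> + of_real (real N)) = u \<tau>" if \<tau>: "Im \<tau> \<ge> y\<^sub>0" for \<tau>
    proof -
      obtain \<delta> where \<delta>: "\<delta> \<in> Gamma0 N" "moeb \<sigma> (\<tau> + of_real (real N)) = moeb \<delta> (moeb \<sigma> \<tau>)"
        using moeb_plus_nat[OF \<sigma> up(1)[OF \<tau>]] by blast
      have "Im (\<tau> + of_real (real N)) \<ge> y\<^sub>0" using \<tau> by simp
      from u_series[OF this] u_series[OF \<tau>] show ?thesis
        using \<delta> niebur_series_invariant[OF _ up(2)[OF \<tau>]] Gamma0_subset by auto
    qed
    obtain M where M: "M summable_on cosets"
      "\<And>C \<tau>. C \<in> cosets \<Longrightarrow> Im \<tau> \<ge> y\<^sub>0 \<Longrightarrow> \<bar>Re \<tau>\<bar> \<le> N \<Longrightarrow> cmod (t C \<tau>) \<le> M C"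
      using dom[of N] by blast
    have "cmod (u \<tau>) \<le> B"
    proof (rule laplace_eigen_series_max_principle[where t = t and I = cosets and P = "real N" and u = u])
      show "s > 1" "y\<^sub>0 > 0" "real N > 0" using s y\<^sub>0 N_pos by simp_all
      show "laplace_eigen s (\<lambda>\<tau>. Re (\<zeta> * t C \<tau>))" if "C \<in> cosets" for C \<zeta>
        using laplace_eigen_niebur_term[OF n s(1) detA[OF that], of "\<zeta> * (2 * of_real pi)"]
        by (simp add: t_def mult.assoc)
      show "continuous_on uhp (t C)" if "C \<in> cosets" for C
        unfolding t_def by (intro continuous_intros continuous_on_niebur_term n s detA that)
      show "\<exists>r>0. uniform_limit (cball p r) (\<lambda>F \<tau>. \<Sum>C\<in>F. t C \<tau>) u (finite_subsets_at_top cosets)"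
        if p: "Im p > y\<^sub>0" for p
      proof -
        define r where "r = Im p - y\<^sub>0"
        obtain M where M: "M summable_on cosets"
          "\<And>C \<tau>. C \<in> cosets \<Longrightarrow> Im \<tau> \<ge> y\<^sub>0 \<Longrightarrow> \<bar>Re \<tau>\<bar> \<le> \<bar>Re p\<bar> + r \<Longrightarrow> cmod (t C \<tau>) \<le> M C"
          using dom[of "\<bar>Re p\<bar> + r"] by blast
        have near: "Im z \<ge> y\<^sub>0" "\<bar>Re z\<bar> \<le> \<bar>Re p\<bar> + r" if "z \<in> cball p r" for z
        proof -
          have "cmod (p - z) \<le> r" using that by (simp add: dist_norm)
          then have "\<bar>Im p - Im z\<bar> \<le> r" "\<bar>Re p - Re z\<bar> \<le> r"
            using abs_Im_le_cmod[of "p - z"] abs_Re_le_cmod[of "p - z"] by simp_all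
          then show "Im z \<ge> y\<^sub>0" "\<bar>Re z\<bar> \<le> \<bar>Re p\<bar> + r" unfolding r_def by linarith+
        qed
        have "uniform_limit (cball p r) (\<lambda>F \<tau>. \<Sum>C\<in>F. t C \<tau>) (\<lambda>\<tau>. \<Sum>\<^sub>\<infinity>C\<in>cosets. t C \<tau>) (finite_subsets_at_top cosets)"
          using M near by (intro Weierstrass_m_test_general) blast+
        then have "uniform_limit (cball p r) (\<lambda>F \<tau>. \<Sum>C\<in>F. t C \<tau>) u (finite_subsets_at_top cosets)"
          by (rule uniform_limit_cong'[THEN iffD1, rotated -1]) (use near(1) u_sum in auto)
        moreover have "r > 0" using p by (simp add: r_def)
        ultimately show ?thesis by blast
      qed
      have "continuous_on {\<tau>. Im \<tau> \<ge> y\<^sub>0} (\<lambda>\<tau>. (\<lambda>(\<tau>, s). G \<tau> s) (moeb \<sigma> \<tau>, of_real s))"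
        using up s by (intro continuous_on_compose2[OF joint] continuous_intros continuous_on_subset[OF moeb]) auto
      then show "continuous_on {\<tau>. Im \<tau> \<ge> y\<^sub>0} u" by (simp add: u_def[abs_def])
      \<comment> \<open>This bound depends on s, but it enters the maximum principle only as a
        qualitative one; the constant of the conclusion comes from the horocycle.\<close>
      show "cmod (u \<tau>) \<le> infsum M cosets" if \<tau>: "Im \<tau> \<ge> y\<^sub>0" for \<tau>
      proof -
        obtain \<tau>' where \<tau>': "Im \<tau>' = Im \<tau>" "0 \<le> Re \<tau>'" "Re \<tau>' \<le> N" "u \<tau>' = u \<tau>"
          by (rule translate_to_strip[of "real N" y\<^sub>0 u \<tau>]) (use N_pos per \<tau> in auto)
        then have le: "cmod (t C \<tau>') \<le> M C" if "C \<in> cosets" for C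
          using M(2)[OF that, of \<tau>'] \<tau> by simp
        have abs: "(\<lambda>C. norm (t C \<tau>')) summable_on cosets"
          using M(1) by (rule summable_on_comparison_test) (use le in auto)
        have "cmod (u \<tau>') \<le> infsum (\<lambda>C. norm (t C \<tau>')) cosets"
          using u_sum[of \<tau>'] \<tau>' \<tau> norm_infsum_bound[OF abs] by simp
        also have "\<dots> \<le> infsum M cosets" by (rule infsum_mono[OF abs M(1) le])
        finally show ?thesis using \<tau>' by simp
      qed
      show "u (\<tau> + of_real (real N)) = u \<tau>" if "Im \<tau> \<ge> y\<^sub>0" for \<tau> using per[OF that] .
      show "cmod (u \<tau>) \<le> B" if \<tau>: "Im \<tau> = y\<^sub>0" for \<tau>
      proof -
        obtain \<tau>' where \<tau>': "Im \<tau>' = Im \<tau>" "0 \<le> Re \<tau>'" "Re \<tau>' \<le> N" "u \<tau>' = u \<tau>"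
          by (rule translate_to_strip[of "real N" y\<^sub>0 u \<tau>]) (use N_pos per \<tau> in auto)
        have "\<tau>' = of_real (Re \<tau>') + \<i> * of_real y\<^sub>0" using \<tau>' \<tau> by (simp add: complex_eq_iff)
        then have "u \<tau>' = L (Re \<tau>', s)" unfolding L_def u_def by simp
        then show ?thesis using B[of "(Re \<tau>', s)"] \<tau>' s by simp
      qed
      show "Im \<tau> \<ge> y\<^sub>0" by (rule \<tau>)
    qed
    then show ?thesis by (simp add: u_def)
  qed
  show ?thesis
  proof (rule that)
    fix \<tau> assume \<tau>: "Im \<tau> \<ge> y\<^sub>0"
    have "(\<lambda>k. cmod (G (moeb \<sigma> \<tau>) (of_real (1 + inverse (real (Suc k)))))) \<longlonglongrightarrow> cmod (G (moeb \<sigma> \<tau>) 1)"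
      by (intro tendsto_norm niebur_continuation_at_1[OF G up(2)[OF \<tau>]])
    \<comment> \<open>The sequence decreases from 2 to 1 and so stays where \<open>bound\<close>
      holds with one B for all s.\<close>
    moreover have "cmod (G (moeb \<sigma> \<tau>) (of_real (1 + inverse (real (Suc k))))) \<le> B" for k
      by (rule bound) (use \<tau> in \<open>auto simp: inverse_le_1_iff\<close>)
    ultimately show "cmod (G (moeb \<sigma> \<tau>) 1) \<le> B"
      by (intro LIMSEQ_le_const2) auto
  qed
qed

end

subsection \<open>Expansions at the cusps\<close>

lemma ee_add: "ee (x + y) = ee x * ee y"
  by (simp add: ee_def ring_distribs exp_add)

lemma ee_nonzero [simp]: "ee x \<noteq> 0"
  by (simp add: ee_def)

lemma ee_of_nat_mult: "ee (of_nat l * x) = ee x ^ l"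
  by (simp add: ee_def mult_ac flip: exp_of_nat_mult)

lemma ee_minus_of_nat_mult: "ee (- of_nat l * x) = inverse (ee x ^ l)"
  using ee_of_nat_mult[of l x] by (simp add: ee_def exp_minus)

lemma norm_ee: "cmod (ee \<tau>) = exp (- 2 * pi * Im \<tau>)"
  by (simp add: ee_def)

lemma ee_in_ball: "\<tau> \<in> uhp \<Longrightarrow> ee \<tau> \<in> ball 0 1"
  by (simp add: norm_ee)

lemma ee_surj:
  assumes "z \<in> ball 0 1" "z \<noteq> 0"
  obtains \<tau> where "\<tau> \<in> uhp" "ee \<tau> = z"
proof
  define \<tau> where "\<tau> = Ln z / (2 * of_real pi * \<i>)"
  show "ee \<tau> = z" using assms by (simp add: ee_def \<tau>_def)
  then have "exp (- 2 * pi * Im \<tau>) < 1" using assms norm_ee[of \<tau>] by simp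
  then show "\<tau> \<in> uhp" by (simp add: zero_less_mult_iff)
qed

text \<open>Its neighbourhoods contain whole half planes Im \<tau> > Y, so limits along it are
  uniform in the real part.\<close>

abbreviation inf_filter :: "complex filter" where
  "inf_filter \<equiv> filtercomap Im at_top"

lemma eventually_inf_filter: "eventually P inf_filter \<longleftrightarrow> (\<exists>Y. \<forall>\<tau>. Im \<tau> > Y \<longrightarrow> P \<tau>)"
proof
  assume "eventually P inf_filter"
  then obtain Q where Q: "eventually Q at_top" "\<And>\<tau>. Q (Im \<tau>) \<Longrightarrow> P \<tau>"
    unfolding eventually_filtercomap by blast
  then obtain Y where "\<And>y. y > Y \<Longrightarrow> Q y" unfolding eventually_at_top_dense by blast
  then show "\<exists>Y. \<forall>\<tau>. Im \<tau> > Y \<longrightarrow> P \<tau>" using Q(2) by blast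
next
  assume "\<exists>Y. \<forall>\<tau>. Im \<tau> > Y \<longrightarrow> P \<tau>"
  then obtain Y where "\<And>\<tau>. Im \<tau> > Y \<Longrightarrow> P \<tau>" by blast
  then show "eventually P inf_filter"
    unfolding eventually_filtercomap using eventually_gt_at_top[of Y] by blast
qed

lemma inf_filter_neq_bot: "inf_filter \<noteq> bot"
proof
  assume "inf_filter = bot"
  then have "eventually (\<lambda>_. False) inf_filter" by simp
  then obtain Y where "\<forall>\<tau>. \<not> Im \<tau> > Y" unfolding eventually_inf_filter by blast
  then have "\<not> Im (\<i> * of_real (Y + 1)) > Y" by blast
  then show False by simp
qed

lemma eventually_uhp: "eventually (\<lambda>\<tau>. \<tau> \<in> uhp) inf_filter"
  unfolding eventually_inf_filter by (intro exI[of _ 0]) simp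

lemma tendsto_ee: "w > 0 \<Longrightarrow> ((\<lambda>\<tau>. ee (\<tau> / of_nat w)) \<longlongrightarrow> 0) inf_filter"
proof (rule tendsto_norm_zero_cancel)
  assume w: "w > 0"
  have "filterlim (\<lambda>\<tau>. - (2 * pi / w) * Im \<tau>) at_bot inf_filter"
    using w by (intro filterlim_tendsto_neg_mult_at_bot[OF tendsto_const] filterlim_filtercomap) simp
  then have "((\<lambda>\<tau>. exp (- (2 * pi / w) * Im \<tau>)) \<longlongrightarrow> 0) inf_filter"
    by (rule filterlim_compose[OF exp_at_bot])
  then show "((\<lambda>\<tau>. cmod (ee (\<tau> / of_nat w))) \<longlongrightarrow> 0) inf_filter"
    by (simp add: norm_ee)
qed

lemma tendsto_q_function:
  assumes "P holomorphic_on ball 0 1" "w > 0"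
  shows "((\<lambda>\<tau>. P (ee (\<tau> / of_nat w))) \<longlongrightarrow> P 0) inf_filter"
proof -
  have "isCont P 0"
    using assms(1) by (meson centre_in_ball continuous_on_eq_continuous_at holomorphic_on_imp_continuous_on open_ball zero_less_one)
  then show ?thesis using isCont_tendsto_compose[OF _ tendsto_ee[OF assms(2)]] by blast
qed

lemma bounded_q_function:
  assumes "P holomorphic_on ball 0 1" "w > 0" "y\<^sub>0 > 0"
  obtains B where "\<And>\<tau>. Im \<tau> \<ge> y\<^sub>0 \<Longrightarrow> cmod (P (ee (\<tau> / of_nat w))) \<le> B"
proof -
  define r where "r = exp (- 2 * pi * y\<^sub>0 / w)"
  have "r < 1" using assms by (simp add: r_def)
  then have "cball 0 r \<subseteq> ball (0::complex) 1" by auto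
  then have "continuous_on (cball 0 r) P"
    using assms(1) holomorphic_on_imp_continuous_on continuous_on_subset by blast
  then have "bounded (P ` cball 0 r)"
    by (intro compact_imp_bounded compact_continuous_image compact_cball)
  then obtain B where B: "\<And>z. z \<in> cball 0 r \<Longrightarrow> cmod (P z) \<le> B" unfolding bounded_iff by blast
  show ?thesis
  proof (rule that)
    fix \<tau> assume "Im \<tau> \<ge> y\<^sub>0"
    then have "cmod (ee (\<tau> / of_nat w)) \<le> r" using assms by (simp add: norm_ee r_def divide_right_mono)
    then show "cmod (P (ee (\<tau> / of_nat w))) \<le> B" using B by simp
  qed
qed

text \<open>Every nonzero point of the unit disc is some \<open>ee \<tau>\<close>, so summability at
  all \<tau> is convergence of the power series on the whole disc.\<close>

lemma q_series_holomorphic: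
  assumes "\<And>\<tau>. \<tau> \<in> uhp \<Longrightarrow> (\<lambda>l::nat. a l * ee \<tau> ^ l) summable_on {1..}"
  obtains P where "P holomorphic_on ball 0 1" "P 0 = 0"
    "\<And>\<tau>. \<tau> \<in> uhp \<Longrightarrow> ((\<lambda>l. a l * ee \<tau> ^ l) has_sum P (ee \<tau>)) {1..}"
proof -
  define a' where "a' l = (if l = 0 then 0 else a l)" for l
  define P where "P z = suminf (\<lambda>l. a' l * z ^ l)" for z
  have sum: "((\<lambda>l. a l * ee \<tau> ^ l) has_sum P (ee \<tau>)) {1..} \<and> (\<lambda>l. a' l * ee \<tau> ^ l) sums P (ee \<tau>)"
    if \<tau>: "\<tau> \<in> uhp" for \<tau>
  proof -
    have "((\<lambda>l. a l * ee \<tau> ^ l) has_sum S) {1..} \<longleftrightarrow> ((\<lambda>l. a' l * ee \<tau> ^ l) has_sum S) UNIV" for S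
      by (rule has_sum_cong_neutral) (auto simp: a'_def not_le)
    moreover obtain S where S: "((\<lambda>l. a l * ee \<tau> ^ l) has_sum S) {1..}"
      using assms[OF \<tau>] by (auto simp: summable_on_def)
    ultimately have "(\<lambda>l. a' l * ee \<tau> ^ l) sums S" by (intro has_sum_imp_sums) simp
    moreover from this have "P (ee \<tau>) = S" by (simp add: P_def sums_iff)
    ultimately show ?thesis using S by simp
  qed
  have P0: "(\<lambda>l. a' l * 0 ^ l) sums P 0"
    using powser_sums_zero[of a'] by (simp add: P_def sums_iff)
  have "P holomorphic_on ball 0 1"
  proof (rule power_series_holomorphic)
    fix z :: complex assume z: "z \<in> ball 0 1"
    show "(\<lambda>l. a' l * (z - 0) ^ l) sums P z"
    proof (cases "z = 0")
      case True
      then show ?thesis using P0 by simp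
    next
      case False
      then obtain \<tau> where "\<tau> \<in> uhp" "ee \<tau> = z" using ee_surj z by blast
      then show ?thesis using sum by auto
    qed
  qed
  moreover have "P 0 = 0" using powser_sums_zero[of a'] by (simp add: P_def sums_iff a'_def)
  ultimately show ?thesis using that sum by blast
qed

text \<open>Once the polar part and the constant term are split off, the rest is a holomorphic
  function of q^(1/w) with a zero at 0, from which growth and limits at the cusp can be read
  off.\<close>

lemma has_q_expansion_split:
  assumes "has_q_expansion w m a f" "w > 0"
  obtains P where "P holomorphic_on ball 0 1" "P 0 = 0"
    "\<And>\<tau>. \<tau> \<in> uhp \<Longrightarrow> f \<tau> = (\<Sum>k\<in>{m..0}. a k * ee (of_int k * \<tau> / of_nat w)) + P (ee (\<tau> / of_nat w))"
proof -
  \<comment> \<open>Coefficients below m are set to 0, so that {m..0} \<union> {1..} serves as index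
    set also when m exceeds 1.\<close>
  define c where "c k = (if k \<ge> m then a k else 0)" for k
  define F where "F \<tau> k = c k * ee (of_int k * \<tau> / of_nat w)" for \<tau> k
  have all: "(F \<tau> has_sum f \<tau>) ({m..0} \<union> {1..})" if "\<tau> \<in> uhp" for \<tau>
  proof -
    have "((\<lambda>k. a k * ee (of_int k * \<tau> / of_nat w)) has_sum f \<tau>) {m..}"
      using assms that by (simp add: has_q_expansion_def)
    then show ?thesis
      by (rule has_sum_cong_neutral[THEN iffD1, rotated -1]) (auto simp: F_def c_def)
  qed
  have bij: "bij_betw int {1..} {1..}"
    by (rule bij_betwI[of _ _ _ nat]) auto
  have Fint: "F \<tau> (int l) = c (int l) * ee (\<tau> / of_nat w) ^ l" for \<tau> l
    using ee_of_nat_mult[of l "\<tau> / of_nat w"] by (simp add: F_def)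
  have "(\<lambda>l. c (int l) * ee \<tau> ^ l) summable_on {1..}" if "\<tau> \<in> uhp" for \<tau>
  proof -
    \<comment> \<open>Evaluation at w \<tau> turns q^(1/w) into q.\<close>
    have "of_nat w * \<tau> \<in> uhp" using that assms(2) by simp
    then have "F (of_nat w * \<tau>) summable_on {1..}"
      using all summable_on_subset[of "F (of_nat w * \<tau>)" "{m..0} \<union> {1..}" "{1..}"] summable_on_def by blast
    then have "(\<lambda>l. F (of_nat w * \<tau>) (int l)) summable_on {1..}"
      using summable_on_reindex_bij_betw[OF bij] by blast
    then show ?thesis using assms(2) by (simp add: Fint)
  qed
  then obtain P where P: "P holomorphic_on ball 0 1" "P 0 = 0"
    "\<And>\<tau>. \<tau> \<in> uhp \<Longrightarrow> ((\<lambda>l. c (int l) * ee \<tau> ^ l) has_sum P (ee \<tau>)) {1..}"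
    using q_series_holomorphic[of "\<lambda>l. c (int l)"] by blast
  have "f \<tau> = (\<Sum>k\<in>{m..0}. a k * ee (of_int k * \<tau> / of_nat w)) + P (ee (\<tau> / of_nat w))" if \<tau>: "\<tau> \<in> uhp" for \<tau>
  proof -
    have "\<tau> / of_nat w \<in> uhp" using \<tau> assms(2) by simp
    then have "((\<lambda>l. F \<tau> (int l)) has_sum P (ee (\<tau> / of_nat w))) {1..}"
      using P(3) by (simp add: Fint)
    then have "(F \<tau> has_sum P (ee (\<tau> / of_nat w))) {1..}"
      using has_sum_reindex_bij_betw[OF bij] by blast
    moreover have "(F \<tau> has_sum sum (F \<tau>) {m..0}) {m..0}" by simp
    ultimately have "(F \<tau> has_sum (sum (F \<tau>) {m..0} + P (ee (\<tau> / of_nat w)))) ({m..0} \<union> {1..})"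
      by (intro has_sum_Un_disjoint) auto
    then have "f \<tau> = sum (F \<tau>) {m..0} + P (ee (\<tau> / of_nat w))"
      using all[OF \<tau>] has_sum_unique by blast
    then show ?thesis by (simp add: F_def c_def)
  qed
  then show ?thesis using that P by blast
qed

text \<open>This makes the definite description in \<open>q_fps\<close> usable; uniqueness is the
  identity theorem for power series.\<close>

lemma q_fps_eq:
  assumes "has_q_expansion 1 1 a h"
  shows "q_fps h = Abs_fps (\<lambda>n. if n = 0 then 0 else a (int n))"
proof -
  define F where "F = Abs_fps (\<lambda>n. if n = 0 then 0 else a (int n))"
  define is_exp where "is_exp F \<longleftrightarrow> (\<forall>\<tau>\<in>uhp. ((\<lambda>n. fps_nth F n * ee \<tau> ^ n) has_sum h \<tau>) UNIV)" for F
  have "is_exp F"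
    unfolding is_exp_def
  proof
    fix \<tau> assume "\<tau> \<in> uhp"
    have bij: "bij_betw int {1..} {1..}"
      by (rule bij_betwI[of _ _ _ nat]) auto
    have "((\<lambda>k. a k * ee (of_int k * \<tau> / of_nat 1)) has_sum h \<tau>) {1..}"
      using assms \<open>\<tau> \<in> uhp\<close> by (simp add: has_q_expansion_def)
    then have "((\<lambda>l. a (int l) * ee (of_int (int l) * \<tau> / of_nat 1)) has_sum h \<tau>) {1..}"
      using has_sum_reindex_bij_betw[OF bij, of "\<lambda>k. a k * ee (of_int k * \<tau> / of_nat 1)"] by blast
    then have "((\<lambda>l. a (int l) * ee \<tau> ^ l) has_sum h \<tau>) {1..}"
      by (simp add: ee_of_nat_mult)
    then show "((\<lambda>n. fps_nth F n * ee \<tau> ^ n) has_sum h \<tau>) UNIV"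
      by (rule has_sum_cong_neutral[THEN iffD1, rotated -1]) (auto simp: F_def not_le)
  qed
  moreover have "F' = F" if "is_exp F'" for F'
  proof (rule ccontr)
    assume "F' \<noteq> F"
    then obtain m where m: "fps_nth F' m \<noteq> fps_nth F m" by (auto simp: fps_eq_iff)
    \<comment> \<open>The difference of the two series, multiplied by z. It is known to vanish only
      for nonzero z, since \<open>ee\<close> omits the value 0; the extra factor settles z =
      0.\<close>
    define d where "d n = (case n of 0 \<Rightarrow> 0 | Suc n \<Rightarrow> fps_nth F' n - fps_nth F n)" for n
    have zero: "(\<lambda>n. d n * (z - 0) ^ n) sums 0" if z: "cmod (z - 0) < 1" for z
    proof (cases "z = 0")
      case True
      then show ?thesis using powser_sums_zero[of d] by (simp add: d_def)
    next
      case False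
      then obtain \<tau> where \<tau>: "\<tau> \<in> uhp" "ee \<tau> = z" using ee_surj[of z] z by auto
      then have "(\<lambda>n. fps_nth F n * z ^ n) sums h \<tau>" "(\<lambda>n. fps_nth F' n * z ^ n) sums h \<tau>"
        using \<open>is_exp F\<close> \<open>is_exp F'\<close> has_sum_imp_sums unfolding is_exp_def by blast+
      from sums_mult[OF sums_diff[OF this(2,1)], of z]
      have "(\<lambda>n. d (Suc n) * z ^ Suc n) sums 0" by (simp add: d_def algebra_simps)
      then show ?thesis using sums_Suc_imp[of "\<lambda>n. d n * z ^ n"] by (simp add: d_def)
    qed
    show False
    proof (rule powser_0_nonzero[of 1 0 d "\<lambda>_. 0" "Suc m"])
      show "d (Suc m) \<noteq> 0" using m by (simp add: d_def)
      fix s :: real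
      assume "s > 0" "\<And>z. z \<in> cball (0::complex) s - {0} \<Longrightarrow> (0::complex) \<noteq> 0"
      from this(2)[of "of_real s"] \<open>s > 0\<close> show False by simp
    qed (use zero in simp_all)
  qed
  ultimately have "(THE F. is_exp F) = F" by (rule the_equality)
  then show ?thesis by (simp add: q_fps_def is_exp_def F_def)
qed

lemma cusp_ord_ge_0_expansion:
  assumes "cusp_ord_ge k 0 \<sigma> f"
  obtains w L P where "w > 0" "P holomorphic_on ball 0 1" "P 0 = 0"
    "\<And>\<tau>. \<tau> \<in> uhp \<Longrightarrow> slash k \<sigma> f \<tau> = L + P (ee (\<tau> / of_nat w))"
proof -
  obtain w a where w: "w > 0" "has_q_expansion w 0 a (slash k \<sigma> f)"
    using assms by (auto simp: cusp_ord_ge_def)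
  obtain P where "P holomorphic_on ball 0 1" "P 0 = 0"
    "\<And>\<tau>. \<tau> \<in> uhp \<Longrightarrow> slash k \<sigma> f \<tau> = a 0 + P (ee (\<tau> / of_nat w))"
    using has_q_expansion_split[OF w(2,1)] by (auto simp: ee_def)
  then show ?thesis by (rule that[OF w(1)])
qed

lemma cusp_ord_ge_0_tendsto:
  assumes "cusp_ord_ge k 0 \<sigma> f"
  obtains L where "(slash k \<sigma> f \<longlongrightarrow> L) inf_filter"
proof -
  obtain w L P where w: "w > 0" and P: "P holomorphic_on ball 0 1" "P 0 = 0"
    "\<And>\<tau>. \<tau> \<in> uhp \<Longrightarrow> slash k \<sigma> f \<tau> = L + P (ee (\<tau> / of_nat w))"
    by (rule cusp_ord_ge_0_expansion[OF assms]) blast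
  have "((\<lambda>\<tau>. L + P (ee (\<tau> / of_nat w))) \<longlongrightarrow> L + P 0) inf_filter"
    by (intro tendsto_intros tendsto_q_function P w)
  moreover have "eventually (\<lambda>\<tau>. L + P (ee (\<tau> / of_nat w)) = slash k \<sigma> f \<tau>) inf_filter"
    using eventually_uhp by eventually_elim (simp add: P(3))
  ultimately have "(slash k \<sigma> f \<longlongrightarrow> L + P 0) inf_filter" by (rule Lim_transform_eventually)
  then show ?thesis by (rule that)
qed

lemma cusp_ord_ge_1_tendsto:
  assumes "cusp_ord_ge k 1 \<sigma> f"
  shows "(slash k \<sigma> f \<longlongrightarrow> 0) inf_filter"
proof -
  obtain w a where w: "w > 0" "has_q_expansion w 1 a (slash k \<sigma> f)"
    using assms by (auto simp: cusp_ord_ge_def)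
  obtain P where P: "P holomorphic_on ball 0 1" "P 0 = 0"
    "\<And>\<tau>. \<tau> \<in> uhp \<Longrightarrow> slash k \<sigma> f \<tau> = P (ee (\<tau> / of_nat w))"
    using has_q_expansion_split[OF w(2,1)] by auto
  have "((\<lambda>\<tau>. P (ee (\<tau> / of_nat w))) \<longlongrightarrow> P 0) inf_filter"
    by (intro tendsto_q_function P w)
  moreover have "eventually (\<lambda>\<tau>. P (ee (\<tau> / of_nat w)) = slash k \<sigma> f \<tau>) inf_filter"
    using eventually_uhp by eventually_elim (simp add: P(3))
  ultimately have "(slash k \<sigma> f \<longlongrightarrow> P 0) inf_filter" by (rule Lim_transform_eventually)
  then show ?thesis by (simp add: P)
qed

lemma cusp_ord_ge_0_bounded:
  assumes "cusp_ord_ge k 0 \<sigma> f" "y\<^sub>0 > 0"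
  obtains B where "\<And>\<tau>. Im \<tau> \<ge> y\<^sub>0 \<Longrightarrow> cmod (slash k \<sigma> f \<tau>) \<le> B"
proof -
  obtain w L P where w: "w > 0" and P: "P holomorphic_on ball 0 1" "P 0 = 0"
    "\<And>\<tau>. \<tau> \<in> uhp \<Longrightarrow> slash k \<sigma> f \<tau> = L + P (ee (\<tau> / of_nat w))"
    by (rule cusp_ord_ge_0_expansion[OF assms(1)]) blast
  obtain B where B: "\<And>\<tau>. Im \<tau> \<ge> y\<^sub>0 \<Longrightarrow> cmod (P (ee (\<tau> / of_nat w))) \<le> B"
    using bounded_q_function[OF P(1) w assms(2)] by blast
  show ?thesis
  proof (rule that)
    fix \<tau> assume "Im \<tau> \<ge> y\<^sub>0"
    then show "cmod (slash k \<sigma> f \<tau>) \<le> cmod L + B"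
      using P(3)[of \<tau>] B[of \<tau>] assms(2) norm_triangle_ineq[of "L" "P (ee (\<tau> / of_nat w))"] by simp
  qed
qed

subsection \<open>The residue theorem\<close>

text \<open>The increment is the integral of \<rho> over a horizontal segment of fixed length. It
  tends to 0 as the segment moves up, and it is constant.\<close>

lemma translation_increment_tendsto:
  assumes d: "\<And>\<tau>. \<tau> \<in> uhp \<Longrightarrow> (\<Phi> has_field_derivative \<rho> \<tau>) (at \<tau>)"
    and \<rho>: "(\<rho> \<longlongrightarrow> 0) inf_filter"
    and const: "\<And>\<tau>. \<tau> \<in> uhp \<Longrightarrow> \<Phi> (\<tau> + of_real P) - \<Phi> \<tau> = c"
  shows "c = 0"
proof (rule ccontr)
  assume "c \<noteq> 0"
  define e where "e = cmod c / (2 * (\<bar>P\<bar> + 1))"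
  have e: "e > 0" using \<open>c \<noteq> 0\<close> by (simp add: e_def)
  have "eventually (\<lambda>\<tau>. dist (\<rho> \<tau>) 0 < e) inf_filter" using \<rho> e by (rule tendstoD)
  then obtain Y where Y: "\<And>\<tau>. Im \<tau> > Y \<Longrightarrow> cmod (\<rho> \<tau>) < e"
    by (auto simp: eventually_inf_filter)
  define H where "H = {\<tau>. Im \<tau> > max Y 0}"
  define \<tau> where "\<tau> = \<i> * of_real (max Y 0 + 1)"
  have "cmod (\<Phi> (\<tau> + of_real P) - \<Phi> \<tau>) \<le> e * cmod (\<tau> + of_real P - \<tau>)"
  proof (rule field_differentiable_bound)
    show "convex H" unfolding H_def by (rule convex_halfspace_Im_gt)
    show "(\<Phi> has_field_derivative \<rho> z) (at z within H)" if "z \<in> H" for z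
      using that d[of z] by (simp add: H_def has_field_derivative_at_within)
    show "cmod (\<rho> z) \<le> e" if "z \<in> H" for z
      using that Y[of z] by (simp add: H_def)
  next
    have "max Y 0 < max Y 0 + 1" by simp
    then show "\<tau> + of_real P \<in> H" "\<tau> \<in> H" unfolding H_def \<tau>_def by (auto simp: max_def)
  qed
  also have "\<Phi> (\<tau> + of_real P) - \<Phi> \<tau> = c" by (rule const) (simp add: \<tau>_def)
  finally have "cmod c \<le> e * \<bar>P\<bar>" by simp
  also have "\<dots> \<le> e * (\<bar>P\<bar> + 1)" using e by simp
  also have "\<dots> = cmod c / 2"
    using abs_ge_zero[of P] by (simp add: e_def divide_simps del: abs_ge_zero)
  finally show False using \<open>c \<noteq> 0\<close> by simp
qed

context atkin_lehner_group
begin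

text \<open>A primitive of a form $\varphi\,d\tau$ of weight 2 summed over the cosets of $\Gamma_0(N)$ changes
  under $\mathrm{SL}_2(\mathbb{Z})$ by a homomorphism to $\mathbb{C}$.  The latter is trivial, because
  the generators $S$ and $ST$ have fixed points in the upper half plane; evaluating it on a power
  of $T$ yields the residue theorem at the cusps.\<close>

lemma residue_at_inf:
  assumes hol: "\<phi> holomorphic_on uhp"
    and wt: "\<And>\<gamma> \<tau>. \<gamma> \<in> \<Gamma> \<Longrightarrow> \<tau> \<in> uhp \<Longrightarrow> \<phi> (moeb \<gamma> \<tau>) = (autom \<gamma> \<tau>)\<^sup>2 * \<phi> \<tau>"
    and cusps: "\<And>\<sigma>. \<sigma> \<in> SL2Z \<Longrightarrow> ext_moeb \<sigma> None \<notin> orbit_of \<Gamma> None \<Longrightarrow>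
       ((\<lambda>\<tau>. \<phi> (moeb \<sigma> \<tau>) / (autom \<sigma> \<tau>)\<^sup>2) \<longlongrightarrow> 0) inf_filter"
    and \<Phi>: "\<And>\<tau>. \<tau> \<in> uhp \<Longrightarrow> (\<Phi> has_field_derivative \<phi> \<tau>) (at \<tau>)"
    and c0: "\<And>\<tau>. \<tau> \<in> uhp \<Longrightarrow> \<Phi> (\<tau> + 1) - \<Phi> \<tau> = c0"
  shows "c0 = 0"
proof -
  have \<Phi>_moeb: "((\<lambda>\<tau>. \<Phi> (moeb \<sigma> \<tau>)) has_field_derivative \<phi> (moeb \<sigma> \<tau>) / (autom \<sigma> \<tau>)\<^sup>2) (at \<tau>)"
    if "det \<sigma> = 1" "\<tau> \<in> uhp" for \<sigma> \<tau>
    using DERIV_chain2[OF \<Phi>[OF moeb_uhp[OF that]] moeb_has_derivative[OF that]] by simp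
  \<comment> \<open>By the weight 2 law the derivative of \<Phi> o \<gamma> - \<Phi> vanishes; the
    constants are the periods of the form.\<close>
  have "\<exists>c. \<forall>\<tau>\<in>uhp. \<Phi> (moeb \<gamma> \<tau>) - \<Phi> \<tau> = c" if \<gamma>: "\<gamma> \<in> \<Gamma>" for \<gamma>
  proof (rule has_field_derivative_zero_constant[OF convex_uhp])
    fix \<tau> assume \<tau>: "\<tau> \<in> uhp"
    have "((\<lambda>\<tau>. \<Phi> (moeb \<gamma> \<tau>) - \<Phi> \<tau>) has_field_derivative
        \<phi> (moeb \<gamma> \<tau>) / (autom \<gamma> \<tau>)\<^sup>2 - \<phi> \<tau>) (at \<tau>)"
      using \<Phi>_moeb[OF det_Gamma[OF \<gamma>] \<tau>] \<Phi>[OF \<tau>] by (rule DERIV_diff)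
    also have "\<phi> (moeb \<gamma> \<tau>) / (autom \<gamma> \<tau>)\<^sup>2 - \<phi> \<tau> = 0"
      using wt[OF \<gamma> \<tau>] autom_nonzero[OF det_Gamma[OF \<gamma>] \<tau>] by simp
    finally show "((\<lambda>\<tau>. \<Phi> (moeb \<gamma> \<tau>) - \<Phi> \<tau>) has_field_derivative 0) (at \<tau> within uhp)"
      by (rule has_field_derivative_at_within)
  qed
  then obtain \<xi> where \<xi>: "\<And>\<gamma> \<tau>. \<gamma> \<in> \<Gamma> \<Longrightarrow> \<tau> \<in> uhp \<Longrightarrow> \<Phi> (moeb \<gamma> \<tau>) = \<Phi> \<tau> + \<xi> \<gamma>"
    by (metis diff_eq_eq add.commute)
  obtain R rep where R: "finite R" "R \<subseteq> SL2Z" "\<And>\<sigma>. \<sigma> \<in> SL2Z \<Longrightarrow> rep \<sigma> \<in> R"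
    "\<And>\<sigma>. \<sigma> \<in> SL2Z \<Longrightarrow> \<sigma> ** inv2 (rep \<sigma>) \<in> Gamma0 N"
    "\<And>\<gamma>. \<gamma> \<in> SL2Z \<Longrightarrow> bij_betw (\<lambda>r. rep (r ** \<gamma>)) R R" "rep (mat 1) \<in> Gamma0 N"
    using finite_coset_reps[OF N_pos] by metis
  have detR: "det r = 1" if "r \<in> R" for r using that R(2) det_SL2Z by blast
  \<comment> \<open>A trace to level 1. Right multiplication by an element of SL2(Z) permutes the
    cosets up to elements of \<Gamma>, so it changes \<Psi> by a constant.\<close>
  define \<Psi> where "\<Psi> \<tau> = (\<Sum>r\<in>R. \<Phi> (moeb r \<tau>))" for \<tau>
  have "\<exists>\<kappa>. \<forall>\<tau>\<in>uhp. \<Psi> (moeb \<gamma> \<tau>) = \<Psi> \<tau> + \<kappa>" if \<gamma>: "\<gamma> \<in> SL2Z" for \<gamma>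
  proof (intro exI ballI)
    fix \<tau> assume \<tau>: "\<tau> \<in> uhp"
    have "\<Phi> (moeb r (moeb \<gamma> \<tau>)) = \<Phi> (moeb (rep (r ** \<gamma>)) \<tau>) + \<xi> ((r ** \<gamma>) ** inv2 (rep (r ** \<gamma>)))"
      if r: "r \<in> R" for r
    proof -
      have r\<gamma>: "r ** \<gamma> \<in> SL2Z" using r R(2) \<gamma> SL2Z_mult by blast
      define \<rho> where "\<rho> = rep (r ** \<gamma>)"
      have d\<rho>: "det \<rho> = 1" using R(3)[OF r\<gamma>] detR by (simp add: \<rho>_def)
      have \<delta>: "(r ** \<gamma>) ** inv2 \<rho> \<in> \<Gamma>" using R(4)[OF r\<gamma>] Gamma0_subset by (auto simp: \<rho>_def)
      have "moeb r (moeb \<gamma> \<tau>) = moeb (r ** \<gamma>) \<tau>" using moeb_mult[OF det_SL2Z[OF \<gamma>] \<tau>] by simp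
      also have "r ** \<gamma> = ((r ** \<gamma>) ** inv2 \<rho>) ** \<rho>"
        by (simp add: inv2_left[OF d\<rho>] flip: matrix_mul_assoc)
      also have "moeb \<dots> \<tau> = moeb ((r ** \<gamma>) ** inv2 \<rho>) (moeb \<rho> \<tau>)" by (rule moeb_mult[OF d\<rho> \<tau>])
      finally show ?thesis using \<xi>[OF \<delta> moeb_uhp[OF d\<rho> \<tau>]] by (simp add: \<rho>_def)
    qed
    then have "\<Psi> (moeb \<gamma> \<tau>) = (\<Sum>r\<in>R. \<Phi> (moeb (rep (r ** \<gamma>)) \<tau>)) + (\<Sum>r\<in>R. \<xi> ((r ** \<gamma>) ** inv2 (rep (r ** \<gamma>))))"
      by (simp add: \<Psi>_def sum.distrib)
    also have "(\<Sum>r\<in>R. \<Phi> (moeb (rep (r ** \<gamma>)) \<tau>)) = \<Psi> \<tau>"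
      unfolding \<Psi>_def by (rule sum.reindex_bij_betw[OF R(5)[OF \<gamma>]])
    finally show "\<Psi> (moeb \<gamma> \<tau>) = \<Psi> \<tau> + (\<Sum>r\<in>R. \<xi> ((r ** \<gamma>) ** inv2 (rep (r ** \<gamma>))))" .
  qed
  \<comment> \<open>The constant increment is evaluated at the fixed point p, where it is 0.\<close>
  then have fixed: "\<Psi> (moeb \<gamma> \<tau>) = \<Psi> \<tau>"
    if "\<gamma> \<in> SL2Z" "p \<in> uhp" "moeb \<gamma> p = p" "\<tau> \<in> uhp" for \<gamma> p \<tau>
    using that by (metis add_cancel_right_right)
  define S where "S = mat2 (of_int 0) (of_int (-1)) (of_int 1) (of_int 0)"
  have S: "S \<in> SL2Z" unfolding SL2Z_def S_def by (intro CollectI exI conjI) (rule refl, simp)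
  define U where "U = S ** shift (of_int 1)"
  have U: "U \<in> SL2Z" unfolding U_def by (intro SL2Z_mult S shift_in_SL2Z)
  have S_fix: "moeb S \<i> = \<i>" by (simp add: S_def moeb_def autom_def)
  have moeb_U: "moeb U \<tau> = moeb S (\<tau> + 1)" if "\<tau> \<in> uhp" for \<tau>
    using moeb_mult[of "shift (of_int 1)" \<tau> S] that by (simp add: U_def)
  \<comment> \<open>A primitive cube root of unity, fixed by the map \<tau> \<mapsto> -1 / (\<tau> +
    1) of \<open>U\<close>.\<close>
  define \<omega> where "\<omega> = Complex (- 1 / 2) (sqrt 3 / 2)"
  have \<omega>: "\<omega> \<in> uhp" by (simp add: \<omega>_def)
  have "\<omega> * (\<omega> + 1) = -1"
    by (simp add: \<omega>_def complex_eq_iff)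
  moreover have "\<omega> + 1 \<noteq> 0" by (simp add: \<omega>_def complex_eq_iff)
  ultimately have "-1 / (\<omega> + 1) = \<omega>" by (simp add: field_simps)
  then have U_fix: "moeb U \<omega> = \<omega>"
    unfolding moeb_U[OF \<omega>] by (simp add: S_def moeb_def autom_def)
  have \<Psi>1: "\<Psi> (\<tau> + 1) = \<Psi> \<tau>" if "\<tau> \<in> uhp" for \<tau>
  proof -
    have "\<Psi> (moeb U \<tau>) = \<Psi> \<tau>" by (rule fixed[OF U \<omega> U_fix that])
    moreover have "\<Psi> (moeb S (\<tau> + 1)) = \<Psi> (\<tau> + 1)"
      by (rule fixed[OF S _ S_fix]) (use that in simp_all)
    ultimately show ?thesis using moeb_U[OF that] by simp
  qed
  have \<Psi>k: "\<Psi> (\<tau> + of_nat k) = \<Psi> \<tau>" if "\<tau> \<in> uhp" for \<tau> k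
    using \<Psi>1[of "\<tau> + of_nat j" for j] that by (induction k) (simp_all add: add_ac)
  have \<Phi>k: "\<Phi> (\<tau> + of_nat k) - \<Phi> \<tau> = of_nat k * c0" if "\<tau> \<in> uhp" for \<tau> k
  proof (induction k)
    case (Suc k)
    have "\<Phi> (\<tau> + of_nat k + 1) - \<Phi> (\<tau> + of_nat k) = c0" by (rule c0) (use that in simp)
    then show ?case using Suc by (simp add: algebra_simps)
  qed simp
  \<comment> \<open>At the cusp r(i\<infinity>) the translation by N contributes a natural multiple
    of c0: none at an inequivalent cusp, where the form tends to 0, and otherwise the length that
    the translation has after transport to i\<infinity>. Since no multiplicity is negative, the
    total cannot cancel.\<close>
  have "\<exists>a::nat. (\<forall>\<tau>\<in>uhp. \<Phi> (moeb r (\<tau> + of_real (real N))) - \<Phi> (moeb r \<tau>) = of_nat a * c0) \<and>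
      (r \<in> \<Gamma> \<longrightarrow> a > 0)" if r: "r \<in> R" for r
  proof -
    have rSL: "r \<in> SL2Z" using r R by blast
    have dr: "det r = 1" using detR r by blast
    have Nup: "\<tau> + of_real (real N) \<in> uhp" if "\<tau> \<in> uhp" for \<tau> using that by simp
    define \<delta> where "\<delta> = r ** shift (of_nat N) ** inv2 r"
    have \<delta>: "\<delta> \<in> \<Gamma>" using conj_shift_in_Gamma0[OF rSL] Gamma0_subset unfolding \<delta>_def by blast
    have \<delta>r: "\<delta> ** r = r ** shift (of_nat N)"
      by (simp add: \<delta>_def inv2_left[OF dr] flip: matrix_mul_assoc)
    have diff: "\<Phi> (moeb r (\<tau> + of_real (real N))) - \<Phi> (moeb r \<tau>) = \<xi> \<delta>" if \<tau>: "\<tau> \<in> uhp" for \<tau>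
    proof -
      have "moeb r (\<tau> + of_real (real N)) = moeb (r ** shift (of_nat N)) \<tau>"
        using moeb_mult[of "shift (of_nat N)" \<tau> r] \<tau> by simp
      also have "\<dots> = moeb \<delta> (moeb r \<tau>)"
        unfolding \<delta>r[symmetric] by (rule moeb_mult[OF dr \<tau>])
      finally show ?thesis using \<xi>[OF \<delta> moeb_uhp[OF dr \<tau>]] by simp
    qed
    show ?thesis
    proof (cases "ext_moeb r None \<in> orbit_of \<Gamma> None")
      case False
      have "\<xi> \<delta> = 0"
        by (rule translation_increment_tendsto[OF \<Phi>_moeb[OF dr] cusps[OF rSL False] diff])
      moreover have "r \<notin> \<Gamma>" using False unfolding orbit_of_def by (metis imageI)
      ultimately show ?thesis using diff by (intro exI[of _ 0]) simp
    next
      case True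
      then obtain \<gamma> t where \<gamma>: "\<gamma> \<in> \<Gamma>" and r_eq: "r = \<gamma> ** t" and t: "t$2$1 = 0" "det t = 1"
        using cusp_equivalent dr by blast
      have d\<gamma>: "det \<gamma> = 1" using \<gamma> by (rule det_Gamma)
      have t12: "t$1$1 * t$2$2 = 1" using t by (simp add: det_2)
      \<comment> \<open>The matrix t need not be integral. Its conjugate of the translation by N
        nevertheless lies in \<Gamma> and fixes i\<infinity>, so it translates by an integer, which
        makes (t11)^2 N an integer.\<close>
      define M where "M = inv2 \<gamma> ** \<delta> ** \<gamma>"
      have "M \<in> \<Gamma>" unfolding M_def by (intro Gamma_mult Gamma_inv \<gamma> \<delta>)
      have "M = t ** shift (of_nat N) ** inv2 t"
        by (simp add: M_def r_eq \<delta>_def inv2_mult inv2_left[OF d\<gamma>] inv2_cancel_left[OF d\<gamma>] flip: matrix_mul_assoc)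
      then have M: "M$1$1 = 1" "M$1$2 = (t$1$1)\<^sup>2 * N" "M$2$1 = 0"
        using t12 by (simp_all add: mult_nth t(1) algebra_simps power2_eq_square)
      have "M \<in> Gamma_inf" using Gamma_stabilizer[OF \<open>M \<in> \<Gamma>\<close> M(3)] .
      then obtain e k where ek: "M = mat2 e (e * of_int k) 0 e" unfolding Gamma_inf_def by blast
      have k: "(t$1$1)\<^sup>2 * N = of_int k" using M(1,2) unfolding ek by simp
      have "t$1$1 \<noteq> 0" using t12 by auto
      then have "(t$1$1)\<^sup>2 * N > 0" using N_pos by simp
      then have "k > 0" unfolding k by simp
      define a where "a = nat k"
      have a: "(t$1$1)\<^sup>2 * N = of_nat a" "a > 0" using k \<open>k > 0\<close> by (simp_all add: a_def)
      have "\<Phi> (moeb r (\<tau> + of_real (real N))) - \<Phi> (moeb r \<tau>) = of_nat a * c0" if \<tau>: "\<tau> \<in> uhp" for \<tau>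
      proof -
        have split: "\<Phi> (moeb r z) = \<Phi> (moeb t z) + \<xi> \<gamma>" if "z \<in> uhp" for z
          unfolding r_eq moeb_mult[OF t(2) that] by (rule \<xi>[OF \<gamma> moeb_uhp[OF t(2) that]])
        have "moeb t (\<tau> + of_real (real N)) = moeb t \<tau> + of_real ((t$1$1)\<^sup>2 * N)"
          unfolding moeb_upper[OF t] by (simp add: algebra_simps)
        then have "moeb t (\<tau> + of_real (real N)) = moeb t \<tau> + of_nat a" by (simp add: a)
        then show ?thesis
          unfolding split[OF \<tau>] split[OF Nup[OF \<tau>]] using \<Phi>k[OF moeb_uhp[OF t(2) \<tau>]] by simp
      qed
      then show ?thesis using a(2) by blast
    qed
  qed
  then obtain a where a: "\<And>r \<tau>. r \<in> R \<Longrightarrow> \<tau> \<in> uhp \<Longrightarrow>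
      \<Phi> (moeb r (\<tau> + of_real (real N))) - \<Phi> (moeb r \<tau>) = of_nat (a r) * c0"
    "\<And>r. r \<in> R \<Longrightarrow> r \<in> \<Gamma> \<Longrightarrow> a r > 0"
    by metis
  have "0 = \<Psi> (\<i> + of_nat N) - \<Psi> \<i>" using \<Psi>k[of \<i> N] by simp
  also have "\<dots> = (\<Sum>r\<in>R. \<Phi> (moeb r (\<i> + of_real (real N))) - \<Phi> (moeb r \<i>))"
    by (simp add: \<Psi>_def sum_subtractf)
  also have "\<dots> = (\<Sum>r\<in>R. of_nat (a r) * c0)" using a(1)[of _ \<i>] by (intro sum.cong) auto
  also have "\<dots> = of_nat (\<Sum>r\<in>R. a r) * c0" by (simp add: sum_distrib_right)
  finally have "of_nat (\<Sum>r\<in>R. a r) * c0 = 0" by simp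
  \<comment> \<open>The representative of Gamma0(N) itself lies in \<Gamma> and has positive
    multiplicity.\<close>
  moreover have "(\<Sum>r\<in>R. a r) > 0"
  proof -
    have "rep (mat 1) \<in> R" "rep (mat 1) \<in> \<Gamma>" using R(3)[OF mat1_in_SL2Z] R(6) Gamma0_subset by auto
    then show ?thesis using a(2) R(1) by (metis member_le_sum not_gr_zero le_zero_eq zero_le)
  qed
  ultimately show ?thesis by (metis mult_eq_0_iff of_nat_eq_0_iff less_irrefl)
qed

text \<open>The increment of a primitive of \<phi> under \<tau> \<mapsto> \<tau> + 1 vanishes by
  \<open>residue_at_inf\<close>. An explicit primitive of the exponential sum has the same
  increment, because the difference has a derivative tending to 0, and only exponents equal to 0
  contribute to it. Exponents may repeat, so that a product of two expansions can be indexed by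
  pairs.\<close>

lemma constant_term_zero:
  assumes hol: "\<phi> holomorphic_on uhp"
    and wt: "\<And>\<gamma> \<tau>. \<gamma> \<in> \<Gamma> \<Longrightarrow> \<tau> \<in> uhp \<Longrightarrow> \<phi> (moeb \<gamma> \<tau>) = (autom \<gamma> \<tau>)\<^sup>2 * \<phi> \<tau>"
    and cusps: "\<And>\<sigma>. \<sigma> \<in> SL2Z \<Longrightarrow> ext_moeb \<sigma> None \<notin> orbit_of \<Gamma> None \<Longrightarrow>
       ((\<lambda>\<tau>. \<phi> (moeb \<sigma> \<tau>) / (autom \<sigma> \<tau>)\<^sup>2) \<longlongrightarrow> 0) inf_filter"
    and expansion: "finite I" "((\<lambda>\<tau>. \<phi> \<tau> - (\<Sum>i\<in>I. c i * ee (of_int (e i) * \<tau>))) \<longlongrightarrow> 0) inf_filter"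
  shows "(\<Sum>i\<in>{i\<in>I. e i = 0}. c i) = 0"
proof -
  obtain \<Phi> where \<Phi>: "\<And>\<tau>. \<tau> \<in> uhp \<Longrightarrow> (\<Phi> has_field_derivative \<phi> \<tau>) (at \<tau> within uhp)"
    using holomorphic_convex_primitive'[OF convex_uhp open_uhp hol] by blast
  then have \<Phi>': "(\<Phi> has_field_derivative \<phi> \<tau>) (at \<tau>)" if "\<tau> \<in> uhp" for \<tau>
    using that at_within_open[OF that open_uhp] by metis
  define p where "p j \<tau> = (if j = 0 then \<tau> else ee (of_int j * \<tau>) / (2 * of_real pi * \<i> * of_int j))" for j :: int and \<tau>
  have p: "(p j has_field_derivative ee (of_int j * \<tau>)) (at \<tau>)" for j \<tau>
    by (cases "j = 0") (auto simp: p_def[abs_def] ee_def intro!: derivative_eq_intros)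
  have p1: "p j (\<tau> + 1) - p j \<tau> = (if j = 0 then 1 else 0)" for j \<tau>
  proof -
    have "ee (of_int j) = 1" using exp_integer_2pi[of "of_int j"] by (simp add: ee_def mult_ac)
    then show ?thesis by (simp add: p_def ring_distribs ee_add)
  qed
  define \<Theta> where "\<Theta> \<tau> = (\<Sum>i\<in>I. c i * p (e i) \<tau>)" for \<tau>
  have d: "((\<lambda>\<tau>. \<Phi> \<tau> - \<Theta> \<tau>) has_field_derivative \<phi> \<tau> - (\<Sum>i\<in>I. c i * ee (of_int (e i) * \<tau>))) (at \<tau>)"
    if "\<tau> \<in> uhp" for \<tau>
    unfolding \<Theta>_def by (intro DERIV_diff \<Phi>' that DERIV_sum DERIV_cmult p)
  define c0 where "c0 = (\<Sum>i\<in>{i\<in>I. e i = 0}. c i)"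
  have \<Theta>1: "\<Theta> (\<tau> + 1) - \<Theta> \<tau> = c0" for \<tau>
  proof -
    have "\<Theta> (\<tau> + 1) - \<Theta> \<tau> = (\<Sum>i\<in>I. c i * (p (e i) (\<tau> + 1) - p (e i) \<tau>))"
      by (simp add: \<Theta>_def sum_subtractf right_diff_distrib)
    also have "\<dots> = (\<Sum>i\<in>I. if e i = 0 then c i else 0)" unfolding p1 by (intro sum.cong) auto
    also have "\<dots> = c0" unfolding c0_def using expansion(1) by (simp add: sum.inter_filter)
    finally show ?thesis .
  qed
  have "\<exists>c1. \<forall>\<tau>\<in>uhp. \<Phi> (\<tau> + 1) - \<Phi> \<tau> = c1"
  proof (rule has_field_derivative_zero_constant[OF convex_uhp])
    fix \<tau> assume \<tau>: "\<tau> \<in> uhp"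
    have "shift (of_int 1) \<in> \<Gamma>" using shift_in_Gamma0 Gamma0_subset by blast
    then have "\<phi> (\<tau> + 1) = \<phi> \<tau>" using wt[OF _ \<tau>, of "shift (of_int 1)"] by (simp add: autom_def)
    moreover have "((\<lambda>\<tau>. \<Phi> (\<tau> + 1)) has_field_derivative \<phi> (\<tau> + 1)) (at \<tau>)"
      using \<Phi>'[of "\<tau> + 1"] \<tau> by (simp add: DERIV_shift)
    ultimately have "((\<lambda>\<tau>. \<Phi> (\<tau> + 1) - \<Phi> \<tau>) has_field_derivative 0) (at \<tau>)"
      using DERIV_diff[OF _ \<Phi>'[OF \<tau>]] by fastforce
    then show "((\<lambda>\<tau>. \<Phi> (\<tau> + 1) - \<Phi> \<tau>) has_field_derivative 0) (at \<tau> within uhp)"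
      by (rule has_field_derivative_at_within)
  qed
  then obtain c1 where c1: "\<And>\<tau>. \<tau> \<in> uhp \<Longrightarrow> \<Phi> (\<tau> + 1) - \<Phi> \<tau> = c1" by blast
  have "c1 - c0 = 0"
  proof (rule translation_increment_tendsto[OF d expansion(2), of 1])
    show "\<Phi> (\<tau> + of_real 1) - \<Theta> (\<tau> + of_real 1) - (\<Phi> \<tau> - \<Theta> \<tau>) = c1 - c0" if "\<tau> \<in> uhp" for \<tau>
      using c1[OF that] \<Theta>1[of \<tau>] by (simp add: algebra_simps)
  qed
  moreover have "c1 = 0" by (rule residue_at_inf[OF hol wt cusps \<Phi>' c1])
  ultimately show ?thesis by (simp add: c0_def)
qed

end

subsection \<open>Harmonic functions and the generating function\<close>

text \<open>Harmonic functions of q with limit 0 at i\<infinity>. The two holomorphic parts are kept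
  because Re(\<zeta> u) is then the real part of \<zeta> P + cnj(\<zeta>) Q, to whose exponential
  the maximum modulus principle applies.\<close>

definition q_harmonic :: "(complex \<Rightarrow> complex) \<Rightarrow> bool" where
  "q_harmonic u \<longleftrightarrow> (\<exists>P Q. P holomorphic_on ball 0 1 \<and> Q holomorphic_on ball 0 1 \<and> P 0 = 0 \<and> Q 0 = 0 \<and>
     (\<forall>\<tau>\<in>uhp. u \<tau> = P (ee \<tau>) + cnj (Q (ee \<tau>))))"

lemma q_harmonicI:
  assumes "P holomorphic_on ball 0 1" "Q holomorphic_on ball 0 1" "P 0 = 0" "Q 0 = 0"
    "\<And>\<tau>. \<tau> \<in> uhp \<Longrightarrow> u \<tau> = P (ee \<tau>) + cnj (Q (ee \<tau>))"
  shows "q_harmonic u"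
  using assms unfolding q_harmonic_def by blast

lemma q_harmonic_zero: "q_harmonic (\<lambda>_. 0)"
  by (rule q_harmonicI[of "\<lambda>_. 0" "\<lambda>_. 0"]) simp_all

lemma q_harmonic_add:
  assumes "q_harmonic u" "q_harmonic v"
  shows "q_harmonic (\<lambda>\<tau>. u \<tau> + v \<tau>)"
proof -
  obtain P Q where u: "P holomorphic_on ball 0 1" "Q holomorphic_on ball 0 1" "P 0 = 0" "Q 0 = 0"
    "\<And>\<tau>. \<tau> \<in> uhp \<Longrightarrow> u \<tau> = P (ee \<tau>) + cnj (Q (ee \<tau>))"
    using assms(1) unfolding q_harmonic_def by blast
  obtain P' Q' where v: "P' holomorphic_on ball 0 1" "Q' holomorphic_on ball 0 1" "P' 0 = 0" "Q' 0 = 0"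
    "\<And>\<tau>. \<tau> \<in> uhp \<Longrightarrow> v \<tau> = P' (ee \<tau>) + cnj (Q' (ee \<tau>))"
    using assms(2) unfolding q_harmonic_def by blast
  show ?thesis
    by (rule q_harmonicI[of "\<lambda>z. P z + P' z" "\<lambda>z. Q z + Q' z"])
      (use u v in \<open>auto intro!: holomorphic_intros\<close>)
qed

lemma q_harmonic_cmult:
  assumes "q_harmonic u"
  shows "q_harmonic (\<lambda>\<tau>. c * u \<tau>)"
proof -
  obtain P Q where u: "P holomorphic_on ball 0 1" "Q holomorphic_on ball 0 1" "P 0 = 0" "Q 0 = 0"
    "\<And>\<tau>. \<tau> \<in> uhp \<Longrightarrow> u \<tau> = P (ee \<tau>) + cnj (Q (ee \<tau>))"
    using assms unfolding q_harmonic_def by blast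
  show ?thesis
    by (rule q_harmonicI[of "\<lambda>z. c * P z" "\<lambda>z. cnj c * Q z"])
      (use u in \<open>auto intro!: holomorphic_intros simp: algebra_simps\<close>)
qed

lemma q_harmonic_sum:
  assumes "\<And>i. i \<in> I \<Longrightarrow> q_harmonic (u i)"
  shows "q_harmonic (\<lambda>\<tau>. \<Sum>i\<in>I. u i \<tau>)"
  using assms by (induction I rule: infinite_finite_induct) (auto simp: q_harmonic_zero q_harmonic_add)

lemma q_harmonic_cong:
  assumes "q_harmonic u" "\<And>\<tau>. \<tau> \<in> uhp \<Longrightarrow> u \<tau> = v \<tau>"
  shows "q_harmonic v"
  using assms unfolding q_harmonic_def by auto

lemma q_harmonic_niebur:
  assumes "niebur_expansion n c j" "n \<ge> 1"
  shows "q_harmonic (\<lambda>\<tau>. j \<tau> - c 0 - inverse (ee \<tau> ^ n))"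
proof -
  have exp: "(\<lambda>l::nat. c (int l) * ee \<tau> ^ l) summable_on {1..}"
    "(\<lambda>l::nat. c (- int l) * cnj (ee \<tau>) ^ l) summable_on {1..}"
    "j \<tau> = inverse (ee \<tau> ^ n) - cnj (ee \<tau>) ^ n + c 0
       + (\<Sum>\<^sub>\<infinity>l\<in>{1::nat..}. c (int l) * ee \<tau> ^ l)
       + (\<Sum>\<^sub>\<infinity>l\<in>{1::nat..}. c (- int l) * cnj (ee \<tau>) ^ l)" if "\<tau> \<in> uhp" for \<tau>
    using assms(1) that unfolding niebur_expansion_def by blast+
  obtain P where P: "P holomorphic_on ball 0 1" "P 0 = 0"
    "\<And>\<tau>. \<tau> \<in> uhp \<Longrightarrow> ((\<lambda>l. c (int l) * ee \<tau> ^ l) has_sum P (ee \<tau>)) {1..}"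
    using q_series_holomorphic[of "\<lambda>l. c (int l)"] exp(1) by blast
  have conj: "cnj (c (- int l)) * ee \<tau> ^ l = cnj (c (- int l) * cnj (ee \<tau>) ^ l)" for l \<tau>
    by simp
  have "(\<lambda>l. cnj (c (- int l)) * ee \<tau> ^ l) summable_on {1..}" if "\<tau> \<in> uhp" for \<tau>
    unfolding conj summable_on_cnj_iff by (rule exp(2)[OF that])
  then obtain Q where Q: "Q holomorphic_on ball 0 1" "Q 0 = 0"
    "\<And>\<tau>. \<tau> \<in> uhp \<Longrightarrow> ((\<lambda>l. cnj (c (- int l)) * ee \<tau> ^ l) has_sum Q (ee \<tau>)) {1..}"
    using q_series_holomorphic[of "\<lambda>l. cnj (c (- int l))"] by blast
  have Q': "(\<Sum>\<^sub>\<infinity>l\<in>{1::nat..}. c (- int l) * cnj (ee \<tau>) ^ l) = cnj (Q (ee \<tau>))" if "\<tau> \<in> uhp" for \<tau>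
  proof -
    have "Q (ee \<tau>) = (\<Sum>\<^sub>\<infinity>l\<in>{1::nat..}. cnj (c (- int l) * cnj (ee \<tau>) ^ l))"
      using infsumI[OF Q(3)[OF that]] unfolding conj by simp
    then show ?thesis unfolding infsum_cnj by simp
  qed
  show ?thesis
  \<comment> \<open>The term - cnj(q)^n of the expansion is the conjugate of - q^n and is put into
    Q; it vanishes at 0 because n \<ge> 1.\<close>
  proof (rule q_harmonicI[of P "\<lambda>z. Q z - z ^ n"])
    show "j \<tau> - c 0 - inverse (ee \<tau> ^ n) = P (ee \<tau>) + cnj (Q (ee \<tau>) - ee \<tau> ^ n)" if "\<tau> \<in> uhp" for \<tau>
      using exp(3)[OF that] Q'[OF that] infsumI[OF P(3)[OF that]] by simp
  qed (use P Q assms(2) in \<open>auto intro!: holomorphic_intros\<close>)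
qed

lemma is_f_expansion:
  assumes "is_f \<Gamma> g m f" "m \<ge> g + 1"
  obtains a P where "P holomorphic_on ball 0 1" "P 0 = 0" "has_q_expansion 1 (- int m) a f"
    "a (- int m) = 1" "\<And>k. - int m < k \<Longrightarrow> k < - int g \<Longrightarrow> a k = 0" "a 0 = 0"
    "\<And>\<tau>. \<tau> \<in> uhp \<Longrightarrow> f \<tau> = inverse (ee \<tau> ^ m) + (\<Sum>l = 1..g. a (- int l) * inverse (ee \<tau> ^ l)) + P (ee \<tau>)"
proof -
  obtain a where a: "has_q_expansion 1 (- int m) a f" "a (- int m) = 1"
    "\<And>k. - int m < k \<Longrightarrow> k < - int g \<Longrightarrow> a k = 0" "a 0 = 0"
    using assms(1) unfolding is_f_def by blast
  obtain P where P: "P holomorphic_on ball 0 1" "P 0 = 0"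
    "\<And>\<tau>. \<tau> \<in> uhp \<Longrightarrow> f \<tau> = (\<Sum>k\<in>{- int m..0}. a k * ee (of_int k * \<tau> / of_nat 1)) + P (ee (\<tau> / of_nat 1))"
    using has_q_expansion_split[OF a(1)] by auto
  have "f \<tau> = inverse (ee \<tau> ^ m) + (\<Sum>l = 1..g. a (- int l) * inverse (ee \<tau> ^ l)) + P (ee \<tau>)" if "\<tau> \<in> uhp" for \<tau>
  proof -
    let ?t = "\<lambda>k. a k * ee (of_int k * \<tau>)"
    have "(\<Sum>k\<in>{- int m..0}. ?t k) = (\<Sum>k\<in>insert (- int m) ((\<lambda>l. - int l) ` {1..g}). ?t k)"
    proof (rule sum.mono_neutral_right)
      show "\<forall>k\<in>{- int m..0} - insert (- int m) ((\<lambda>l. - int l) ` {1..g}). ?t k = 0"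
      proof
        fix k assume k: "k \<in> {- int m..0} - insert (- int m) ((\<lambda>l. - int l) ` {1..g})"
        have "k = 0 \<or> k < - int g"
        proof (rule ccontr)
          assume "\<not> (k = 0 \<or> k < - int g)"
          then have "k = - int (nat (- k))" "nat (- k) \<in> {1..g}" using k by auto
          then show False using k by blast
        qed
        then show "?t k = 0" using k a(3,4) by auto
      qed
    qed (use assms(2) in auto)
    also have "\<dots> = ?t (- int m) + (\<Sum>k\<in>(\<lambda>l. - int l) ` {1..g}. ?t k)"
      using assms(2) by (intro sum.insert) auto
    also have "(\<Sum>k\<in>(\<lambda>l. - int l) ` {1..g}. ?t k) = (\<Sum>l = 1..g. a (- int l) * inverse (ee \<tau> ^ l))"
      by (subst sum.reindex) (auto simp: inj_on_def o_def ee_minus_of_nat_mult[simplified])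
    also have "?t (- int m) = inverse (ee \<tau> ^ m)" by (simp add: a(2) ee_minus_of_nat_mult[simplified])
    finally show ?thesis using P(3)[OF that] by simp
  qed
  then show ?thesis using that P a by blast
qed

text \<open>A Phragmen-Lindelof argument in the cusp. If u exceeded its maximum on the horocycle, u
  - \<epsilon> Im z would for small \<epsilon> attain its maximum strictly above it. The modulus of
  exp(H + \<i> \<epsilon> z) is exp(u - \<epsilon> Im z), so this function would be constant,
  against the smaller values on the horocycle.\<close>

lemma harmonic_attains_sup_on_horocycle:
  fixes u :: "complex \<Rightarrow> real"
  assumes H: "H holomorphic_on uhp" "\<And>\<tau>. \<tau> \<in> uhp \<Longrightarrow> u \<tau> = Re (H \<tau>)"
    and per: "\<And>\<tau>. \<tau> \<in> uhp \<Longrightarrow> u (\<tau> + of_real P) = u \<tau>" "P > 0"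
    and y\<^sub>0: "y\<^sub>0 > 0" and bound: "\<And>\<tau>. Im \<tau> \<ge> y\<^sub>0 \<Longrightarrow> u \<tau> \<le> B"
  obtains p where "p \<in> uhp" "\<And>\<tau>. Im \<tau> \<ge> y\<^sub>0 \<Longrightarrow> u \<tau> \<le> u p"
proof -
  have "continuous_on uhp (\<lambda>\<tau>. Re (H \<tau>))"
    by (intro continuous_intros holomorphic_on_imp_continuous_on H)
  then have "continuous_on uhp u" by (rule continuous_on_eq) (use H in auto)
  then have cont: "continuous_on {z. Im z \<ge> y\<^sub>0} u"
    by (rule continuous_on_subset) (use y\<^sub>0 in auto)
  have strip: "\<exists>x\<in>{0..P}. u (Complex x y\<^sub>0) = u \<tau>" if \<tau>: "Im \<tau> = y\<^sub>0" for \<tau>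
  proof -
    obtain \<tau>' where "Im \<tau>' = Im \<tau>" "0 \<le> Re \<tau>'" "Re \<tau>' \<le> P" "u \<tau>' = u \<tau>"
      by (rule translate_to_strip[of P y\<^sub>0 u \<tau>]) (use per y\<^sub>0 \<tau> in auto)
    moreover from this have "Complex (Re \<tau>') y\<^sub>0 = \<tau>'" using \<tau> by (simp add: complex_eq_iff)
    ultimately show ?thesis by (intro bexI[of _ "Re \<tau>'"]) auto
  qed
  have "continuous_on {0..P} (\<lambda>x. u (Complex x y\<^sub>0))"
    unfolding Complex_eq by (intro continuous_on_compose2[OF cont] continuous_intros) auto
  then obtain x where x: "\<And>x'. x' \<in> {0..P} \<Longrightarrow> u (Complex x' y\<^sub>0) \<le> u (Complex x y\<^sub>0)"
    using continuous_attains_sup[of "{0..P}" "\<lambda>x. u (Complex x y\<^sub>0)"] per(2) by fastforce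
  define p where "p = Complex x y\<^sub>0"
  have line: "u \<tau> \<le> u p" if \<tau>: "Im \<tau> = y\<^sub>0" for \<tau>
    using strip[OF \<tau>] x unfolding p_def by metis
  have "u \<tau> \<le> u p" if \<tau>: "Im \<tau> \<ge> y\<^sub>0" for \<tau>
  proof (rule ccontr)
    assume "\<not> u \<tau> \<le> u p"
    then have gt: "u \<tau> > u p" by simp
    have Im: "Im \<tau> > 0" using \<tau> y\<^sub>0 by linarith
    define \<epsilon> where "\<epsilon> = (u \<tau> - u p) / (2 * Im \<tau>)"
    have \<epsilon>: "\<epsilon> > 0" using gt Im by (simp add: \<epsilon>_def)
    define w where "w z = u z - \<epsilon> * Im z" for z
    have "\<epsilon> * Im \<tau> = (u \<tau> - u p) / 2" using Im by (simp add: \<epsilon>_def)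
    then have w\<tau>: "w \<tau> > u p" using gt unfolding w_def by argo
    have "continuous_on {z. Im z \<ge> y\<^sub>0} w"
      unfolding w_def by (intro continuous_intros cont)
    moreover have "w z \<le> w \<tau>" if z: "Im z \<ge> y\<^sub>0" "Im z > (B - u p) / \<epsilon>" for z
    proof -
      have "\<epsilon> * Im z > B - u p" using \<epsilon> z by (simp add: field_simps)
      then show ?thesis using bound[OF z(1)] w\<tau> by (simp add: w_def)
    qed
    ultimately obtain q where q: "Im q \<ge> y\<^sub>0" and glob: "\<And>z. Im z \<ge> y\<^sub>0 \<Longrightarrow> w z \<le> w q"
      using periodic_attains_sup[OF per(2), of y\<^sub>0 w \<tau> "(B - u p) / \<epsilon>"] per(1) \<tau> y\<^sub>0 by (auto simp: w_def)
    have wq: "w q > u p" using glob[OF \<tau>] w\<tau> by simp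
    have line_w: "w z < w q" if "Im z = y\<^sub>0" for z
    proof -
      have "\<epsilon> * Im z > 0" using \<epsilon> y\<^sub>0 that by simp
      then show ?thesis using line[OF that] wq by (simp add: w_def)
    qed
    have "Im q > y\<^sub>0" using q line_w[of q] by (auto simp: le_less)
    define E where "E z = exp (H z + \<i> * of_real \<epsilon> * z)" for z
    have normE: "cmod (E z) = exp (w z)" if "z \<in> uhp" for z
      using H(2)[OF that] by (simp add: E_def w_def)
    have "E constant_on uhp"
    proof (rule maximum_modulus_principle[where U = "{z. Im z > y\<^sub>0}" and \<xi> = q])
      show "E holomorphic_on uhp" unfolding E_def by (intro holomorphic_intros H)
      show "cmod (E z) \<le> cmod (E q)" if "z \<in> {z. Im z > y\<^sub>0}" for z
        using that glob[of z] \<open>Im q > y\<^sub>0\<close> y\<^sub>0 normE[of z] normE[of q] by simp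
    qed (use open_uhp connected_uhp open_halfspace_Im_gt[of y\<^sub>0] y\<^sub>0 \<open>Im q > y\<^sub>0\<close> in auto)
    then obtain k where k: "\<And>z. z \<in> uhp \<Longrightarrow> E z = k" unfolding constant_on_def by blast
    have "q \<in> uhp" "\<i> * of_real y\<^sub>0 \<in> uhp" using \<open>Im q > y\<^sub>0\<close> y\<^sub>0 by simp_all
    then have "w q = w (\<i> * of_real y\<^sub>0)" using k normE by (metis exp_inj_iff)
    then show False using line_w[of "\<i> * of_real y\<^sub>0"] by simp
  qed
  then show ?thesis using that[of p] y\<^sub>0 by (simp add: p_def)
qed

section \<open>Duality of f and h, vanishing of F, and the coefficients beyond g\<close>

context atkin_lehner_group
begin

text \<open>The constant term of f h is zero. The exponents -j of f and j of h meet only for j = m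
  and j = l: the coefficient of h vanishes for the other j \<le> g, that of f for g < j < m. At the
  other cusps f has a limit and h tends to 0.\<close>

lemma f_times_h_duality:
  assumes f: "f \<in> M0_inf \<Gamma>" "has_q_expansion 1 (- int m) a f" "a (- int m) = 1"
      "\<And>k. - int m < k \<Longrightarrow> k < - int g \<Longrightarrow> a k = 0" "a 0 = 0"
    and h: "h \<in> S2 \<Gamma>" "has_q_expansion 1 1 b h"
      "\<And>k. 1 \<le> k \<Longrightarrow> k \<le> int g \<Longrightarrow> b k = (if k = int l then 1 else 0)"
    and l: "1 \<le> l" "l \<le> g" "m \<ge> g + 1"
  shows "a (- int l) = - b (int m)"
proof -
  define \<phi> where "\<phi> \<tau> = f \<tau> * h \<tau>" for \<tau>
  have fm: "weakly_modular 0 \<Gamma> f" and hm: "weakly_modular 2 \<Gamma> h"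
    using f(1) h(1) by (simp_all add: M0_inf_def S2_def)
  \<comment> \<open>The pairs of exponents that can have a nonpositive sum, as f starts at -m and h
    at 1.\<close>
  define I where "I = {- int m..0} \<times> {1..int m}"
  define c where "c = (\<lambda>(k, j). a k * b j)"
  define e where "e = (\<lambda>(k, j). k + j :: int)"
  have "(\<Sum>i\<in>{i\<in>I. e i = 0}. c i) = 0"
  proof (rule constant_term_zero)
    show "\<phi> holomorphic_on uhp"
      unfolding \<phi>_def using fm hm by (intro holomorphic_intros) (simp_all add: weakly_modular_def)
    show "\<phi> (moeb \<gamma> \<tau>) = (autom \<gamma> \<tau>)\<^sup>2 * \<phi> \<tau>" if "\<gamma> \<in> \<Gamma>" "\<tau> \<in> uhp" for \<gamma> \<tau>
    proof -
      have "slash 0 \<gamma> f \<tau> = f \<tau>" "slash 2 \<gamma> h \<tau> = h \<tau>"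
        using fm hm that unfolding weakly_modular_def by blast+
      then have "f (moeb \<gamma> \<tau>) = f \<tau>" "h (moeb \<gamma> \<tau>) / (autom \<gamma> \<tau>)\<^sup>2 = h \<tau>"
        by (simp_all add: slash_def power_int_minus divide_inverse mult.commute)
      then show ?thesis using autom_nonzero[OF det_Gamma[OF that(1)] that(2)]
        by (simp add: \<phi>_def field_simps)
    qed
    show "((\<lambda>\<tau>. \<phi> (moeb \<sigma> \<tau>) / (autom \<sigma> \<tau>)\<^sup>2) \<longlongrightarrow> 0) inf_filter"
      if \<sigma>: "\<sigma> \<in> SL2Z" "ext_moeb \<sigma> None \<notin> orbit_of \<Gamma> None" for \<sigma>
    proof -
      have "cusp_ord_ge 0 0 \<sigma> f" using f(1) \<sigma> by (simp add: M0_inf_def)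
      then obtain L where "(slash 0 \<sigma> f \<longlongrightarrow> L) inf_filter" using cusp_ord_ge_0_tendsto by blast
      moreover have "(slash 2 \<sigma> h \<longlongrightarrow> 0) inf_filter"
        using h(1) \<sigma> by (intro cusp_ord_ge_1_tendsto) (simp add: S2_def)
      ultimately have "((\<lambda>\<tau>. slash 0 \<sigma> f \<tau> * slash 2 \<sigma> h \<tau>) \<longlongrightarrow> L * 0) inf_filter" by (rule tendsto_mult)
      then show ?thesis by (simp add: slash_def \<phi>_def power_int_minus divide_inverse mult_ac)
    qed
    show "finite I" by (simp add: I_def)
    show "((\<lambda>\<tau>. \<phi> \<tau> - (\<Sum>i\<in>I. c i * ee (of_int (e i) * \<tau>))) \<longlongrightarrow> 0) inf_filter"
    proof -
      obtain P where P: "P holomorphic_on ball 0 1" "P 0 = 0"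
        "\<And>\<tau>. \<tau> \<in> uhp \<Longrightarrow> f \<tau> = (\<Sum>k\<in>{- int m..0}. a k * ee (of_int k * \<tau> / of_nat 1)) + P (ee (\<tau> / of_nat 1))"
        using has_q_expansion_split[OF f(2)] by auto
      obtain P1 where P1: "P1 holomorphic_on ball 0 1" "P1 0 = 0"
        "\<And>\<tau>. \<tau> \<in> uhp \<Longrightarrow> h \<tau> = P1 (ee (\<tau> / of_nat 1))"
        using has_q_expansion_split[OF h(2)] by auto
      \<comment> \<open>Multiplication by q^(-m) makes exactly the terms of h beyond q^m have
        positive exponents, so the splitting separates them as q^m H.\<close>
      have "has_q_expansion 1 (1 - int m) (\<lambda>k. b (k + int m)) (\<lambda>\<tau>. h \<tau> * ee (- of_nat m * \<tau>))"
        unfolding has_q_expansion_def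
      proof
        fix \<tau> assume "\<tau> \<in> uhp"
        then have "((\<lambda>j. b j * ee (of_int j * \<tau> / of_nat 1)) has_sum h \<tau>) {1..}"
          using h(2) by (simp add: has_q_expansion_def)
        then have "((\<lambda>j. b j * ee (of_int j * \<tau> / of_nat 1) * ee (- of_nat m * \<tau>)) has_sum h \<tau> * ee (- of_nat m * \<tau>)) {1..}"
          by (rule has_sum_cmult_left)
        moreover have bij: "bij_betw (\<lambda>k. k + int m) {1 - int m..} {1..}"
          by (rule bij_betwI[of _ _ _ "\<lambda>j. j - int m"]) auto
        ultimately have "((\<lambda>k. b (k + int m) * ee (of_int (k + int m) * \<tau> / of_nat 1) * ee (- of_nat m * \<tau>))
            has_sum h \<tau> * ee (- of_nat m * \<tau>)) {1 - int m..}"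
          using has_sum_reindex_bij_betw[OF bij, of "\<lambda>j. b j * ee (of_int j * \<tau> / of_nat 1) * ee (- of_nat m * \<tau>)"]
          by blast
        moreover have "ee (of_int (k + int m) * \<tau> / of_nat 1) * ee (- of_nat m * \<tau>) = ee (of_int k * \<tau> / of_nat 1)" for k
          by (simp add: algebra_simps flip: ee_add)
        ultimately show "((\<lambda>k. b (k + int m) * ee (of_int k * \<tau> / of_nat 1)) has_sum h \<tau> * ee (- of_nat m * \<tau>)) {1 - int m..}"
          by (simp only: mult.assoc)
      qed
      then obtain H where H: "H holomorphic_on ball 0 1" "H 0 = 0"
        "\<And>\<tau>. \<tau> \<in> uhp \<Longrightarrow> h \<tau> * ee (- of_nat m * \<tau>) =
          (\<Sum>k\<in>{1 - int m..0}. b (k + int m) * ee (of_int k * \<tau> / of_nat 1)) + H (ee (\<tau> / of_nat 1))"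
        using has_q_expansion_split[of 1 "1 - int m" "\<lambda>k. b (k + int m)"] by auto
      define A where "A \<tau> = (\<Sum>k\<in>{- int m..0}. a k * ee (of_int k * \<tau>))" for \<tau>
      define B where "B \<tau> = (\<Sum>j\<in>{1..int m}. b j * ee (of_int j * \<tau>))" for \<tau>
      have h_eq: "h \<tau> = B \<tau> + ee \<tau> ^ m * H (ee \<tau>)" if "\<tau> \<in> uhp" for \<tau>
      proof -
        have "h \<tau> = ee \<tau> ^ m * (h \<tau> * ee (- of_nat m * \<tau>))" by (simp add: ee_minus_of_nat_mult[simplified])
        also have "\<dots> = (\<Sum>k\<in>{1 - int m..0}. ee \<tau> ^ m * (b (k + int m) * ee (of_int k * \<tau>))) + ee \<tau> ^ m * H (ee \<tau>)"
          by (simp add: H(3)[OF that, simplified] ring_distribs sum_distrib_left)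
        also have "(\<Sum>k\<in>{1 - int m..0}. ee \<tau> ^ m * (b (k + int m) * ee (of_int k * \<tau>))) = B \<tau>"
          unfolding B_def
        proof (rule sum.reindex_bij_witness[of _ "\<lambda>j. j - int m" "\<lambda>k. k + int m"])
          fix k
          show "b (k + int m) * ee (of_int (k + int m) * \<tau>) = ee \<tau> ^ m * (b (k + int m) * ee (of_int k * \<tau>))"
            using ee_of_nat_mult[of m \<tau>] by (simp add: ring_distribs ee_add mult_ac)
        qed auto
        finally show ?thesis .
      qed
      \<comment> \<open>A has a pole of order at most m in q, so A q^m is a polynomial W, and A (h -
        B) = W H tends to 0.\<close>
      define W where "W z = (\<Sum>k\<in>{- int m..0}. a k * z ^ nat (k + int m))" for z
      have W: "A \<tau> * ee \<tau> ^ m = W (ee \<tau>)" for \<tau>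
        unfolding A_def W_def sum_distrib_right
      proof (rule sum.cong)
        fix k assume "k \<in> {- int m..0}"
        then have "of_nat (nat (k + int m)) = (of_int (k + int m) :: complex)" by (simp add: of_nat_nat)
        then have "ee \<tau> ^ nat (k + int m) = ee (of_int (k + int m) * \<tau>)" by (metis ee_of_nat_mult)
        also have "\<dots> = ee (of_int k * \<tau>) * ee \<tau> ^ m"
          using ee_of_nat_mult[of m \<tau>] by (simp add: ring_distribs ee_add)
        finally show "a k * ee (of_int k * \<tau>) * ee \<tau> ^ m = a k * ee \<tau> ^ nat (k + int m)" by simp
      qed simp
      have lim: "((\<lambda>\<tau>. F (ee \<tau>)) \<longlongrightarrow> F 0) inf_filter" if "F holomorphic_on ball 0 1" for F
        using tendsto_q_function[OF that, of 1] by simp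
      have "((\<lambda>\<tau>. P (ee \<tau>) * P1 (ee \<tau>) + W (ee \<tau>) * H (ee \<tau>)) \<longlongrightarrow> P 0 * P1 0 + W 0 * H 0) inf_filter"
        unfolding W_def by (intro tendsto_add tendsto_mult lim P P1 H holomorphic_intros)
      moreover have "eventually (\<lambda>\<tau>. P (ee \<tau>) * P1 (ee \<tau>) + W (ee \<tau>) * H (ee \<tau>)
          = \<phi> \<tau> - (\<Sum>i\<in>I. c i * ee (of_int (e i) * \<tau>))) inf_filter"
        using eventually_uhp
      proof eventually_elim
        case (elim \<tau>)
        have "(\<Sum>i\<in>I. c i * ee (of_int (e i) * \<tau>)) = A \<tau> * B \<tau>"
          unfolding I_def c_def e_def A_def B_def sum_product sum.cartesian_product
          by (intro sum.cong) (auto simp: ring_distribs ee_add)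
        moreover have "f \<tau> = A \<tau> + P (ee \<tau>)" using P(3)[OF elim] by (simp add: A_def)
        moreover have "h \<tau> = P1 (ee \<tau>)" using P1(3)[OF elim] by simp
        moreover have "A \<tau> * h \<tau> = A \<tau> * B \<tau> + W (ee \<tau>) * H (ee \<tau>)"
          unfolding h_eq[OF elim] W[symmetric] by (simp add: algebra_simps)
        ultimately show ?case by (simp add: \<phi>_def algebra_simps)
      qed
      ultimately have "((\<lambda>\<tau>. \<phi> \<tau> - (\<Sum>i\<in>I. c i * ee (of_int (e i) * \<tau>))) \<longlongrightarrow> P 0 * P1 0 + W 0 * H 0) inf_filter"
        by (rule Lim_transform_eventually)
      then show ?thesis by (simp add: P H)
    qed
  qed
  moreover have "(\<Sum>i\<in>{i\<in>I. e i = 0}. c i) = (\<Sum>i\<in>{(- int m, int m), (- int l, int l)}. c i)"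
  proof (rule sum.mono_neutral_right)
    show "finite {i \<in> I. e i = 0}" by (simp add: I_def)
    show "{(- int m, int m), (- int l, int l)} \<subseteq> {i \<in> I. e i = 0}" using l by (auto simp: I_def e_def)
    show "\<forall>i\<in>{i \<in> I. e i = 0} - {(- int m, int m), (- int l, int l)}. c i = 0"
    proof
      fix i assume i: "i \<in> {i \<in> I. e i = 0} - {(- int m, int m), (- int l, int l)}"
      obtain k j where kj: "i = (k, j)" by (cases i)
      have j: "k = - j" "1 \<le> j" "j \<le> int m" "j \<noteq> int m" "j \<noteq> int l"
        using i by (auto simp: kj I_def e_def)
      show "c i = 0"
      proof (cases "j \<le> int g")
        case True
        then show ?thesis using h(3)[of j] j by (simp add: c_def kj)
      next
        case False
        then show ?thesis using f(4)[of k] j by (simp add: c_def kj)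
      qed
    qed
  qed
  moreover have "(\<Sum>i\<in>{(- int m, int m), (- int l, int l)}. c i) = b (int m) + a (- int l)"
    using l f(3) h(3)[of "int l"] by (simp add: c_def)
  ultimately show ?thesis by (simp add: add_eq_0_iff)
qed

text \<open>On each translate of Im z \<ge> 1/5 the function Re(\<zeta> F) is dominated by one of
  its values, and finitely many translates cover the half plane up to \<Gamma>. So it has a global
  maximum at an interior point, is constant by the maximum modulus principle, and equals its limit 0
  at i\<infinity>. The choices \<zeta> = 1 and \<zeta> = -\<i> give both parts of F.\<close>

lemma invariant_q_harmonic_zero:
  assumes F: "q_harmonic F" and inv: "\<And>\<gamma> \<tau>. \<gamma> \<in> \<Gamma> \<Longrightarrow> \<tau> \<in> uhp \<Longrightarrow> F (moeb \<gamma> \<tau>) = F \<tau>"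
    and bound: "\<And>\<sigma> y\<^sub>0. \<sigma> \<in> SL2Z \<Longrightarrow> ext_moeb \<sigma> None \<notin> orbit_of \<Gamma> None \<Longrightarrow> y\<^sub>0 > 0 \<Longrightarrow>
      \<exists>B. \<forall>\<tau>. Im \<tau> \<ge> y\<^sub>0 \<longrightarrow> cmod (F (moeb \<sigma> \<tau>)) \<le> B"
    and \<tau>: "\<tau> \<in> uhp"
  shows "F \<tau> = 0"
proof -
  obtain P Q where PQ: "P holomorphic_on ball 0 1" "Q holomorphic_on ball 0 1" "P 0 = 0" "Q 0 = 0"
    "\<And>\<tau>. \<tau> \<in> uhp \<Longrightarrow> F \<tau> = P (ee \<tau>) + cnj (Q (ee \<tau>))"
    using F unfolding q_harmonic_def by blast
  have bounded: "\<exists>B. \<forall>\<tau>. Im \<tau> \<ge> y\<^sub>0 \<longrightarrow> cmod (F (moeb \<sigma> \<tau>)) \<le> B"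
    if \<sigma>: "\<sigma> \<in> SL2Z" and y\<^sub>0: "y\<^sub>0 > 0" for \<sigma> y\<^sub>0
  proof (cases "ext_moeb \<sigma> None \<in> orbit_of \<Gamma> None")
    case False
    then show ?thesis using bound \<sigma> y\<^sub>0 by blast
  next
    case True
    have d: "det \<sigma> = 1" using \<sigma> by (rule det_SL2Z)
    obtain \<gamma> t where \<gamma>: "\<gamma> \<in> \<Gamma>" "\<sigma> = \<gamma> ** t" and t: "t$2$1 = 0" "det t = 1"
      using cusp_equivalent[OF True d] by blast
    have "t$1$1 \<noteq> 0" using t by (auto simp: det_2)
    \<comment> \<open>The height that \<open>t\<close> gives to a point of height
      \<open>y\<^sub>0\<close>.\<close>
    define y\<^sub>1 where "y\<^sub>1 = (t$1$1)\<^sup>2 * y\<^sub>0"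
    have y\<^sub>1: "y\<^sub>1 > 0" using y\<^sub>0 \<open>t$1$1 \<noteq> 0\<close> by (simp add: y\<^sub>1_def)
    obtain B1 where B1: "\<And>\<tau>. Im \<tau> \<ge> y\<^sub>1 \<Longrightarrow> cmod (P (ee (\<tau> / of_nat 1))) \<le> B1"
      using bounded_q_function[OF PQ(1) _ y\<^sub>1, of 1] by auto
    obtain B2 where B2: "\<And>\<tau>. Im \<tau> \<ge> y\<^sub>1 \<Longrightarrow> cmod (Q (ee (\<tau> / of_nat 1))) \<le> B2"
      using bounded_q_function[OF PQ(2) _ y\<^sub>1, of 1] by auto
    have "cmod (F (moeb \<sigma> \<tau>)) \<le> B1 + B2" if "Im \<tau> \<ge> y\<^sub>0" for \<tau>
    proof -
      have up: "\<tau> \<in> uhp" using that y\<^sub>0 by simp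
      have "F (moeb \<sigma> \<tau>) = F (moeb t \<tau>)"
        unfolding \<gamma>(2) using moeb_mult[OF t(2) up] inv[OF \<gamma>(1) moeb_uhp[OF t(2) up]] by simp
      also have "\<dots> = P (ee (moeb t \<tau>)) + cnj (Q (ee (moeb t \<tau>)))" by (rule PQ(5)[OF moeb_uhp[OF t(2) up]])
      also have "cmod \<dots> \<le> cmod (P (ee (moeb t \<tau>))) + cmod (Q (ee (moeb t \<tau>)))"
        using norm_triangle_ineq[of "P (ee (moeb t \<tau>))" "cnj (Q (ee (moeb t \<tau>)))"] by simp
      also have "\<dots> \<le> B1 + B2"
      proof -
        have "Im (moeb t \<tau>) = (t$1$1)\<^sup>2 * Im \<tau>"
          unfolding moeb_upper[OF t] by (simp flip: of_real_power)
        then have "Im (moeb t \<tau>) \<ge> y\<^sub>1" using that by (simp add: y\<^sub>1_def mult_left_mono)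
        then show ?thesis using B1[of "moeb t \<tau>"] B2[of "moeb t \<tau>"] by simp
      qed
      finally show ?thesis .
    qed
    then show ?thesis by blast
  qed
  have zero: "Re (\<zeta> * F \<tau>) = 0" for \<zeta>
  proof -
    define u where "u z = Re (\<zeta> * F z)" for z
    define H where "H z = \<zeta> * P (ee z) + cnj \<zeta> * Q (ee z)" for z
    have hol_ee: "ee holomorphic_on uhp" unfolding ee_def[abs_def] by (intro holomorphic_intros)
    have "ee ` uhp \<subseteq> ball 0 1" using ee_in_ball by blast
    then have "(\<lambda>z. P (ee z)) holomorphic_on uhp" "(\<lambda>z. Q (ee z)) holomorphic_on uhp"
      using holomorphic_on_compose_gen[OF hol_ee PQ(1)] holomorphic_on_compose_gen[OF hol_ee PQ(2)]
      by (simp_all only: o_def)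
    then have H: "H holomorphic_on uhp" unfolding H_def by (intro holomorphic_intros)
    have u: "u z = Re (H z)" if "z \<in> uhp" for z
      using PQ(5)[OF that] by (simp add: u_def H_def algebra_simps)
    have u_inv: "u (moeb \<gamma> z) = u z" if "\<gamma> \<in> \<Gamma>" "z \<in> uhp" for \<gamma> z
      using inv[OF that] by (simp add: u_def)
    have "\<exists>p\<in>uhp. \<forall>z. Im z \<ge> 1 / 5 \<longrightarrow> u (moeb \<sigma> z) \<le> u p" if \<sigma>: "\<sigma> \<in> SL2Z" for \<sigma>
    proof -
      have d: "det \<sigma> = 1" using \<sigma> by (rule det_SL2Z)
      obtain B where B: "\<And>z. Im z \<ge> 1 / 5 \<Longrightarrow> cmod (F (moeb \<sigma> z)) \<le> B"
        using bounded[OF \<sigma>, of "1 / 5"] by auto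
      obtain p where p: "p \<in> uhp" "\<And>z. Im z \<ge> 1 / 5 \<Longrightarrow> (u \<circ> moeb \<sigma>) z \<le> (u \<circ> moeb \<sigma>) p"
      proof (rule harmonic_attains_sup_on_horocycle[of "H \<circ> moeb \<sigma>" "u \<circ> moeb \<sigma>" "real N" "1 / 5" "cmod \<zeta> * B"])
        have "moeb \<sigma> holomorphic_on uhp"
          using moeb_has_derivative[OF d] open_uhp holomorphic_on_open by blast
        then show "H \<circ> moeb \<sigma> holomorphic_on uhp"
          using H by (rule holomorphic_on_compose_gen) (use moeb_uhp[OF d] in auto)
        show "(u \<circ> moeb \<sigma>) z = Re ((H \<circ> moeb \<sigma>) z)" if "z \<in> uhp" for z
          using u[OF moeb_uhp[OF d that]] by simp
        show "(u \<circ> moeb \<sigma>) (z + of_real (real N)) = (u \<circ> moeb \<sigma>) z" if z: "z \<in> uhp" for z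
        proof -
          obtain \<delta> where \<delta>: "\<delta> \<in> Gamma0 N" "moeb \<sigma> (z + of_real (real N)) = moeb \<delta> (moeb \<sigma> z)"
            using moeb_plus_nat[OF \<sigma> z] by blast
          then show ?thesis using u_inv[of \<delta> "moeb \<sigma> z"] moeb_uhp[OF d z] Gamma0_subset by auto
        qed
        show "(u \<circ> moeb \<sigma>) z \<le> cmod \<zeta> * B" if "Im z \<ge> 1 / 5" for z
        proof -
          have "u (moeb \<sigma> z) \<le> cmod (\<zeta> * F (moeb \<sigma> z))" unfolding u_def by (rule complex_Re_le_cmod)
          also have "\<dots> \<le> cmod \<zeta> * B" using B[OF that] by (simp add: norm_mult mult_left_mono)
          finally show ?thesis by simp
        qed
      qed (use N_pos in auto)
      then show ?thesis using moeb_uhp[OF d p(1)] by (intro bexI[of _ "moeb \<sigma> p"]) auto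
    qed
    then obtain p where p: "\<And>\<sigma>. \<sigma> \<in> SL2Z \<Longrightarrow> p \<sigma> \<in> uhp"
      "\<And>\<sigma> z. \<sigma> \<in> SL2Z \<Longrightarrow> Im z \<ge> 1 / 5 \<Longrightarrow> u (moeb \<sigma> z) \<le> u (p \<sigma>)"
      by metis
    obtain R rep where R: "finite R" "R \<subseteq> SL2Z" "\<And>\<sigma>. \<sigma> \<in> SL2Z \<Longrightarrow> rep \<sigma> \<in> R"
      "\<And>\<sigma>. \<sigma> \<in> SL2Z \<Longrightarrow> \<sigma> ** inv2 (rep \<sigma>) \<in> Gamma0 N"
      using finite_coset_reps[OF N_pos] by metis
    have "R \<noteq> {}" using R(3)[OF mat1_in_SL2Z] by blast
    then have "Max ((\<lambda>r. u (p r)) ` R) \<in> (\<lambda>r. u (p r)) ` R" using R(1) by simp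
    then obtain r0 where r0: "r0 \<in> R" "Max ((\<lambda>r. u (p r)) ` R) = u (p r0)" by blast
    then have r0_max: "u (p r) \<le> u (p r0)" if "r \<in> R" for r
      using Max_ge[of "(\<lambda>r. u (p r)) ` R" "u (p r)"] R(1) that by simp
    define p0 where "p0 = p r0"
    have p0: "p0 \<in> uhp" using p(1) r0(1) R(2) by (auto simp: p0_def)
    have max: "u z \<le> u p0" if "z \<in> uhp" for z
    proof -
      obtain \<sigma> z' where \<sigma>: "\<sigma> \<in> SL2Z" "Im z' \<ge> 1 / 5" "z = moeb \<sigma> z'"
        using SL2Z_reduction[OF \<open>z \<in> uhp\<close>] by blast
      define \<rho> where "\<rho> = rep \<sigma>"
      have \<rho>: "\<rho> \<in> R" "\<rho> \<in> SL2Z" using R(2,3) \<sigma> by (auto simp: \<rho>_def)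
      have d\<rho>: "det \<rho> = 1" using \<rho> det_SL2Z by blast
      have \<delta>: "\<sigma> ** inv2 \<rho> \<in> \<Gamma>" using R(4)[OF \<sigma>(1)] Gamma0_subset by (auto simp: \<rho>_def)
      have z': "z' \<in> uhp" using \<sigma> by simp
      have "\<sigma> = (\<sigma> ** inv2 \<rho>) ** \<rho>" by (simp add: inv2_left[OF d\<rho>] flip: matrix_mul_assoc)
      then have "z = moeb (\<sigma> ** inv2 \<rho>) (moeb \<rho> z')" using \<sigma>(3) moeb_mult[OF d\<rho> z'] by metis
      then have "u z = u (moeb \<rho> z')" using u_inv[OF \<delta> moeb_uhp[OF d\<rho> z']] by simp
      also have "\<dots> \<le> u (p \<rho>)" by (rule p(2)[OF \<rho>(2) \<sigma>(2)])
      also have "\<dots> \<le> u p0" unfolding p0_def by (rule r0_max[OF \<rho>(1)])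
      finally show ?thesis .
    qed
    define E where "E z = exp (H z)" for z
    have normE: "cmod (E z) = exp (u z)" if "z \<in> uhp" for z using u[OF that] by (simp add: E_def)
    have "E constant_on uhp"
    proof (rule maximum_modulus_principle[where U = uhp and \<xi> = p0])
      show "E holomorphic_on uhp" unfolding E_def by (intro holomorphic_intros H)
      show "cmod (E z) \<le> cmod (E p0)" if "z \<in> uhp" for z
        using max[OF that] normE[OF that] normE[OF p0] by simp
    qed (use open_uhp connected_uhp p0 in auto)
    then obtain k where k: "\<And>z. z \<in> uhp \<Longrightarrow> E z = k" unfolding constant_on_def by blast
    have const: "u z = u \<tau>" if "z \<in> uhp" for z
      using k normE that \<tau> by (metis exp_inj_iff)
    have "((\<lambda>z. \<zeta> * P (ee (z / of_nat 1)) + cnj \<zeta> * Q (ee (z / of_nat 1))) \<longlongrightarrow> \<zeta> * P 0 + cnj \<zeta> * Q 0) inf_filter"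
      by (intro tendsto_intros tendsto_q_function PQ) simp_all
    then have "(H \<longlongrightarrow> 0) inf_filter" by (simp add: H_def[abs_def] PQ)
    then have "((\<lambda>z. Re (H z)) \<longlongrightarrow> Re 0) inf_filter" by (rule tendsto_Re)
    moreover have "eventually (\<lambda>z. Re (H z) = u \<tau>) inf_filter"
      using eventually_uhp by eventually_elim (use u const in auto)
    ultimately have "((\<lambda>_. u \<tau>) \<longlongrightarrow> 0) inf_filter"
      using Lim_transform_eventually by fastforce
    then have "u \<tau> = 0"
      using tendsto_unique[OF inf_filter_neq_bot tendsto_const] by blast
    then show ?thesis by (simp add: u_def)
  qed
  show ?thesis using zero[of 1] zero[of "- \<i>"] by (simp add: complex_eq_iff)
qed

lemma f_eq_niebur:
  assumes m: "m \<ge> g + 1"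
    and G: "\<And>n. n \<ge> 1 \<Longrightarrow> niebur_continuation \<Gamma> n (G n)"
    and c: "\<And>n. n \<ge> 1 \<Longrightarrow> niebur_expansion n (c n) (\<lambda>\<tau>. G n \<tau> 1)"
    and f: "is_f \<Gamma> g m f"
    and h: "\<And>l. 1 \<le> l \<Longrightarrow> l \<le> g \<Longrightarrow> is_h \<Gamma> g l (h l)"
    and \<tau>: "\<tau> \<in> uhp"
  shows "niebur_J G c m \<tau> - (\<Sum>l = 1..g. fps_nth (q_fps (h l)) m * niebur_J G c l \<tau>) = f \<tau>"
proof -
  define J where "J n \<tau> = G n \<tau> 1 - c n 0" for n \<tau>
  have J: "niebur_J G c n \<tau> = J n \<tau>" if "n \<ge> 1" for n \<tau>
    using that by (simp add: niebur_J_def J_def)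
  have fM: "f \<in> M0_inf \<Gamma>" using f by (simp add: is_f_def)
  obtain a P where a: "P holomorphic_on ball 0 1" "P 0 = 0" "has_q_expansion 1 (- int m) a f"
    "a (- int m) = 1" "\<And>k. - int m < k \<Longrightarrow> k < - int g \<Longrightarrow> a k = 0" "a 0 = 0"
    "\<And>\<tau>. \<tau> \<in> uhp \<Longrightarrow> f \<tau> = inverse (ee \<tau> ^ m) + (\<Sum>l = 1..g. a (- int l) * inverse (ee \<tau> ^ l)) + P (ee \<tau>)"
    by (rule is_f_expansion[OF f m]) (rule that; assumption)
  have dual: "a (- int l) = - fps_nth (q_fps (h l)) m" if l: "1 \<le> l" "l \<le> g" for l
  proof -
    obtain b where b: "h l \<in> S2 \<Gamma>" "has_q_expansion 1 1 b (h l)"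
      "\<And>k. 1 \<le> k \<Longrightarrow> k \<le> int g \<Longrightarrow> b k = (if k = int l then 1 else 0)"
      using h[OF l] unfolding is_h_def by blast
    have "a (- int l) = - b (int m)"
      by (rule f_times_h_duality[OF fM a(3-6) b l m])
    moreover have "fps_nth (q_fps (h l)) m = b (int m)"
      using q_fps_eq[OF b(2)] m by simp
    ultimately show ?thesis by simp
  qed
  define F where "F \<tau> = J m \<tau> + (\<Sum>l = 1..g. a (- int l) * J l \<tau>) + (- 1) * f \<tau>" for \<tau>
  have "F \<tau> = 0"
  proof (rule invariant_q_harmonic_zero[OF _ _ _ \<tau>])
    have Jh: "q_harmonic (\<lambda>\<tau>. J n \<tau> - inverse (ee \<tau> ^ n))" if "n \<ge> 1" for n
      using q_harmonic_niebur[OF c[OF that] that] by (simp add: J_def)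
    have "q_harmonic (\<lambda>\<tau>. P (ee \<tau>))"
      by (rule q_harmonicI[of P "\<lambda>_. 0"]) (use a in auto)
    \<comment> \<open>The poles split off here add up to the polar part of f, so the combination
      equals F.\<close>
    then have "q_harmonic (\<lambda>\<tau>. (J m \<tau> - inverse (ee \<tau> ^ m))
        + (\<Sum>l = 1..g. a (- int l) * (J l \<tau> - inverse (ee \<tau> ^ l))) + (- 1) * P (ee \<tau>))"
      using m by (intro q_harmonic_add q_harmonic_sum q_harmonic_cmult Jh) auto
    then show "q_harmonic F"
      by (rule q_harmonic_cong) (simp add: F_def a(7) right_diff_distrib sum_subtractf)
    show "F (moeb \<gamma> z) = F z" if "\<gamma> \<in> \<Gamma>" "z \<in> uhp" for \<gamma> z
    proof -
      have "J n (moeb \<gamma> z) = J n z" if "n \<ge> 1" for n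
        using niebur_continuation_invariant[OF G[OF that] \<open>\<gamma> \<in> \<Gamma>\<close> \<open>z \<in> uhp\<close>] by (simp add: J_def)
      moreover have "slash 0 \<gamma> f z = f z"
        using fM that unfolding M0_inf_def weakly_modular_def by blast
      then have "f (moeb \<gamma> z) = f z" by (simp add: slash_def)
      ultimately show ?thesis using m by (simp add: F_def)
    qed
    show "\<exists>B. \<forall>z. Im z \<ge> y\<^sub>0 \<longrightarrow> cmod (F (moeb \<sigma> z)) \<le> B"
      if \<sigma>: "\<sigma> \<in> SL2Z" "ext_moeb \<sigma> None \<notin> orbit_of \<Gamma> None" and y\<^sub>0: "y\<^sub>0 > 0" for \<sigma> y\<^sub>0
    proof -
      have "\<exists>B. \<forall>z. Im z \<ge> y\<^sub>0 \<longrightarrow> cmod (J n (moeb \<sigma> z)) \<le> B" if n: "n \<ge> 1" for n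
      proof -
        obtain B where B: "\<And>z. Im z \<ge> y\<^sub>0 \<Longrightarrow> cmod (G n (moeb \<sigma> z) 1) \<le> B"
          using niebur_bounded_at_cusp[OF n G[OF n] \<sigma> y\<^sub>0] by blast
        have "cmod (J n (moeb \<sigma> z)) \<le> B + cmod (c n 0)" if "Im z \<ge> y\<^sub>0" for z
          using norm_triangle_ineq4[of "G n (moeb \<sigma> z) 1" "c n 0"] B[OF that] by (simp add: J_def)
        then show ?thesis by blast
      qed
      then obtain BJ where BJ: "\<And>n z. n \<ge> 1 \<Longrightarrow> Im z \<ge> y\<^sub>0 \<Longrightarrow> cmod (J n (moeb \<sigma> z)) \<le> BJ n" by metis
      have "cusp_ord_ge 0 0 \<sigma> f" using fM \<sigma> by (simp add: M0_inf_def)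
      then obtain Bf where Bf: "\<And>z. Im z \<ge> y\<^sub>0 \<Longrightarrow> cmod (slash 0 \<sigma> f z) \<le> Bf"
        using cusp_ord_ge_0_bounded y\<^sub>0 by blast
      have "cmod (F (moeb \<sigma> z)) \<le> BJ m + (\<Sum>l = 1..g. cmod (a (- int l)) * BJ l) + Bf" if z: "Im z \<ge> y\<^sub>0" for z
      proof -
        have "cmod (F (moeb \<sigma> z)) \<le> cmod (J m (moeb \<sigma> z) + (\<Sum>l = 1..g. a (- int l) * J l (moeb \<sigma> z)))
            + cmod ((- 1) * f (moeb \<sigma> z))"
          unfolding F_def by (rule norm_triangle_ineq)
        also have "cmod (J m (moeb \<sigma> z) + (\<Sum>l = 1..g. a (- int l) * J l (moeb \<sigma> z)))
            \<le> cmod (J m (moeb \<sigma> z)) + cmod (\<Sum>l = 1..g. a (- int l) * J l (moeb \<sigma> z))"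
          by (rule norm_triangle_ineq)
        also have "cmod (J m (moeb \<sigma> z)) \<le> BJ m" using BJ m z by simp
        also have "cmod (\<Sum>l = 1..g. a (- int l) * J l (moeb \<sigma> z)) \<le> (\<Sum>l = 1..g. cmod (a (- int l)) * BJ l)"
          by (rule sum_norm_le) (use BJ z in \<open>auto simp: norm_mult intro!: mult_left_mono\<close>)
        also have "cmod ((- 1) * f (moeb \<sigma> z)) \<le> Bf" using Bf[OF z] by (simp add: slash_def)
        finally show ?thesis by simp
      qed
      then show ?thesis by blast
    qed
  qed
  then have "f \<tau> = J m \<tau> + (\<Sum>l = 1..g. a (- int l) * J l \<tau>)" by (simp add: F_def)
  also have "(\<Sum>l = 1..g. a (- int l) * J l \<tau>) = - (\<Sum>l = 1..g. fps_nth (q_fps (h l)) m * niebur_J G c l \<tau>)"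
    unfolding sum_negf[symmetric] by (rule sum.cong) (simp_all add: dual J)
  finally show ?thesis using m by (simp add: J)
qed

end

section \<open>Comparison of the coefficients of q_2^n\<close>

theorem theorem1p16:
  fixes N g :: nat and S :: "nat set" and \<Gamma> :: "(real^2^2) set"
    and G :: "nat \<Rightarrow> complex \<Rightarrow> complex \<Rightarrow> complex" and c :: "nat \<Rightarrow> int \<Rightarrow> complex"
    and f h :: "nat \<Rightarrow> complex \<Rightarrow> complex" and \<tau>\<^sub>1 :: complex
  assumes "N > 0" and "S \<subseteq> exact_divisors N" and "\<Gamma> = Gamma_plus N S"
    and "has_genus (modular_curve \<Gamma>) g" and "\<not> inf_weierstrass \<Gamma> g"
    and "\<And>n. n \<ge> 1 \<Longrightarrow> niebur_continuation \<Gamma> n (G n)"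
    and "\<And>n. n \<ge> 1 \<Longrightarrow> niebur_expansion n (c n) (\<lambda>\<tau>. G n \<tau> 1)"
    and "\<And>\<tau>. \<tau> \<in> uhp \<Longrightarrow> f 0 \<tau> = 1"
    and "\<And>m \<tau>. 1 \<le> m \<Longrightarrow> m \<le> g \<Longrightarrow> \<tau> \<in> uhp \<Longrightarrow> f m \<tau> = 0"
    and "\<And>m. m \<ge> g + 1 \<Longrightarrow> is_f \<Gamma> g m (f m)"
    and "\<And>l. 1 \<le> l \<Longrightarrow> l \<le> g \<Longrightarrow> is_h \<Gamma> g l (h l)"
    and "\<tau>\<^sub>1 \<in> uhp"
  shows "Abs_fps (\<lambda>n. niebur_J G c n \<tau>\<^sub>1)
           - (\<Sum>l = 1..g. q_fps (h l) * fps_const (niebur_J G c l \<tau>\<^sub>1))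
         = Abs_fps (\<lambda>n. f n \<tau>\<^sub>1)"
proof (rule fps_ext)
  fix n
  interpret atkin_lehner_group N \<Gamma>
    unfolding assms(3) by (rule atkin_lehner_group_Gamma_plus[OF assms(1,2)])
  \<comment> \<open>For n \<le> g the normalisation of h_l gives a Kronecker delta. The sum over l
    therefore removes J_n for 1 \<le> n \<le> g and is empty of contributions at n = 0, where J_0 =
    1 = f_0 remains.\<close>
  have small: "fps_nth (q_fps (h l)) n = (if n = l then 1 else 0)" if l: "l \<in> {1..g}" and n: "n \<le> g" for l
  proof -
    have "is_h \<Gamma> g l (h l)" using assms(11) l by simp
    then obtain b where "has_q_expansion 1 1 b (h l)"
      "\<And>k. 1 \<le> k \<Longrightarrow> k \<le> int g \<Longrightarrow> b k = (if k = int l then 1 else 0)"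
      unfolding is_h_def by blast
    then show ?thesis using q_fps_eq[of b "h l"] l n by auto
  qed
  have "niebur_J G c n \<tau>\<^sub>1 - (\<Sum>l = 1..g. fps_nth (q_fps (h l)) n * niebur_J G c l \<tau>\<^sub>1) = f n \<tau>\<^sub>1"
  proof (cases "n \<le> g")
    case True
    then have "(\<Sum>l = 1..g. fps_nth (q_fps (h l)) n * niebur_J G c l \<tau>\<^sub>1)
        = (\<Sum>l = 1..g. if n = l then niebur_J G c l \<tau>\<^sub>1 else 0)"
      using small by (intro sum.cong) auto
    also have "\<dots> = (if n \<ge> 1 then niebur_J G c n \<tau>\<^sub>1 else 0)" using True by simp
    finally show ?thesis
      using True assms(8)[OF assms(12)] assms(9)[of n, OF _ True assms(12)]
      by (cases "n = 0") (simp_all add: niebur_J_def)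
  next
    case False
    then show ?thesis
      using f_eq_niebur[OF _ assms(6,7) assms(10) assms(11) assms(12)] by simp
  qed
  then show "fps_nth (Abs_fps (\<lambda>n. niebur_J G c n \<tau>\<^sub>1)
           - (\<Sum>l = 1..g. q_fps (h l) * fps_const (niebur_J G c l \<tau>\<^sub>1))) n
         = fps_nth (Abs_fps (\<lambda>n. f n \<tau>\<^sub>1)) n"
    by (simp add: fps_sum_nth)
qed

end
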